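(* Let $m=0$, $\sigma>0$, $\tau>0$ and $(\alpha,\beta)\in Q^*$, let $\mathcal{H}$ and $\mathcal{A}$ be the Hilbert space and the operator defined in the context, and suppose that $(T(t))_{t\ge0}$ is the $C_0$-semigroup of contractions on $\mathcal{H}$ generated by $\mathcal{A}$. Then for $t\ge1$, $$\big\|T(t)\,\mathcal{A}\,(I-\mathcal{A})^{-2}\big\|=O\big(t^{-\frac{\alpha}{2\alpha-\beta}}\big).$$ Moreover, this decay rate is sharp.
   Context: $H$ is an infinite-dimensional complex Hilbert space with inner product $(\cdot,\cdot)$ and norm $\|\cdot\|$; $A$ is a self-adjoint, positive definite operator on $H$ with compact resolvent (so its eigenvalues form a sequence $0<\mu_1\le\mu_2\le\cdots\to\infty$). For $s\in\mathbb{R}$, $A^s$ denotes the fractional power; $\mathcal{D}(A^s)$ carries the norm $\|A^s\cdot\|$, and for $s<0$ it denotes the completion of $H$ in this norm. Expressions such as $A^\alpha v$ are understood in these extrapolation spaces. Parameter region: $$Q^*=\Big\{(\alpha,\beta)\in[0,1]\times[0,1]\ :\ \alpha>\tfrac{\beta+1}{2}\Big\}.$$ For $m=0$ the space is $\mathcal{H}=\mathcal{D}(A^{1/2})\times H\times H\times H$ with inner product $$\langle U_1,U_2\rangle_{\mathcal{H}}=\sigma(A^{1/2}u_1,A^{1/2}u_2)+(v_1,v_2)+(\theta_1,\theta_2)+\tau(q_1,q_2),\quad U_i=(u_i,v_i,\theta_i,q_i)^\top .$$ The operator $\mathcal{A}:\mathcal{D}(\mathcal{A})\subseteq\mathcal{H}\to\mathcal{H}$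 is $$\mathcal{A}\,(u,v,\theta,q)^\top=\Big(v,\ -(\sigma Au-A^\alpha\theta),\ -A^\alpha v+A^{\beta/2}q,\ \tfrac1\tau(-q-A^{\beta/2}\theta)\Big)^\top,$$ with domain the set of all $(u,v,\theta,q)^\top\in\mathcal{H}$ such that $v\in\mathcal{D}(A^{1/2})$, $\sigma Au-A^\alpha\theta\in H$, $-A^\alpha v+A^{\beta/2}q\in H$, and $q+A^{\beta/2}\theta\in H$. It is the first-order form of the system $u_{tt}+\sigma Au-A^\alpha\theta=0$, $\theta_t-A^{\beta/2}q+A^\alpha u_t=0$, $\tau q_t+q+A^{\beta/2}\theta=0$. $\|\cdot\|$ of an operator is the operator norm on $\mathcal{H}$. "$f(t)=O(g(t))$ for $t\ge1$" means there is a constant $C$ with $|f(t)|\le Cg(t)$ for all $t\ge1$. "The decay rate is sharp" means that the exponent cannot be improved: there is no $\delta>0$ such that the norm is $O(t^{-\frac{\alpha}{2\alpha-\beta}-\delta})$ as $t\to\infty$. *)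

theory Defs
  imports "HOL-Analysis.Analysis"
begin

section \<open>Complex Hilbert spaces\<close>

text \<open>The inner product is linear in the first and conjugate linear in the second argument.\<close>

class complex_hilbert = banach +
  fixes scaleC :: "complex \<Rightarrow> 'a \<Rightarrow> 'a" (infixr \<open>*\<^sub>C\<close> 75)
    and cinner :: "'a \<Rightarrow> 'a \<Rightarrow> complex"
  assumes scaleC_add_right: "a *\<^sub>C (x + y) = a *\<^sub>C x + a *\<^sub>C y"
    and scaleC_add_left: "(a + b) *\<^sub>C x = a *\<^sub>C x + b *\<^sub>C x"
    and scaleC_scaleC: "a *\<^sub>C (b *\<^sub>C x) = (a * b) *\<^sub>C x"
    and scaleR_scaleC: "r *\<^sub>R x = complex_of_real r *\<^sub>C x"
    and cinner_commute: "cinner x y = cnj (cinner y x)"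
    and cinner_add_left: "cinner (x + y) z = cinner x z + cinner y z"
    and cinner_scaleC_left: "cinner (a *\<^sub>C x) y = a * cinner x y"
    and norm_eq_sqrt_cinner: "norm x = sqrt (Re (cinner x x))"

lemma vector_space_scaleC: "vector_space (scaleC :: complex \<Rightarrow> 'a::complex_hilbert \<Rightarrow> 'a)"
proof
  fix x :: 'a
  show "1 *\<^sub>C x = x"
    using scaleR_scaleC[of 1 x] by simp
qed (simp_all add: scaleC_add_right scaleC_add_left scaleC_scaleC)

lemma cinner_self_eq: "cinner x x = complex_of_real ((norm x)\<^sup>2)" for x :: "'a::complex_hilbert"
proof -
  have "Im (cinner x x) = 0"
    using arg_cong[OF cinner_commute[of x x], of Im] by simp
  moreover have "Re (cinner x x) \<ge> 0"
    using norm_ge_zero[of x] unfolding norm_eq_sqrt_cinner by (simp only: real_sqrt_ge_0_iff)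
  ultimately show ?thesis
    by (simp add: complex_eq_iff norm_eq_sqrt_cinner)
qed

definition complex_subspace :: "'a::complex_hilbert set \<Rightarrow> bool" where
  "complex_subspace S \<longleftrightarrow> module.subspace scaleC S"

definition infinite_dimensional :: "'a::complex_hilbert itself \<Rightarrow> bool" where
  "infinite_dimensional _ \<longleftrightarrow> \<not> (\<exists>B :: 'a set. finite B \<and> module.span scaleC B = UNIV)"

instantiation prod :: (complex_hilbert, complex_hilbert) complex_hilbert
begin

definition scaleC_prod :: "complex \<Rightarrow> 'a \<times> 'b \<Rightarrow> 'a \<times> 'b" where
  "scaleC_prod a x = (a *\<^sub>C fst x, a *\<^sub>C snd x)"

definition cinner_prod :: "'a \<times> 'b \<Rightarrow> 'a \<times> 'b \<Rightarrow> complex" where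
  "cinner_prod x y = cinner (fst x) (fst y) + cinner (snd x) (snd y)"

instance
proof
  fix a b :: complex and r :: real and x y z :: "'a \<times> 'b"
  show "a *\<^sub>C (x + y) = a *\<^sub>C x + a *\<^sub>C y"
    by (simp add: scaleC_prod_def scaleC_add_right)
  show "(a + b) *\<^sub>C x = a *\<^sub>C x + b *\<^sub>C x"
    by (simp add: scaleC_prod_def scaleC_add_left)
  show "a *\<^sub>C (b *\<^sub>C x) = (a * b) *\<^sub>C x"
    by (simp add: scaleC_prod_def scaleC_scaleC)
  show "r *\<^sub>R x = complex_of_real r *\<^sub>C x"
    by (simp add: scaleC_prod_def scaleR_prod_def scaleR_scaleC)
  show "cinner x y = cnj (cinner y x)"
    by (simp add: cinner_prod_def flip: cinner_commute)
  show "cinner (x + y) z = cinner x z + cinner y z"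
    by (simp add: cinner_prod_def cinner_add_left)
  show "cinner (a *\<^sub>C x) y = a * cinner x y"
    by (simp add: cinner_prod_def scaleC_prod_def cinner_scaleC_left distrib_left)
  show "norm x = sqrt (Re (cinner x x))"
    by (simp add: norm_prod_def cinner_prod_def cinner_self_eq)
qed

end

section \<open>Unbounded operators\<close>

text \<open>An unbounded operator is given by a domain \<open>D\<close> and a function of which only the values
  on \<open>D\<close> matter. The spaces are carriers \<open>X\<close>, with a norm \<open>N\<close> that need not be the norm of the
  type.\<close>

definition linear_operator ::
  "'a::complex_hilbert set \<Rightarrow> ('a \<Rightarrow> 'a) \<Rightarrow> bool" where
  "linear_operator D A \<longleftrightarrow> complex_subspace D \<and>
     (\<forall>x\<in>D. \<forall>y\<in>D. A (x + y) = A x + A y) \<and> (\<forall>c. \<forall>x\<in>D. A (c *\<^sub>C x) = c *\<^sub>C A x)"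

definition operator_graph :: "'a set \<Rightarrow> ('a \<Rightarrow> 'a) \<Rightarrow> ('a \<times> 'a) set" where
  "operator_graph D A = {(x, A x) | x. x \<in> D}"

definition adjoint_graph ::
  "'a::complex_hilbert set \<Rightarrow> ('a \<Rightarrow> 'a) \<Rightarrow> ('a \<times> 'a) set" where
  "adjoint_graph D A = {(y, z). \<forall>x\<in>D. cinner (A x) y = cinner x z}"

definition self_adjoint :: "'a::complex_hilbert set \<Rightarrow> ('a \<Rightarrow> 'a) \<Rightarrow> bool" where
  "self_adjoint D A \<longleftrightarrow>
     linear_operator D A \<and> closure D = UNIV \<and> adjoint_graph D A = operator_graph D A"

definition positive_definite :: "'a::complex_hilbert set \<Rightarrow> ('a \<Rightarrow> 'a) \<Rightarrow> bool" where
  "positive_definite D A \<longleftrightarrow>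
     (\<forall>x\<in>D. x \<noteq> 0 \<longrightarrow> cinner (A x) x \<in> \<real> \<and> Re (cinner (A x) x) > 0)"

definition resolvent ::
  "'a::complex_hilbert set \<Rightarrow> ('a \<Rightarrow> 'a) \<Rightarrow> complex \<Rightarrow> 'a \<Rightarrow> 'a" where
  "resolvent D A l = inv_into D (\<lambda>x. l *\<^sub>C x - A x)"

text \<open>Boundedness of the resolvent follows from compactness and is not required separately.\<close>

definition compact_resolvent :: "'a::complex_hilbert set \<Rightarrow> ('a \<Rightarrow> 'a) \<Rightarrow> bool" where
  "compact_resolvent D A \<longleftrightarrow>
     (\<exists>l. bij_betw (\<lambda>x. l *\<^sub>C x - A x) D UNIV \<and> compact (closure (resolvent D A l ` cball 0 1)))"

text \<open>The value is \<open>\<infinity>\<close> for an unbounded operator.\<close>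

definition operator_norm :: "'a set \<Rightarrow> ('a \<Rightarrow> real) \<Rightarrow> ('a \<Rightarrow> 'a) \<Rightarrow> ennreal" where
  "operator_norm X N L = (SUP x\<in>{x\<in>X. N x \<le> 1}. ennreal (N (L x)))"

section \<open>Semigroups\<close>

definition contraction_semigroup ::
  "'a::complex_hilbert set \<Rightarrow> ('a \<Rightarrow> real) \<Rightarrow> (real \<Rightarrow> 'a \<Rightarrow> 'a) \<Rightarrow> bool" where
  "contraction_semigroup X N T \<longleftrightarrow>
     (\<forall>t\<ge>0. linear_operator X (T t) \<and> (\<forall>x\<in>X. T t x \<in> X \<and> N (T t x) \<le> N x)) \<and>
     (\<forall>x\<in>X. T 0 x = x) \<and>
     (\<forall>s\<ge>0. \<forall>t\<ge>0. \<forall>x\<in>X. T (s + t) x = T s (T t x)) \<and>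
     (\<forall>x\<in>X. ((\<lambda>t. N (T t x - x)) \<longlongrightarrow> 0) (at_right 0))"

definition has_right_derivative_at_0 ::
  "('a::complex_hilbert \<Rightarrow> real) \<Rightarrow> (real \<Rightarrow> 'a \<Rightarrow> 'a) \<Rightarrow> 'a \<Rightarrow> 'a \<Rightarrow> bool" where
  "has_right_derivative_at_0 N T x y \<longleftrightarrow>
     ((\<lambda>h. N ((1 / h) *\<^sub>R (T h x - x) - y)) \<longlongrightarrow> 0) (at_right 0)"

definition is_generator ::
  "'a::complex_hilbert set \<Rightarrow> ('a \<Rightarrow> real) \<Rightarrow> (real \<Rightarrow> 'a \<Rightarrow> 'a) \<Rightarrow> 'a set \<Rightarrow> ('a \<Rightarrow> 'a) \<Rightarrow> bool" where
  "is_generator X N T D B \<longleftrightarrow>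
     D = {x\<in>X. \<exists>y\<in>X. has_right_derivative_at_0 N T x y} \<and>
     (\<forall>x\<in>D. B x \<in> X \<and> has_right_derivative_at_0 N T x (B x))"

section \<open>Fractional powers and extrapolation spaces\<close>

text \<open>Let \<open>A\<close> be self-adjoint, positive definite, with compact resolvent. Then \<open>H\<close> is the
  orthogonal sum of the eigenspaces of \<open>A\<close>, all eigenvalues are positive, and
  \<open>A\<^sup>s = \<Sum>\<^sub>\<mu> \<mu>\<^sup>s P\<^sub>\<mu>\<close> with the orthogonal projections \<open>P\<^sub>\<mu>\<close> onto the eigenspaces.
  All spaces \<open>D(A\<^sup>s)\<close>, \<open>s\<close> real, are realised inside one vector space, that of the formal sums
  \<open>\<Sum>\<^sub>\<mu> w\<^sub>\<mu>\<close> with \<open>w\<^sub>\<mu>\<close> in the eigenspace of \<open>\<mu>\<close>. Such a sum is encoded as the function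
  \<open>\<mu> \<mapsto> w\<^sub>\<mu>\<close>, which vanishes wherever \<open>\<mu>\<close> is not an eigenvalue. Vectors of \<open>H\<close>
  are identified with their expansions. The sums with
  \<open>\<Sum>\<^sub>\<mu> \<mu>\<^bsup>2s\<^esup> \<parallel>w\<^sub>\<mu>\<parallel>\<^sup>2 < \<infinity>\<close> form \<open>D(A\<^sup>s)\<close>. For \<open>s < 0\<close> this weighted
  Hilbert sum is complete and contains \<open>H\<close> as a dense subspace (finite sums are dense), with the
  norm \<open>\<parallel>A\<^sup>s x\<parallel>\<close> on \<open>H\<close>, so it is the completion of \<open>H\<close> in that norm.\<close>

definition eigenspace :: "'a::complex_hilbert set \<Rightarrow> ('a \<Rightarrow> 'a) \<Rightarrow> real \<Rightarrow> 'a set" where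
  "eigenspace D A \<mu> = {x\<in>D. A x = \<mu> *\<^sub>R x}"

definition eigenprojection ::
  "'a::complex_hilbert set \<Rightarrow> ('a \<Rightarrow> 'a) \<Rightarrow> real \<Rightarrow> 'a \<Rightarrow> 'a" where
  "eigenprojection D A \<mu> x =
     (THE y. y \<in> eigenspace D A \<mu> \<and> (\<forall>z\<in>eigenspace D A \<mu>. cinner (x - y) z = 0))"

definition expansion ::
  "'a::complex_hilbert set \<Rightarrow> ('a \<Rightarrow> 'a) \<Rightarrow> 'a \<Rightarrow> (real \<Rightarrow> 'a)" where
  "expansion D A x = (\<lambda>\<mu>. eigenprojection D A \<mu> x)"

definition power_space ::
  "'a::complex_hilbert set \<Rightarrow> ('a \<Rightarrow> 'a) \<Rightarrow> real \<Rightarrow> (real \<Rightarrow> 'a) set" where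
  "power_space D A s =
     {w. (\<forall>\<mu>. w \<mu> \<in> eigenspace D A \<mu>) \<and> (\<lambda>\<mu>. (\<mu> powr s * norm (w \<mu>))\<^sup>2) summable_on UNIV}"

definition fractional_power ::
  "'a::complex_hilbert set \<Rightarrow> ('a \<Rightarrow> 'a) \<Rightarrow> real \<Rightarrow> 'a \<Rightarrow> (real \<Rightarrow> 'a)" where
  "fractional_power D A s x = (\<lambda>\<mu>. (\<mu> powr s) *\<^sub>R expansion D A x \<mu>)"

definition in_H :: "'a::complex_hilbert set \<Rightarrow> ('a \<Rightarrow> 'a) \<Rightarrow> (real \<Rightarrow> 'a) \<Rightarrow> bool" where
  "in_H D A w \<longleftrightarrow> w \<in> range (expansion D A)"

definition vector_of :: "'a::complex_hilbert set \<Rightarrow> ('a \<Rightarrow> 'a) \<Rightarrow> (real \<Rightarrow> 'a) \<Rightarrow> 'a" where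
  "vector_of D A w = (THE x. expansion D A x = w)"

section \<open>The thermoelastic system\<close>

definition Q_star :: "(real \<times> real) set" where
  "Q_star = {(\<alpha>, \<beta>). \<alpha> \<in> {0..1} \<and> \<beta> \<in> {0..1} \<and> \<alpha> > (\<beta> + 1) / 2}"

definition state_space ::
  "'a::complex_hilbert set \<Rightarrow> ('a \<Rightarrow> 'a) \<Rightarrow> ('a \<times> 'a \<times> 'a \<times> 'a) set" where
  "state_space D A = {(u, v, \<theta>, q). expansion D A u \<in> power_space D A (1/2)}"

definition state_inner ::
  "'a::complex_hilbert set \<Rightarrow> ('a \<Rightarrow> 'a) \<Rightarrow> real \<Rightarrow> real \<Rightarrow>
     'a \<times> 'a \<times> 'a \<times> 'a \<Rightarrow> 'a \<times> 'a \<times> 'a \<times> 'a \<Rightarrow> complex" where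
  "state_inner D A \<sigma> \<tau> = (\<lambda>(u\<^sub>1, v\<^sub>1, \<theta>\<^sub>1, q\<^sub>1) (u\<^sub>2, v\<^sub>2, \<theta>\<^sub>2, q\<^sub>2).
     \<sigma> * cinner (vector_of D A (fractional_power D A (1/2) u\<^sub>1))
                (vector_of D A (fractional_power D A (1/2) u\<^sub>2))
     + cinner v\<^sub>1 v\<^sub>2 + cinner \<theta>\<^sub>1 \<theta>\<^sub>2 + \<tau> * cinner q\<^sub>1 q\<^sub>2)"

definition state_norm ::
  "'a::complex_hilbert set \<Rightarrow> ('a \<Rightarrow> 'a) \<Rightarrow> real \<Rightarrow> real \<Rightarrow> 'a \<times> 'a \<times> 'a \<times> 'a \<Rightarrow> real" where
  "state_norm D A \<sigma> \<tau> U = sqrt (Re (state_inner D A \<sigma> \<tau> U U))"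

text \<open>The following formal sums are \<open>\<sigma>Au - A\<^sup>\<alpha>\<theta>\<close>, \<open>-A\<^sup>\<alpha>v + A\<^bsup>\<beta>/2\<^esup>q\<close> and
  \<open>q + A\<^bsup>\<beta>/2\<^esup>\<theta>\<close>, formed in the extrapolation spaces.\<close>

definition stress ::
  "'a::complex_hilbert set \<Rightarrow> ('a \<Rightarrow> 'a) \<Rightarrow> real \<Rightarrow> real \<Rightarrow> 'a \<Rightarrow> 'a \<Rightarrow> (real \<Rightarrow> 'a)" where
  "stress D A \<sigma> \<alpha> u \<theta> =
     (\<lambda>\<mu>. \<sigma> *\<^sub>R fractional_power D A 1 u \<mu> - fractional_power D A \<alpha> \<theta> \<mu>)"

definition heat ::
  "'a::complex_hilbert set \<Rightarrow> ('a \<Rightarrow> 'a) \<Rightarrow> real \<Rightarrow> real \<Rightarrow> 'a \<Rightarrow> 'a \<Rightarrow> (real \<Rightarrow> 'a)" where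
  "heat D A \<alpha> \<beta> v q =
     (\<lambda>\<mu>. - fractional_power D A \<alpha> v \<mu> + fractional_power D A (\<beta>/2) q \<mu>)"

definition flux ::
  "'a::complex_hilbert set \<Rightarrow> ('a \<Rightarrow> 'a) \<Rightarrow> real \<Rightarrow> 'a \<Rightarrow> 'a \<Rightarrow> (real \<Rightarrow> 'a)" where
  "flux D A \<beta> \<theta> q =
     (\<lambda>\<mu>. expansion D A q \<mu> + fractional_power D A (\<beta>/2) \<theta> \<mu>)"

definition system_domain ::
  "'a::complex_hilbert set \<Rightarrow> ('a \<Rightarrow> 'a) \<Rightarrow> real \<Rightarrow> real \<Rightarrow> real \<Rightarrow> ('a \<times> 'a \<times> 'a \<times> 'a) set" where
  "system_domain D A \<sigma> \<alpha> \<beta> = {(u, v, \<theta>, q). (u, v, \<theta>, q) \<in> state_space D A \<and>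
     expansion D A v \<in> power_space D A (1/2) \<and>
     in_H D A (stress D A \<sigma> \<alpha> u \<theta>) \<and> in_H D A (heat D A \<alpha> \<beta> v q) \<and> in_H D A (flux D A \<beta> \<theta> q)}"

definition system_operator ::
  "'a::complex_hilbert set \<Rightarrow> ('a \<Rightarrow> 'a) \<Rightarrow> real \<Rightarrow> real \<Rightarrow> real \<Rightarrow> real \<Rightarrow>
     'a \<times> 'a \<times> 'a \<times> 'a \<Rightarrow> 'a \<times> 'a \<times> 'a \<times> 'a" where
  "system_operator D A \<sigma> \<tau> \<alpha> \<beta> = (\<lambda>(u, v, \<theta>, q).
     (v,
      - vector_of D A (stress D A \<sigma> \<alpha> u \<theta>),
      vector_of D A (heat D A \<alpha> \<beta> v q),
      (1 / \<tau>) *\<^sub>R (- vector_of D A (flux D A \<beta> \<theta> q))))"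

end

theory Submission
  imports Defs
begin

text \<open>The operator decouples over the eigenspaces of \<open>A\<close> into a four-dimensional system. Its matrix is
  uniformly diagonalisable for large eigenvalues \<open>\<mu>\<close>: one root tends to \<open>0\<close> along the negative
  axis, one stays near \<open>-1/\<tau>\<close>, and a complex pair has modulus about \<open>\<mu>\<^sup>\<alpha>\<close> and real part
  comparable to \<open>-\<mu>\<^bsup>\<beta> - 2\<alpha>\<^esup>\<close>. A root \<open>\<lambda>\<close> contributes
  \<open>e\<^bsup>t Re \<lambda>\<^esup> |\<lambda>| / |1 - \<lambda>|\<^sup>2\<close> to the norm, which is at most \<open>1/t\<close> for the real roots and of
  the order of \<open>\<mu>\<^bsup>-\<alpha>\<^esup> exp (- k t \<mu>\<^bsup>\<beta> - 2\<alpha>\<^esup>)\<close> for the pair. The supremum over \<open>\<mu>\<close> of the latter gives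
  the rate, attained at \<open>t = \<mu>\<^bsup>2\<alpha> - \<beta>\<^esup>\<close>. On the finitely many remaining eigenspaces the decay is
  exponential, by a Lyapunov function.\<close>

section \<open>Hilbert space geometry\<close>

text \<open>The matrices are not normal, so the location of the roots does not by itself bound the
  orbits; the constants of the diagonalisation must not depend on \<mu>. It is expressed by left
  eigenvectors: applied to an orbit, a left eigenvector yields a scalar exponential at once, and the
  generator and both resolvents become scalar factors, so neither a matrix exponential nor the
  inverse of an eigenvector matrix occurs. The condition \<alpha> > (\<beta> + 1)/2 says that the
  coupling of order \<mu>^\<alpha> outgrows the product of the two others, of order \<mu>^(1/2) and
  \<mu>^(\<beta>/2); this separates the roots and makes the left eigenvectors perturbations of a
  fixed basis. For moderate \<mu> roots may coincide and such a basis need not exist, hence the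
  Lyapunov form there; its constants depend on \<mu>, which is harmless because compactness leaves
  only finitely many such eigenvalues. The 1/t contribution of the real roots does not spoil the
  rate, because \<alpha>/(2\<alpha> - \<beta>) is at most 1. The spectral decomposition of A is
  derived from compactness of \<open>(I + A)^{-1}\<close>.\<close>

lemma scaleC_one [simp]: "1 *\<^sub>C x = (x :: 'a::complex_hilbert)"
  using scaleR_scaleC[of 1 x] by simp

lemma scaleC_zero_left [simp]: "0 *\<^sub>C x = (0 :: 'a::complex_hilbert)"
  using scaleR_scaleC[of 0 x] by simp

lemma scaleC_zero_right [simp]: "a *\<^sub>C 0 = (0 :: 'a::complex_hilbert)"
  using scaleC_add_right[of a 0 0] by simp

lemma scaleC_minus_right: "a *\<^sub>C (- x) = - (a *\<^sub>C (x :: 'a::complex_hilbert))"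
  using scaleC_add_right[of a x "- x"] by (simp add: add_eq_0_iff)

lemma scaleC_minus_left: "(- a) *\<^sub>C x = - (a *\<^sub>C (x :: 'a::complex_hilbert))"
  using scaleC_add_left[of a "- a" x] by (simp add: add_eq_0_iff)

lemma scaleC_diff_right: "a *\<^sub>C (x - y) = a *\<^sub>C x - a *\<^sub>C (y :: 'a::complex_hilbert)"
  using scaleC_add_right[of a x "- y"] by (simp add: scaleC_minus_right)

lemma scaleC_diff_left: "(a - b) *\<^sub>C x = a *\<^sub>C x - b *\<^sub>C (x :: 'a::complex_hilbert)"
  using scaleC_add_left[of a "- b" x] by (simp add: scaleC_minus_left)

lemma scaleC_scaleR: "a *\<^sub>C (r *\<^sub>R x) = (a * of_real r) *\<^sub>C (x :: 'a::complex_hilbert)"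
  by (simp add: scaleR_scaleC scaleC_scaleC)

lemma scaleR_of_scaleC: "r *\<^sub>R (a *\<^sub>C x) = (of_real r * a) *\<^sub>C (x :: 'a::complex_hilbert)"
  by (simp add: scaleR_scaleC scaleC_scaleC)

lemma cinner_add_right: "cinner x (y + z) = cinner x y + cinner x (z :: 'a::complex_hilbert)"
  by (metis cinner_add_left cinner_commute complex_cnj_add)

lemma cinner_scaleC_right: "cinner x (a *\<^sub>C y) = cnj a * cinner x (y :: 'a::complex_hilbert)"
  by (metis cinner_scaleC_left cinner_commute complex_cnj_mult)

lemma cinner_zero_left [simp]: "cinner 0 (x :: 'a::complex_hilbert) = 0"
  using cinner_add_left[of 0 0 x] by simp

lemma cinner_zero_right [simp]: "cinner (x :: 'a::complex_hilbert) 0 = 0"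
  using cinner_add_right[of x 0 0] by simp

lemma cinner_minus_left: "cinner (- x) y = - cinner x (y :: 'a::complex_hilbert)"
  using cinner_add_left[of x "- x" y] by (simp add: add_eq_0_iff)

lemma cinner_minus_right: "cinner x (- y) = - cinner x (y :: 'a::complex_hilbert)"
  using cinner_add_right[of x y "- y"] by (simp add: add_eq_0_iff)

lemma cinner_diff_left: "cinner (x - y) z = cinner x z - cinner y (z :: 'a::complex_hilbert)"
  using cinner_add_left[of x "- y" z] by (simp add: cinner_minus_left)

lemma cinner_diff_right: "cinner x (y - z) = cinner x y - cinner x (z :: 'a::complex_hilbert)"
  using cinner_add_right[of x y "- z"] by (simp add: cinner_minus_right)

lemma cinner_scaleR_left: "cinner (r *\<^sub>R x) y = of_real r * cinner x (y :: 'a::complex_hilbert)"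
  by (simp add: scaleR_scaleC cinner_scaleC_left)

lemma cinner_scaleR_right: "cinner x (r *\<^sub>R y) = of_real r * cinner x (y :: 'a::complex_hilbert)"
  by (simp add: scaleR_scaleC cinner_scaleC_right)

lemmas cinner_simps = cinner_add_left cinner_add_right cinner_diff_left cinner_diff_right
  cinner_minus_left cinner_minus_right cinner_scaleR_left cinner_scaleR_right
  cinner_scaleC_left cinner_scaleC_right

lemma cinner_sum_left: "cinner (sum f F) y = (\<Sum>i\<in>F. cinner (f i) (y :: 'a::complex_hilbert))"
  by (induction F rule: infinite_finite_induct) (simp_all add: cinner_add_left)

lemma norm_scaleC: "norm (a *\<^sub>C x) = cmod a * norm (x :: 'a::complex_hilbert)"
proof -
  have "cinner (a *\<^sub>C x) (a *\<^sub>C x) = (a * cnj a) * cinner x x"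
    by (simp add: cinner_scaleC_left cinner_scaleC_right)
  also have "\<dots> = of_real ((cmod a * norm x)\<^sup>2)"
    unfolding complex_norm_square[symmetric] cinner_self_eq by (simp add: power_mult_distrib)
  finally have "(norm (a *\<^sub>C x))\<^sup>2 = (cmod a * norm x)\<^sup>2"
    unfolding cinner_self_eq of_real_eq_iff .
  then show ?thesis
    by (rule power2_eq_imp_eq) simp_all
qed

lemma Re_cinner_commute: "Re (cinner x y) = Re (cinner y (x :: 'a::complex_hilbert))"
  by (subst cinner_commute) simp

lemma norm_add_square:
  "(norm (x + y))\<^sup>2 = (norm x)\<^sup>2 + 2 * Re (cinner x y) + (norm (y :: 'a::complex_hilbert))\<^sup>2"
proof -
  have "Re (cinner (x + y) (x + y)) = (norm x)\<^sup>2 + 2 * Re (cinner x y) + (norm y)\<^sup>2"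
    unfolding cinner_add_left cinner_add_right by (simp add: cinner_self_eq Re_cinner_commute[of y x])
  then show ?thesis
    by (simp add: cinner_self_eq)
qed

lemma norm_diff_square:
  "(norm (x - y))\<^sup>2 = (norm x)\<^sup>2 - 2 * Re (cinner x y) + (norm (y :: 'a::complex_hilbert))\<^sup>2"
  using norm_add_square[of x "- y"] by (simp add: cinner_minus_right)

lemma parallelogram_law:
  "(norm (x + y))\<^sup>2 + (norm (x - y))\<^sup>2 = 2 * (norm x)\<^sup>2 + 2 * (norm (y :: 'a::complex_hilbert))\<^sup>2"
  by (simp add: norm_add_square norm_diff_square)

text \<open>The class provides a norm with the triangle inequality, so Cauchy-Schwarz is read off
  from the squared triangle inequality instead of the other way round.\<close>

lemma Re_cinner_le: "Re (cinner x y) \<le> norm x * norm (y :: 'a::complex_hilbert)"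
proof -
  have "(norm (x + y))\<^sup>2 \<le> (norm x + norm y)\<^sup>2"
    by (intro power_mono norm_triangle_ineq norm_ge_zero)
  then show ?thesis
    by (simp add: norm_add_square power2_sum)
qed

lemma abs_Re_cinner_le: "\<bar>Re (cinner x y)\<bar> \<le> norm x * norm (y :: 'a::complex_hilbert)"
  using Re_cinner_le[of x y] Re_cinner_le[of "- x" y] by (simp add: cinner_minus_left abs_le_iff)

lemma norm_cinner_le: "cmod (cinner x y) \<le> norm x * norm (y :: 'a::complex_hilbert)"
proof (cases "cinner x y = 0")
  case False
  define c where "c = cnj (cinner x y) / of_real (cmod (cinner x y))"
  have "cmod c = 1"
    using False by (simp add: c_def norm_divide)
  have "cinner (c *\<^sub>C x) y = of_real (cmod (cinner x y))"
  proof -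
    have "cnj (cinner x y) * cinner x y
      = of_real (cmod (cinner x y)) * of_real (cmod (cinner x y))"
      by (metis complex_norm_square mult.commute of_real_mult power2_eq_square)
    then show ?thesis
      using False by (simp add: c_def cinner_scaleC_left)
  qed
  then show ?thesis
    using Re_cinner_le[of "c *\<^sub>C x" y] \<open>cmod c = 1\<close> by (simp add: norm_scaleC)
qed simp

lemma bounded_linear_cinner_left: "bounded_linear (\<lambda>x. cinner x (y :: 'a::complex_hilbert))"
  by (rule bounded_linear_intro[where K = "norm y"])
     (simp_all add: cinner_simps norm_cinner_le scaleR_conv_of_real)

lemma bounded_linear_cinner_right: "bounded_linear (\<lambda>x. cinner (y :: 'a::complex_hilbert) x)"
  by (rule bounded_linear_intro[where K = "norm y"])
     (simp_all add: cinner_simps norm_cinner_le scaleR_conv_of_real mult.commute[of _ "norm y"])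

lemma bounded_bilinear_scaleC:
  "bounded_bilinear (scaleC :: complex \<Rightarrow> 'a::complex_hilbert \<Rightarrow> 'a)"
proof
  show "\<exists>K. \<forall>a (b :: 'a). norm (a *\<^sub>C b) \<le> norm a * norm b * K"
    by (rule exI[of _ 1]) (simp add: norm_scaleC)
qed (simp_all add: scaleC_add_left scaleC_add_right scaleR_scaleC scaleC_scaleC
      scaleR_conv_of_real mult.commute)

lemma bounded_bilinear_Re_cinner:
  "bounded_bilinear (\<lambda>x y :: 'a::complex_hilbert. Re (cinner x y))"
proof
  show "\<exists>K. \<forall>a b :: 'a. norm (Re (cinner a b)) \<le> norm a * norm b * K"
    by (rule exI[of _ 1]) (simp add: abs_Re_cinner_le)
qed (simp_all add: cinner_simps)

section \<open>Orthogonal projections and orthogonal series\<close>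

lemma complex_subspace_iff:
  "complex_subspace (S :: 'a::complex_hilbert set) \<longleftrightarrow> 0 \<in> S \<and> (\<forall>x\<in>S. \<forall>y\<in>S. x + y \<in> S) \<and> (\<forall>c. \<forall>x\<in>S. c *\<^sub>C x \<in> S)"
  unfolding complex_subspace_def
  using module.subspace_def[of "scaleC :: complex \<Rightarrow> 'a::complex_hilbert \<Rightarrow> 'a" S]
    vector_space_scaleC by (simp add: module_iff_vector_space)

lemma complex_subspace_diff:
  assumes "complex_subspace S" "x \<in> S" "y \<in> S"
  shows "x - y \<in> S"
proof -
  have "x + (-1) *\<^sub>C y \<in> S"
    using assms unfolding complex_subspace_iff by blast
  then show ?thesis
    by (simp add: scaleC_minus_left)
qed

lemma complex_subspace_scaleR: "complex_subspace S \<Longrightarrow> x \<in> S \<Longrightarrow> r *\<^sub>R x \<in> S"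
  by (simp add: complex_subspace_iff scaleR_scaleC)

text \<open>A minimising sequence for the distance to \<open>S\<close> is Cauchy, and its limit is
  stationary in every direction of \<open>S\<close>. Used to show that the range of
  \<open>I + A\<close> is everything, and for the existence of the eigenprojections.\<close>

lemma ex_orthogonal_projection:
  fixes S :: "'a::complex_hilbert set"
  assumes S: "complex_subspace S" and "closed S"
  shows "\<exists>y\<in>S. \<forall>z\<in>S. cinner (x - y) z = 0"
proof -
  have "S \<noteq> {}"
    using S by (auto simp: complex_subspace_iff)
  define r where "r = infdist x S"
  have r_le: "r \<le> norm (x - y)" if "y \<in> S" for y
    using infdist_le[OF that, of x] by (simp add: r_def dist_norm)
  have "r \<ge> 0"
    by (simp add: r_def infdist_nonneg)
  have "\<exists>y\<in>S. norm (x - y) < r + 1 / real (Suc n)" for n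
  proof (rule ccontr)
    assume "\<not> ?thesis"
    then have "r + 1 / real (Suc n) \<le> infdist x S"
      using \<open>S \<noteq> {}\<close> by (auto simp: infdist_notempty dist_norm intro!: cINF_greatest)
    then show False
      by (simp add: r_def)
  qed
  then obtain y where y: "\<And>n. y n \<in> S" "\<And>n. norm (x - y n) < r + 1 / real (Suc n)"
    by metis
  have lim: "(\<lambda>n. norm (x - y n)) \<longlonglongrightarrow> r"
  proof (rule tendsto_sandwich[where f = "\<lambda>_. r" and h = "\<lambda>n. r + 1 / real (Suc n)"])
    show "(\<lambda>n. r + 1 / real (Suc n)) \<longlonglongrightarrow> r"
      using LIMSEQ_inverse_real_of_nat_add[of r] by (simp add: inverse_eq_divide)
    show "\<forall>\<^sub>F n in sequentially. r \<le> norm (x - y n)"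
      using y(1) r_le by simp
    show "\<forall>\<^sub>F n in sequentially. norm (x - y n) \<le> r + 1 / real (Suc n)"
      by (intro always_eventually allI less_imp_le y(2))
  qed (rule tendsto_const)
  \<comment> \<open>The parallelogram law, the midpoint of two elements of \<open>S\<close> being in \<open>S\<close>.\<close>
  have par: "(norm (y m - y n))\<^sup>2 \<le> 2 * (norm (x - y m))\<^sup>2 + 2 * (norm (x - y n))\<^sup>2 - 4 * r\<^sup>2" for m n
  proof -
    have "y m + y n \<in> S"
      using S y(1)[of m] y(1)[of n] unfolding complex_subspace_iff by blast
    then have "(1/2) *\<^sub>R (y m + y n) \<in> S"
      by (rule complex_subspace_scaleR[OF S])
    then have "r \<le> norm (x - (1/2) *\<^sub>R (y m + y n))"
      by (rule r_le)
    also have "x - (1/2) *\<^sub>R (y m + y n) = (1/2) *\<^sub>R ((x - y m) + (x - y n))"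
      by (metis add_diff_add scaleR_half_double scaleR_right_diff_distrib)
    also have "norm \<dots> = norm ((x - y m) + (x - y n)) / 2"
      by simp
    finally have "2 * r \<le> norm ((x - y m) + (x - y n))"
      by simp
    then have "4 * r\<^sup>2 \<le> (norm ((x - y m) + (x - y n)))\<^sup>2"
      using power_mono[of "2 * r" "norm ((x - y m) + (x - y n))" 2] \<open>r \<ge> 0\<close>
      by (simp only: power_mult_distrib) simp
    moreover have "(norm (y m - y n))\<^sup>2 = (norm ((x - y m) - (x - y n)))\<^sup>2"
      by (simp add: norm_minus_commute)
    ultimately show ?thesis
      using parallelogram_law[of "x - y m" "x - y n"] by linarith
  qed
  have "Cauchy y"
  proof (rule metric_CauchyI)
    fix e :: real assume "e > 0"
    have "(\<lambda>n. 2 * (norm (x - y n))\<^sup>2 - 2 * r\<^sup>2) \<longlonglongrightarrow> 2 * r\<^sup>2 - 2 * r\<^sup>2"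
      by (intro tendsto_intros lim)
    then have "\<forall>\<^sub>F n in sequentially. 2 * (norm (x - y n))\<^sup>2 - 2 * r\<^sup>2 < e\<^sup>2 / 2"
      by (rule order_tendstoD(2)) (use \<open>e > 0\<close> in simp)
    then obtain n0 where n0: "\<And>n. n \<ge> n0 \<Longrightarrow> 2 * (norm (x - y n))\<^sup>2 - 2 * r\<^sup>2 < e\<^sup>2 / 2"
      by (auto simp: eventually_sequentially)
    have "dist (y m) (y n) < e" if "m \<ge> n0" "n \<ge> n0" for m n
    proof -
      have "(norm (y m - y n))\<^sup>2 < e\<^sup>2"
        using par[of m n] n0[OF that(1)] n0[OF that(2)] by linarith
      then show ?thesis
        using \<open>e > 0\<close> by (simp add: dist_norm power2_less_imp_less)
    qed
    then show "\<exists>M. \<forall>m\<ge>M. \<forall>n\<ge>M. dist (y m) (y n) < e"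
      by blast
  qed
  then obtain l where l: "y \<longlonglongrightarrow> l"
    using Cauchy_convergent convergent_def by blast
  have "l \<in> S"
    using closed_sequentially[OF \<open>closed S\<close> _ l] y(1) by blast
  have "(\<lambda>n. norm (x - y n)) \<longlonglongrightarrow> norm (x - l)"
    by (intro tendsto_intros l)
  then have norm_l: "norm (x - l) = r"
    using lim LIMSEQ_unique by blast
  have "cinner (x - l) z = 0" if "z \<in> S" for z
  proof (cases "z = 0")
    case False
    \<comment> \<open>The best multiple of \<open>z\<close>: subtracting it lowers the squared
      distance by \<open>|(x - l, z)|^2 / norm z^2\<close>, which minimality forbids unless it is
      0.\<close>
    define c where "c = cinner (x - l) z / of_real ((norm z)\<^sup>2)"
    have "l + c *\<^sub>C z \<in> S"
      using S \<open>l \<in> S\<close> that unfolding complex_subspace_iff by blast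
    then have "r \<le> norm ((x - l) - c *\<^sub>C z)"
      using r_le[of "l + c *\<^sub>C z"] by (simp add: algebra_simps)
    then have "r\<^sup>2 \<le> (norm ((x - l) - c *\<^sub>C z))\<^sup>2"
      using \<open>r \<ge> 0\<close> by (simp add: power_mono)
    moreover have "Re (cinner (x - l) (c *\<^sub>C z)) = (cmod (cinner (x - l) z))\<^sup>2 / (norm z)\<^sup>2"
    proof -
      have "cnj c * cinner (x - l) z = of_real ((cmod (cinner (x - l) z))\<^sup>2 / (norm z)\<^sup>2)"
        unfolding c_def using complex_norm_square[of "cinner (x - l) z"] by (simp add: mult.commute)
      then show ?thesis
        by (simp only: cinner_scaleC_right Re_complex_of_real)
    qed
    moreover have "(norm (c *\<^sub>C z))\<^sup>2 = (cmod (cinner (x - l) z))\<^sup>2 / (norm z)\<^sup>2"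
    proof -
      have "cmod c = cmod (cinner (x - l) z) / (norm z)\<^sup>2"
        by (simp add: c_def norm_divide norm_power)
      then show ?thesis
        using False by (simp add: norm_scaleC power2_eq_square)
    qed
    ultimately have "(cmod (cinner (x - l) z))\<^sup>2 / (norm z)\<^sup>2 \<le> 0"
      by (simp add: norm_diff_square norm_l)
    then have "(cmod (cinner (x - l) z))\<^sup>2 \<le> 0"
      using False by (simp add: divide_le_0_iff)
    then show ?thesis
      by simp
  qed simp
  then show ?thesis
    using \<open>l \<in> S\<close> by blast
qed

lemma norm_sum_orthogonal:
  fixes f :: "'i \<Rightarrow> 'a::complex_hilbert"
  assumes "finite F" "\<And>i j. i \<in> F \<Longrightarrow> j \<in> F \<Longrightarrow> i \<noteq> j \<Longrightarrow> cinner (f i) (f j) = 0"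
  shows "(norm (sum f F))\<^sup>2 = (\<Sum>i\<in>F. (norm (f i))\<^sup>2)"
  using assms
proof (induction F)
  case (insert i F)
  have "cinner (sum f F) (f i) = 0"
    unfolding cinner_sum_left using insert by (intro sum.neutral) auto
  then have "Re (cinner (f i) (sum f F)) = 0"
    by (simp add: Re_cinner_commute[of "f i"])
  then show ?case
    using insert by (simp add: norm_add_square)
qed simp

text \<open>By Pythagoras the sum over a finite difference set is as small as the corresponding
  piece of the scalar series. Convergence is in general not absolute, so completeness is applied
  along the filter of finite subsets.\<close>

lemma summable_on_orthogonal:
  fixes f :: "'i \<Rightarrow> 'a::complex_hilbert"
  assumes orth: "\<And>i j. i \<noteq> j \<Longrightarrow> cinner (f i) (f j) = 0"
    and sq: "(\<lambda>i. (norm (f i))\<^sup>2) summable_on UNIV"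
  shows "f summable_on UNIV"
proof -
  have "\<exists>P. eventually P (finite_subsets_at_top UNIV) \<and>
          (\<forall>F G. P F \<and> P G \<longrightarrow> dist (sum f F) (sum f G) < e)" if "e > 0" for e
  proof -
    obtain s where "((\<lambda>i. (norm (f i))\<^sup>2) has_sum s) UNIV"
      using sq by (auto simp: summable_on_def)
    then have "((\<lambda>F. \<Sum>i\<in>F. (norm (f i))\<^sup>2) \<longlongrightarrow> s) (finite_subsets_at_top UNIV)"
      by (simp add: has_sum_def)
    then have "\<forall>\<^sub>F F in finite_subsets_at_top UNIV. dist (\<Sum>i\<in>F. (norm (f i))\<^sup>2) s < e\<^sup>2 / 8"
      using that by (intro tendstoD) auto
    then obtain F0 where F0: "finite F0"
      "\<And>F. finite F \<Longrightarrow> F0 \<subseteq> F \<Longrightarrow> dist (\<Sum>i\<in>F. (norm (f i))\<^sup>2) s < e\<^sup>2 / 8"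
      by (auto simp: eventually_finite_subsets_at_top)
    have near: "norm (sum f F - sum f F0) < e / 2" if F: "finite F" "F0 \<subseteq> F" for F
    proof -
      have "sum f F - sum f F0 = sum f (F - F0)"
        using F by (simp add: sum_diff)
      then have "(norm (sum f F - sum f F0))\<^sup>2 = (\<Sum>i\<in>F - F0. (norm (f i))\<^sup>2)"
        using F by (simp only:) (intro norm_sum_orthogonal orth finite_Diff)
      also have "\<dots> = (\<Sum>i\<in>F. (norm (f i))\<^sup>2) - (\<Sum>i\<in>F0. (norm (f i))\<^sup>2)"
        using F F0(1) by (simp add: sum_diff)
      also have "\<dots> < e\<^sup>2 / 4"
        using F0(2)[OF F] F0(2)[OF F0(1) order_refl] unfolding dist_real_def by linarith
      also have "\<dots> = (e / 2)\<^sup>2"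
        by (simp add: power_divide)
      finally show ?thesis
        by (rule power2_less_imp_less) (use \<open>e > 0\<close> in simp)
    qed
    have "dist (sum f F) (sum f G) < e" if "finite F" "F0 \<subseteq> F" "finite G" "F0 \<subseteq> G" for F G
    proof -
      have "dist (sum f F) (sum f G) \<le> norm (sum f F - sum f F0) + norm (sum f G - sum f F0)"
        using dist_triangle2[of "sum f F" "sum f G" "sum f F0"] by (simp only: dist_norm)
      then show ?thesis
        using near[OF that(1,2)] near[OF that(3,4)] by linarith
    qed
    then show ?thesis
      using F0(1) by (intro exI[of _ "\<lambda>F. finite F \<and> F0 \<subseteq> F"])
        (auto simp: eventually_finite_subsets_at_top)
  qed
  then have "cauchy_filter (filtermap (sum f) (finite_subsets_at_top UNIV))"
    unfolding cauchy_filter_metric_filtermap by blast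
  then obtain l where "((sum f) \<longlongrightarrow> l) (finite_subsets_at_top UNIV)"
    using complete_uniform[of "UNIV :: 'a set"] complete_UNIV
    by (force simp add: filterlim_def)
  then show ?thesis
    by (auto simp: summable_on_def has_sum_def)
qed

section \<open>Self-adjoint positive operators with compact resolvent\<close>

locale elliptic_operator =
  fixes D :: "'h::complex_hilbert set" and A :: "'h \<Rightarrow> 'h"
  assumes self_adjoint: "self_adjoint D A"
    and positive: "positive_definite D A"
    and compact_res: "compact_resolvent D A"
begin

lemma subspace_D: "complex_subspace D"
  and A_add: "x \<in> D \<Longrightarrow> y \<in> D \<Longrightarrow> A (x + y) = A x + A y"
  and A_scaleC: "x \<in> D \<Longrightarrow> A (c *\<^sub>C x) = c *\<^sub>C A x"
  using self_adjoint by (auto simp: self_adjoint_def linear_operator_def)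

lemma D_add: "x \<in> D \<Longrightarrow> y \<in> D \<Longrightarrow> x + y \<in> D"
  and D_scaleC: "x \<in> D \<Longrightarrow> c *\<^sub>C x \<in> D"
  and D_zero: "0 \<in> D"
  using subspace_D by (auto simp: complex_subspace_iff)

lemma D_scaleR: "x \<in> D \<Longrightarrow> r *\<^sub>R x \<in> D"
  by (simp add: scaleR_scaleC D_scaleC)

lemma D_diff: "x \<in> D \<Longrightarrow> y \<in> D \<Longrightarrow> x - y \<in> D"
  using complex_subspace_diff[OF subspace_D] .

lemma A_scaleR: "x \<in> D \<Longrightarrow> A (r *\<^sub>R x) = r *\<^sub>R A x"
  by (simp add: scaleR_scaleC A_scaleC)

lemma A_diff:
  assumes "x \<in> D" "y \<in> D"
  shows "A (x - y) = A x - A y"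
  using A_add[OF assms(1) D_scaleR[OF assms(2), of "-1"]] A_scaleR[OF assms(2), of "-1"] by simp

lemma A_zero: "A 0 = 0"
  using A_scaleC[OF D_zero, of 0] by simp

lemma A_symmetric:
  assumes "x \<in> D" "y \<in> D"
  shows "cinner (A x) y = cinner x (A y)"
proof -
  have "(y, A y) \<in> adjoint_graph D A"
    using self_adjoint assms(2) by (auto simp: self_adjoint_def operator_graph_def)
  then show ?thesis
    using assms(1) by (simp add: adjoint_graph_def)
qed

text \<open>The half of self-adjointness that produces domain membership. Closedness of
  \<open>A\<close> and surjectivity of \<open>I + A\<close> both rest on it.\<close>

lemma A_maximal:
  assumes "\<And>x. x \<in> D \<Longrightarrow> cinner (A x) y = cinner x z"
  shows "y \<in> D" "A y = z"
proof -
  have "(y, z) \<in> adjoint_graph D A"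
    using assms by (simp add: adjoint_graph_def)
  then have "(y, z) \<in> operator_graph D A"
    using self_adjoint by (simp add: self_adjoint_def)
  then show "y \<in> D" "A y = z"
    by (auto simp: operator_graph_def)
qed

lemma A_nonneg: "x \<in> D \<Longrightarrow> Re (cinner (A x) x) \<ge> 0"
  using positive by (cases "x = 0") (auto simp: positive_definite_def less_imp_le)

lemma A_closed:
  assumes "\<And>n. x n \<in> D" "x \<longlonglongrightarrow> l" "(\<lambda>n. A (x n)) \<longlonglongrightarrow> m"
  shows "l \<in> D" "A l = m"
proof -
  have "cinner (A y) l = cinner y m" if "y \<in> D" for y
  proof (rule LIMSEQ_unique)
    show "(\<lambda>n. cinner (A y) (x n)) \<longlonglongrightarrow> cinner (A y) l"
      by (intro bounded_linear.tendsto[OF bounded_linear_cinner_right] assms)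
    have "(\<lambda>n. cinner y (A (x n))) \<longlonglongrightarrow> cinner y m"
      by (intro bounded_linear.tendsto[OF bounded_linear_cinner_right] assms)
    then show "(\<lambda>n. cinner (A y) (x n)) \<longlonglongrightarrow> cinner y m"
      using A_symmetric[OF that assms(1)] by simp
  qed
  then show "l \<in> D" "A l = m"
    using A_maximal by blast+
qed

section \<open>The bounded inverse of I + A\<close>

lemma norm_le_shift:
  assumes "x \<in> D"
  shows "norm x \<le> norm (x + A x)" "norm (A x) \<le> norm (x + A x)"
proof -
  have *: "(norm (x + A x))\<^sup>2 = (norm x)\<^sup>2 + 2 * Re (cinner (A x) x) + (norm (A x))\<^sup>2"
    by (simp add: norm_add_square Re_cinner_commute[of x])
  have "(norm x)\<^sup>2 \<le> (norm (x + A x))\<^sup>2" "(norm (A x))\<^sup>2 \<le> (norm (x + A x))\<^sup>2"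
    unfolding * using A_nonneg[OF assms] by auto
  then show "norm x \<le> norm (x + A x)" "norm (A x) \<le> norm (x + A x)"
    by (auto intro: power2_le_imp_le)
qed

text \<open>The lower bound for \<open>x + A x\<close> and closedness of \<open>A\<close> make the
  range closed. A vector \<open>w\<close> orthogonal to the range satisfies the adjoint relation
  with \<open>A w = - w\<close>, which contradicts positivity unless \<open>w = 0\<close>.\<close>

lemma shift_surjective: "\<exists>x\<in>D. x + A x = y"
proof -
  define S where "S = (\<lambda>x. x + A x) ` D"
  have "complex_subspace S"
    unfolding complex_subspace_iff S_def
  proof (intro conjI ballI allI)
    show "0 \<in> (\<lambda>x. x + A x) ` D"
      by (rule image_eqI[of _ _ 0]) (auto simp: A_zero D_zero)
    fix a b assume "a \<in> (\<lambda>x. x + A x) ` D" "b \<in> (\<lambda>x. x + A x) ` D"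
    then obtain x y where "x \<in> D" "y \<in> D" "a = x + A x" "b = y + A y" by auto
    then show "a + b \<in> (\<lambda>x. x + A x) ` D"
      by (intro image_eqI[of _ _ "x + y"]) (auto simp: A_add D_add)
  next
    fix c a assume "a \<in> (\<lambda>x. x + A x) ` D"
    then obtain x where "x \<in> D" "a = x + A x" by auto
    then show "c *\<^sub>C a \<in> (\<lambda>x. x + A x) ` D"
      by (intro image_eqI[of _ _ "c *\<^sub>C x"]) (auto simp: A_scaleC D_scaleC scaleC_add_right)
  qed
  have "closed S"
    unfolding closed_sequential_limits
  proof (intro allI impI, elim conjE)
    fix s l assume s: "\<forall>n. s n \<in> S" and l: "s \<longlonglongrightarrow> l"
    have "\<exists>x. \<forall>n. x n \<in> D \<and> s n = x n + A (x n)"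
      using s unfolding S_def image_iff by (intro choice) blast
    then obtain x where x: "\<And>n. x n \<in> D" "\<And>n. s n = x n + A (x n)"
      by blast
    have "Cauchy x"
    proof (rule metric_CauchyI)
      fix e :: real assume "e > 0"
      obtain M where M: "\<And>m n. m \<ge> M \<Longrightarrow> n \<ge> M \<Longrightarrow> dist (s m) (s n) < e"
        using metric_CauchyD[OF LIMSEQ_imp_Cauchy[OF l] \<open>e > 0\<close>] by blast
      have "dist (x m) (x n) \<le> dist (s m) (s n)" for m n
      proof -
        have "s m - s n = (x m - x n) + A (x m - x n)"
          by (simp add: x A_diff)
        then show ?thesis
          using norm_le_shift(1)[OF D_diff[OF x(1)[of m] x(1)[of n]]] by (simp add: dist_norm)
      qed
      then show "\<exists>M. \<forall>m\<ge>M. \<forall>n\<ge>M. dist (x m) (x n) < e"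
        using M by (meson le_less_trans)
    qed
    then obtain k where k: "x \<longlonglongrightarrow> k"
      using Cauchy_convergent convergent_def by blast
    have "(\<lambda>n. s n - x n) \<longlonglongrightarrow> l - k"
      by (intro tendsto_intros l k)
    then have "(\<lambda>n. A (x n)) \<longlonglongrightarrow> l - k"
      by (simp add: x(2))
    then have "k \<in> D" "A k = l - k"
      using A_closed[OF x(1) k] by auto
    then show "l \<in> S"
      unfolding S_def by (intro image_eqI[of _ _ k]) auto
  qed
  obtain s where s: "s \<in> S" "\<And>z. z \<in> S \<Longrightarrow> cinner (y - s) z = 0"
    using ex_orthogonal_projection[OF \<open>complex_subspace S\<close> \<open>closed S\<close>] by blast
  define w where "w = y - s"
  have *: "cinner (A x) w = cinner x (- w)" if "x \<in> D" for x
  proof -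
    have "cinner w (x + A x) = 0"
      unfolding w_def by (rule s(2)) (use that S_def in auto)
    then have "cinner (x + A x) w = 0"
      using cinner_commute[of "x + A x" w] by simp
    then show ?thesis
      by (simp add: cinner_add_left cinner_minus_right add_eq_0_iff)
  qed
  have "w \<in> D" "A w = - w"
    using A_maximal[OF *] by auto
  then have "(norm w)\<^sup>2 \<le> 0"
    using A_nonneg[of w] by (simp add: cinner_minus_left cinner_self_eq)
  then have "y = s"
    by (simp add: w_def)
  then show ?thesis
    using s(1) by (auto simp: S_def)
qed

text \<open>The operator \<open>(I + A)^{-1}\<close>. The hypothesis
  \<open>compact_resolvent\<close> supplies an unspecified complex point \<open>l\<close>; passing
  to the point \<open>-1\<close> gives a symmetric, nonnegative contraction, to which variational
  arguments apply.\<close>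

definition K :: "'h \<Rightarrow> 'h" where
  "K y = (SOME x. x \<in> D \<and> x + A x = y)"

lemma K_in_D: "K y \<in> D" and K_eq: "K y + A (K y) = y"
proof -
  have "\<exists>x. x \<in> D \<and> x + A x = y"
    using shift_surjective[of y] by blast
  then have "K y \<in> D \<and> K y + A (K y) = y"
    unfolding K_def by (rule someI_ex)
  then show "K y \<in> D" "K y + A (K y) = y" by auto
qed

lemma K_unique:
  assumes "x \<in> D" "x + A x = y"
  shows "K y = x"
proof -
  have "(x - K y) + A (x - K y) = 0"
    using assms K_eq[of y] by (simp add: A_diff K_in_D algebra_simps)
  then have "norm (x - K y) \<le> 0"
    using norm_le_shift(1)[OF D_diff[OF assms(1) K_in_D[of y]]] by simp
  then show ?thesis by simp
qed

lemma K_add: "K (x + y) = K x + K y"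
proof (rule K_unique)
  have "K x + K y + A (K x + K y) = (K x + A (K x)) + (K y + A (K y))"
    by (simp add: A_add K_in_D)
  then show "K x + K y + A (K x + K y) = x + y"
    by (simp only: K_eq)
qed (simp add: D_add K_in_D)

lemma K_scaleC: "K (c *\<^sub>C x) = c *\<^sub>C K x"
proof (rule K_unique)
  have "c *\<^sub>C K x + A (c *\<^sub>C K x) = c *\<^sub>C (K x + A (K x))"
    by (simp add: A_scaleC K_in_D scaleC_add_right)
  then show "c *\<^sub>C K x + A (c *\<^sub>C K x) = c *\<^sub>C x"
    by (simp only: K_eq)
qed (simp add: D_scaleC K_in_D)

lemma norm_K_le: "norm (K x) \<le> norm x"
  using norm_le_shift(1)[OF K_in_D[of x]] by (simp only: K_eq)

lemma K_scaleR: "K (r *\<^sub>R x) = r *\<^sub>R K x"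
  by (simp add: scaleR_scaleC K_scaleC)

lemma bounded_linear_K: "bounded_linear K"
  by (rule bounded_linear_intro[where K = 1]) (auto simp: K_add K_scaleR norm_K_le)

lemma K_diff: "K (x - y) = K x - K y"
  using bounded_linear.linear[OF bounded_linear_K] linear_diff by blast

lemma K_symmetric: "cinner (K x) y = cinner x (K y)"
proof -
  have "cinner (K x) (K y + A (K y)) = cinner (K x + A (K x)) (K y)"
    by (simp add: cinner_add_left cinner_add_right A_symmetric K_in_D)
  then show ?thesis
    by (simp only: K_eq)
qed

lemma K_nonneg: "Re (cinner (K x) x) \<ge> 0"
proof -
  have "Re (cinner (K x) (K x + A (K x))) \<ge> 0"
    using A_nonneg[OF K_in_D[of x]]
    by (simp add: cinner_add_right cinner_self_eq Re_cinner_commute[of "K x" "A (K x)"])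
  then show ?thesis
    by (simp only: K_eq)
qed

lemma K_eq_0: "K x = 0 \<Longrightarrow> x = 0"
  using K_eq[of x] by (simp add: A_zero)

text \<open>The resolvent identity between \<open>-1\<close> and \<open>l\<close>:
  \<open>K y\<close> is the resolvent at \<open>l\<close> of \<open>(l + 1) K y - y\<close>, and the
  scalar \<open>c\<close> brings this argument back into the unit ball.\<close>

lemma K_image_compact: "\<exists>C. compact C \<and> K ` cball 0 1 \<subseteq> C"
proof -
  obtain l where bij: "bij_betw (\<lambda>x. l *\<^sub>C x - A x) D UNIV"
    and comp: "compact (closure (resolvent D A l ` cball 0 1))"
    using compact_res by (auto simp: compact_resolvent_def)
  define c where "c = cmod (l + 1) + 1"
  have "c > 0"
    by (simp add: c_def add_nonneg_pos)
  have "K y \<in> (\<lambda>x. c *\<^sub>R x) ` closure (resolvent D A l ` cball 0 1)" if "y \<in> cball 0 1" for y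
  proof -
    define z where "z = (1 / c) *\<^sub>R ((l + 1) *\<^sub>C K y - y)"
    have "norm ((l + 1) *\<^sub>C K y - y) \<le> cmod (l + 1) * norm (K y) + norm y"
      by (metis norm_triangle_ineq4 norm_scaleC)
    also have "\<dots> \<le> cmod (l + 1) * 1 + 1"
      using that norm_K_le[of y] by (intro add_mono mult_left_mono) auto
    finally have "norm z \<le> 1"
      using \<open>c > 0\<close> by (simp add: z_def c_def)
    have x: "(1 / c) *\<^sub>R K y \<in> D"
      by (simp add: D_scaleR K_in_D)
    have "A (K y) = y - K y"
      using K_eq[of y] by (simp add: eq_diff_eq add.commute)
    then have "l *\<^sub>C ((1 / c) *\<^sub>R K y) - A ((1 / c) *\<^sub>R K y) = z"
      by (simp add: A_scaleR K_in_D z_def scaleC_add_left scaleR_of_scaleC scaleC_scaleR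
          scaleR_right_diff_distrib scaleR_right_distrib mult.commute)
    then have "resolvent D A l z = (1 / c) *\<^sub>R K y"
      unfolding resolvent_def using bij x
      by (metis (no_types, lifting) bij_betw_imp_inj_on inv_into_f_f)
    then have "(1 / c) *\<^sub>R K y \<in> closure (resolvent D A l ` cball 0 1)"
      using \<open>norm z \<le> 1\<close> by (intro subsetD[OF closure_subset] image_eqI[of _ _ z]) auto
    then show ?thesis
      using \<open>c > 0\<close> by (intro image_eqI[of _ _ "(1 / c) *\<^sub>R K y"]) auto
  qed
  moreover have "compact ((\<lambda>x. c *\<^sub>R x) ` closure (resolvent D A l ` cball 0 1))"
    by (rule compact_scaling[OF comp])
  ultimately show ?thesis
    by blast
qed

text \<open>Compactness in the form of a count: two \<open>\<delta>\<close>-separated image points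
  cannot share one of the balls of radius \<open>\<delta>/2\<close> that cover the compact set. It
  is applied to eigenvectors of distinct eigenvalues and to orthonormal sets.\<close>

lemma card_separated:
  assumes "\<delta> > 0"
  shows "\<exists>n. \<forall>F. finite F \<longrightarrow> F \<subseteq> cball 0 1 \<longrightarrow>
    (\<forall>e\<in>F. \<forall>f\<in>F. e \<noteq> f \<longrightarrow> norm (K e - K f) \<ge> \<delta>) \<longrightarrow> card F \<le> n"
proof -
  obtain C where C: "compact C" "K ` cball 0 1 \<subseteq> C"
    using K_image_compact by blast
  obtain k where k: "finite k" "C \<subseteq> (\<Union>x\<in>k. ball x (\<delta>/2))"
    using C(1) assms unfolding compact_eq_totally_bounded by (meson half_gt_zero)
  have "card F \<le> card k" if F: "finite F" "F \<subseteq> cball 0 1"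
    "\<forall>e\<in>F. \<forall>f\<in>F. e \<noteq> f \<longrightarrow> norm (K e - K f) \<ge> \<delta>" for F
  proof -
    have "\<forall>e\<in>F. \<exists>x. x \<in> k \<and> dist x (K e) < \<delta>/2"
    proof
      fix e assume "e \<in> F"
      then have "K e \<in> (\<Union>x\<in>k. ball x (\<delta>/2))"
        using F(2) C(2) k(2) by blast
      then show "\<exists>x. x \<in> k \<and> dist x (K e) < \<delta>/2"
        by auto
    qed
    then obtain g where g: "\<And>e. e \<in> F \<Longrightarrow> g e \<in> k" "\<And>e. e \<in> F \<Longrightarrow> dist (g e) (K e) < \<delta>/2"
      by metis
    have "inj_on g F"
    proof (rule inj_onI, rule ccontr)
      fix e f assume ef: "e \<in> F" "f \<in> F" "g e = g f" "e \<noteq> f"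
      have "dist (K e) (K f) < \<delta>"
        using g(2)[OF ef(1)] g(2)[OF ef(2)] dist_triangle[of "K e" "K f" "g e"] ef(3)
        by (simp add: dist_commute)
      then show False
        using F(3) ef by (force simp: dist_norm)
    qed
    then show ?thesis
      using g(1) k(1) by (intro card_inj_on_le[of g]) auto
  qed
  then show ?thesis
    by blast
qed

subsection \<open>Eigenspaces\<close>

abbreviation E :: "real \<Rightarrow> 'h set" where "E \<equiv> eigenspace D A"
abbreviation P :: "real \<Rightarrow> 'h \<Rightarrow> 'h" where "P \<equiv> eigenprojection D A"

lemma subspace_E: "complex_subspace (E \<mu>)"
  unfolding complex_subspace_iff eigenspace_def
  by (auto simp: A_zero D_zero A_add D_add A_scaleC D_scaleC scaleR_add_right scaleR_scaleC
      scaleC_scaleC scaleC_add_right mult.commute)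

lemma closed_E: "closed (E \<mu>)"
  unfolding closed_sequential_limits
proof (intro allI impI, elim conjE)
  fix s l assume s: "\<forall>n. s n \<in> E \<mu>" and l: "s \<longlonglongrightarrow> l"
  have "(\<lambda>n. \<mu> *\<^sub>R s n) \<longlonglongrightarrow> \<mu> *\<^sub>R l"
    by (intro tendsto_intros l)
  then have "(\<lambda>n. A (s n)) \<longlonglongrightarrow> \<mu> *\<^sub>R l"
    using s by (simp add: eigenspace_def)
  then show "l \<in> E \<mu>"
    using A_closed[of s l] s l by (auto simp: eigenspace_def)
qed

lemma eigenvalue_pos:
  assumes "z \<in> E \<mu>" "z \<noteq> 0"
  shows "\<mu> > 0"
proof -
  have "Re (cinner (A z) z) > 0"
    using positive assms by (auto simp: positive_definite_def eigenspace_def)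
  moreover have "Re (cinner (A z) z) = \<mu> * (norm z)\<^sup>2"
    using assms(1) by (simp add: eigenspace_def cinner_scaleR_left cinner_self_eq)
  ultimately show ?thesis
    using assms(2) by (simp add: zero_less_mult_iff)
qed

lemma E_orthogonal:
  assumes "x \<in> E \<mu>" "y \<in> E \<nu>" "\<mu> \<noteq> \<nu>"
  shows "cinner x y = 0"
proof -
  have "of_real \<mu> * cinner x y = of_real \<nu> * cinner x y"
    using A_symmetric[of x y] assms
    by (simp add: eigenspace_def cinner_scaleR_left cinner_scaleR_right)
  then show ?thesis
    using assms(3) by simp
qed

lemma K_E:
  assumes "z \<in> E \<mu>"
  shows "K z = (1 / (1 + \<mu>)) *\<^sub>R z"
proof (cases "z = 0")
  case True
  then show ?thesis
    using K_scaleR[of 0 0] by simp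
next
  case False
  then have "\<mu> > 0"
    using eigenvalue_pos assms by blast
  have "(1 / (1 + \<mu>)) *\<^sub>R z + (1 / (1 + \<mu>)) *\<^sub>R \<mu> *\<^sub>R z = z"
    unfolding scaleR_add_right[symmetric] using \<open>\<mu> > 0\<close>
    by (metis (no_types, lifting) add_pos_pos divide_self_if less_irrefl scaleR_add_left scaleR_one
        scaleR_scaleR times_divide_eq_left mult_1 zero_less_one)
  then show ?thesis
    using assms by (intro K_unique) (auto simp: eigenspace_def D_scaleR A_scaleR)
qed

lemma eigenprojection_unique:
  assumes "y \<in> E \<mu>" "\<And>z. z \<in> E \<mu> \<Longrightarrow> cinner (x - y) z = 0"
  shows "P \<mu> x = y"
  unfolding eigenprojection_def
proof (rule the_equality)
  fix y' assume y': "y' \<in> E \<mu> \<and> (\<forall>z\<in>E \<mu>. cinner (x - y') z = 0)"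
  have d: "y - y' \<in> E \<mu>"
    using y' assms(1) complex_subspace_diff[OF subspace_E] by blast
  have "cinner (y - y') (y - y') = cinner (x - y') (y - y') - cinner (x - y) (y - y')"
    by (simp flip: cinner_diff_left)
  also have "\<dots> = 0"
    using y' d assms(2) by simp
  finally show "y' = y"
    by (simp add: cinner_self_eq)
qed (use assms in blast)

lemma P_in_E: "P \<mu> x \<in> E \<mu>" and P_orth: "z \<in> E \<mu> \<Longrightarrow> cinner (x - P \<mu> x) z = 0"
proof -
  obtain y where y: "y \<in> E \<mu>" "\<And>z. z \<in> E \<mu> \<Longrightarrow> cinner (x - y) z = 0"
    using ex_orthogonal_projection[OF subspace_E closed_E] by blast
  then have "P \<mu> x = y"
    by (rule eigenprojection_unique)
  then show "P \<mu> x \<in> E \<mu>" "z \<in> E \<mu> \<Longrightarrow> cinner (x - P \<mu> x) z = 0"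
    using y by auto
qed

lemma P_add: "P \<mu> (x + y) = P \<mu> x + P \<mu> y"
proof (rule eigenprojection_unique)
  show "P \<mu> x + P \<mu> y \<in> E \<mu>"
    using subspace_E P_in_E unfolding complex_subspace_iff by blast
  fix z assume "z \<in> E \<mu>"
  then show "cinner (x + y - (P \<mu> x + P \<mu> y)) z = 0"
    using P_orth[of z \<mu> x] P_orth[of z \<mu> y] by (simp add: cinner_add_left cinner_diff_left)
qed

lemma P_scaleC: "P \<mu> (c *\<^sub>C x) = c *\<^sub>C P \<mu> x"
proof (rule eigenprojection_unique)
  show "c *\<^sub>C P \<mu> x \<in> E \<mu>"
    using subspace_E P_in_E unfolding complex_subspace_iff by blast
  fix z assume "z \<in> E \<mu>"
  then show "cinner (c *\<^sub>C x - c *\<^sub>C P \<mu> x) z = 0"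
    using P_orth[of z \<mu> x] by (simp add: cinner_scaleC_left flip: scaleC_diff_right)
qed

lemma norm_P_le: "norm (P \<mu> x) \<le> norm x"
proof -
  have "Re (cinner (P \<mu> x) (x - P \<mu> x)) = 0"
    using P_orth[OF P_in_E[of \<mu> x], of x] by (simp add: Re_cinner_commute[of "P \<mu> x"])
  then have "(norm (P \<mu> x + (x - P \<mu> x)))\<^sup>2 \<ge> (norm (P \<mu> x))\<^sup>2"
    unfolding norm_add_square by simp
  then have "(norm (P \<mu> x))\<^sup>2 \<le> (norm x)\<^sup>2"
    by simp
  then show ?thesis
    by (rule power2_le_imp_le) simp
qed

lemma P_scaleR: "P \<mu> (r *\<^sub>R x) = r *\<^sub>R P \<mu> x"
  by (simp add: scaleR_scaleC P_scaleC)

lemma bounded_linear_P: "bounded_linear (P \<mu>)"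
  by (rule bounded_linear_intro[where K = 1]) (auto simp: P_add P_scaleR norm_P_le)

lemma P_diff: "P \<mu> (x - y) = P \<mu> x - P \<mu> y"
  using bounded_linear.linear[OF bounded_linear_P] linear_diff by blast

lemma P_minus: "P \<mu> (- x) = - P \<mu> x"
  using P_scaleR[of \<mu> "-1" x] by simp

lemma P_zero: "P \<mu> 0 = 0"
  using P_scaleR[of \<mu> 0 0] by simp

lemma P_same: "x \<in> E \<mu> \<Longrightarrow> P \<mu> x = x"
  by (rule eigenprojection_unique) auto

lemma P_other: "x \<in> E \<nu> \<Longrightarrow> \<mu> \<noteq> \<nu> \<Longrightarrow> P \<mu> x = 0"
  using subspace_E by (intro eigenprojection_unique) (auto simp: E_orthogonal complex_subspace_iff)

lemma P_nonpos: "\<mu> \<le> 0 \<Longrightarrow> P \<mu> x = 0"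
  using eigenvalue_pos[OF P_in_E] by (metis not_le)

section \<open>Completeness of the eigenvectors, synthesis and Parseval\<close>

lemma eigenvectors_complete:
  assumes x: "\<And>\<mu> z. z \<in> E \<mu> \<Longrightarrow> cinner x z = 0"
  shows "x = 0"
proof (rule ccontr)
  assume "x \<noteq> 0"
  \<comment> \<open>\<open>W\<close> is the orthogonal complement of all eigenspaces and is
    invariant under \<open>K\<close>. If it is nonzero, the norm of \<open>K\<close> on
    \<open>W\<close> is attained, and a maximiser contradicts either the choice of \<open>W\<close>
    or the positivity of \<open>K\<close>.\<close>
  define W where "W = {x. \<forall>\<mu>. \<forall>z\<in>E \<mu>. cinner x z = 0}"
  have W_scaleR: "r *\<^sub>R y \<in> W" if "y \<in> W" for r y
    using that by (auto simp: W_def cinner_scaleR_left)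
  have W_add: "y + z \<in> W" if "y \<in> W" "z \<in> W" for y z
    using that by (auto simp: W_def cinner_add_left)
  have K_W: "K y \<in> W" if "y \<in> W" for y
    using that by (auto simp: W_def K_symmetric K_E cinner_scaleR_right)
  define U where "U = {y \<in> W. norm y = 1}"
  have "(1 / norm x) *\<^sub>R x \<in> U"
    using \<open>x \<noteq> 0\<close> x by (auto simp: U_def W_def cinner_scaleR_left)
  then have "U \<noteq> {}" by blast
  have bdd: "bdd_above ((\<lambda>y. norm (K y)) ` U)"
    using norm_K_le by (intro bdd_aboveI2[where M = 1]) (metis (mono_tags, lifting) U_def mem_Collect_eq)
  define m where "m = (SUP y\<in>U. norm (K y))"
  have K_le_U: "norm (K y) \<le> m" if "y \<in> U" for y
    unfolding m_def by (rule cSUP_upper[OF that bdd])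
  have K_le: "norm (K y) \<le> m * norm y" if "y \<in> W" for y
  proof (cases "y = 0")
    case True
    then show ?thesis
      using norm_K_le[of y] by simp
  next
    case False
    then have "(1 / norm y) *\<^sub>R y \<in> U"
      using that W_scaleR by (auto simp: U_def)
    from K_le_U[OF this] False show ?thesis
      by (simp add: K_scaleR field_simps)
  qed
  have "m > 0"
  proof -
    obtain u where "u \<in> U" using \<open>U \<noteq> {}\<close> by blast
    then have "K u \<noteq> 0"
      using K_eq_0[of u] by (auto simp: U_def)
    then show ?thesis
      using K_le_U[OF \<open>u \<in> U\<close>] by (smt (verit) zero_less_norm_iff)
  qed
  have "\<exists>y\<in>U. m - 1 / real (Suc n) < norm (K y)" for n
    using less_cSUP_iff[OF \<open>U \<noteq> {}\<close> bdd, of "m - 1 / real (Suc n)"] by (simp add: m_def)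
  then obtain y where y: "\<And>n. y n \<in> U" "\<And>n. m - 1 / real (Suc n) < norm (K (y n))"
    by metis
  have lim: "(\<lambda>n. norm (K (y n))) \<longlonglongrightarrow> m"
  proof (rule tendsto_sandwich[where f = "\<lambda>n. m - 1 / real (Suc n)" and h = "\<lambda>_. m"])
    show "(\<lambda>n. m - 1 / real (Suc n)) \<longlonglongrightarrow> m"
      using LIMSEQ_inverse_real_of_nat_add_minus[of m] by (simp add: inverse_eq_divide)
    show "\<forall>\<^sub>F n in sequentially. m - 1 / real (Suc n) \<le> norm (K (y n))"
      by (intro always_eventually allI less_imp_le y(2))
    show "\<forall>\<^sub>F n in sequentially. norm (K (y n)) \<le> m"
      by (intro always_eventually allI K_le_U y(1))
  qed (rule tendsto_const)
  \<comment> \<open>Along a maximising sequence \<open>y n\<close> becomes an approximate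
    eigenvector of \<open>K^2\<close>: expanding the square and using
    \<open>norm (K (K (y n))) \<le> m * norm (K (y n))\<close> bounds it by \<open>m^2\<close> times
    the gap \<open>m^2 - norm (K (y n))^2\<close>, which tends to 0.\<close>
  have "(\<lambda>n. (norm (K (K (y n)) - m\<^sup>2 *\<^sub>R y n))\<^sup>2) \<longlonglongrightarrow> 0"
  proof (rule tendsto_sandwich[where f = "\<lambda>_. 0" and h = "\<lambda>n. m\<^sup>2 * (m\<^sup>2 - (norm (K (y n)))\<^sup>2)"])
    have "(\<lambda>n. m\<^sup>2 * (m\<^sup>2 - (norm (K (y n)))\<^sup>2)) \<longlonglongrightarrow> m\<^sup>2 * (m\<^sup>2 - m\<^sup>2)"
      by (intro tendsto_intros lim)
    then show "(\<lambda>n. m\<^sup>2 * (m\<^sup>2 - (norm (K (y n)))\<^sup>2)) \<longlonglongrightarrow> 0"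
      by simp
    have "(norm (K (K (y n)) - m\<^sup>2 *\<^sub>R y n))\<^sup>2 \<le> m\<^sup>2 * (m\<^sup>2 - (norm (K (y n)))\<^sup>2)" for n
    proof -
      have U: "y n \<in> W" "norm (y n) = 1"
        using y(1) by (auto simp: U_def)
      have "norm (K (K (y n))) \<le> m * norm (K (y n))"
        by (rule K_le[OF K_W[OF U(1)]])
      then have "(norm (K (K (y n))))\<^sup>2 \<le> m\<^sup>2 * (norm (K (y n)))\<^sup>2"
        by (metis norm_ge_zero power_mono power_mult_distrib)
      moreover have "Re (cinner (K (K (y n))) (m\<^sup>2 *\<^sub>R y n)) = m\<^sup>2 * (norm (K (y n)))\<^sup>2"
        by (simp add: cinner_scaleR_right K_symmetric[of "K (y n)"] cinner_self_eq)
      moreover have "(norm (m\<^sup>2 *\<^sub>R y n))\<^sup>2 = m\<^sup>2 * m\<^sup>2"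
        by (simp add: U(2) power2_eq_square)
      ultimately show ?thesis
        unfolding norm_diff_square by (simp add: right_diff_distrib)
    qed
    then show "\<forall>\<^sub>F n in sequentially. (norm (K (K (y n)) - m\<^sup>2 *\<^sub>R y n))\<^sup>2
        \<le> m\<^sup>2 * (m\<^sup>2 - (norm (K (y n)))\<^sup>2)"
      by (intro always_eventually allI)
  qed auto
  then have "(\<lambda>n. sqrt ((norm (K (K (y n)) - m\<^sup>2 *\<^sub>R y n))\<^sup>2)) \<longlonglongrightarrow> sqrt 0"
    by (rule tendsto_real_sqrt)
  then have diff0: "(\<lambda>n. K (K (y n)) - m\<^sup>2 *\<^sub>R y n) \<longlonglongrightarrow> 0"
    by (simp add: tendsto_norm_zero_iff)
  \<comment> \<open>Compactness gives convergence of \<open>K (y n)\<close> along a subsequence;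
    since \<open>m^2 y n\<close> differs from \<open>K (K (y n))\<close> by a null sequence, the
    \<open>y n\<close> themselves converge along it.\<close>
  obtain C where C: "compact C" "K ` cball 0 1 \<subseteq> C"
    using K_image_compact by blast
  have "\<forall>n. K (y n) \<in> C"
    using C(2) y(1) by (auto simp: U_def)
  then obtain l r where r: "strict_mono r" "((\<lambda>n. K (y n)) \<circ> r) \<longlonglongrightarrow> l"
    using C(1) unfolding compact_def by metis
  have "(\<lambda>n. K (((\<lambda>n. K (y n)) \<circ> r) n)) \<longlonglongrightarrow> K l"
    by (rule bounded_linear.tendsto[OF bounded_linear_K r(2)])
  moreover have "(\<lambda>n. K (K (y (r n))) - m\<^sup>2 *\<^sub>R y (r n)) \<longlonglongrightarrow> 0"
    using LIMSEQ_subseq_LIMSEQ[OF diff0 r(1)] by (simp add: o_def)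
  ultimately have "(\<lambda>n. K (K (y (r n))) - (K (K (y (r n))) - m\<^sup>2 *\<^sub>R y (r n))) \<longlonglongrightarrow> K l - 0"
    by (intro tendsto_diff) (simp_all add: o_def)
  then have "(\<lambda>n. m\<^sup>2 *\<^sub>R y (r n)) \<longlonglongrightarrow> K l"
    by simp
  then have "(\<lambda>n. (1 / m\<^sup>2) *\<^sub>R (m\<^sup>2 *\<^sub>R y (r n))) \<longlonglongrightarrow> (1 / m\<^sup>2) *\<^sub>R K l"
    by (intro tendsto_intros)
  then obtain v where yr: "(\<lambda>n. y (r n)) \<longlonglongrightarrow> v" and v: "v = (1 / m\<^sup>2) *\<^sub>R K l"
    using \<open>m > 0\<close> by simp
  have "K v = l"
    using bounded_linear.tendsto[OF bounded_linear_K yr] r(2) LIMSEQ_unique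
    by (auto simp: o_def)
  then have KKv: "K (K v) = m\<^sup>2 *\<^sub>R v"
    using \<open>m > 0\<close> v by simp
  have "norm v = 1"
  proof -
    have "(\<lambda>n. norm (y (r n))) \<longlonglongrightarrow> norm v"
      by (rule tendsto_norm[OF yr])
    moreover have "(\<lambda>n. norm (y (r n))) = (\<lambda>_. 1)"
      using y(1) by (auto simp: U_def)
    ultimately show ?thesis
      using LIMSEQ_unique[OF _ tendsto_const] by metis
  qed
  have "v \<in> W"
  proof -
    have "cinner v z = 0" if "z \<in> E \<mu>" for z \<mu>
    proof -
      have "(\<lambda>n. cinner (y (r n)) z) \<longlonglongrightarrow> cinner v z"
        by (rule bounded_linear.tendsto[OF bounded_linear_cinner_left yr])
      moreover have "cinner (y (r n)) z = 0" for n
        using y(1)[of "r n"] that by (auto simp: U_def W_def)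
      ultimately show ?thesis
        by (simp add: LIMSEQ_const_iff)
    qed
    then show ?thesis
      by (simp add: W_def)
  qed
  \<comment> \<open>As \<open>K\<close> is nonnegative, the factor \<open>K + m\<close> of \<open>K\<^sup>2 - m\<^sup>2\<close> is injective.\<close>
  define z where "z = K v + m *\<^sub>R v"
  have "z \<in> W"
    unfolding z_def using \<open>v \<in> W\<close> K_W W_add W_scaleR by blast
  have "K z = m *\<^sub>R z"
    by (simp only: z_def K_add K_scaleR KKv) (simp add: scaleR_add_right power2_eq_square)
  then have "z = K ((1 / m) *\<^sub>R z)"
    using \<open>m > 0\<close> by (simp add: K_scaleR)
  then have "z \<in> D" "z + A z = (1 / m) *\<^sub>R z"
    using K_in_D K_eq by metis+
  then have "z \<in> E (1 / m - 1)"
    by (simp add: eigenspace_def scaleR_diff_left eq_diff_eq add.commute)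
  then have "cinner z z = 0"
    using \<open>z \<in> W\<close> by (auto simp: W_def)
  then have "z = 0"
    by (simp add: cinner_self_eq)
  then have "Re (cinner (K v) v) = - m"
    using \<open>norm v = 1\<close> unfolding z_def
    by (simp add: add_eq_0_iff2 cinner_minus_left cinner_scaleR_left cinner_self_eq)
  then show False
    using K_nonneg[of v] \<open>m > 0\<close> by simp
qed

lemma P_injective:
  assumes "\<And>\<mu>. P \<mu> x = P \<mu> y"
  shows "x = y"
proof -
  have "cinner (x - y) z = 0" if "z \<in> E \<mu>" for \<mu> z
    using P_orth[OF that, of "x - y"] assms[of \<mu>] by (simp add: P_diff)
  then show ?thesis
    using eigenvectors_complete[of "x - y"] by simp
qed

text \<open>Riesz-Fischer for the eigenspace decomposition. The series converges by orthogonality,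
  and the continuous projection \<open>P \<mu>\<close> may be applied to it term by term, where only
  one term survives.\<close>

lemma synthesis:
  assumes E: "\<And>\<mu>. w \<mu> \<in> E \<mu>" and sq: "(\<lambda>\<mu>. (norm (w \<mu>))\<^sup>2) summable_on UNIV"
  shows "\<exists>x. (w has_sum x) UNIV \<and> (\<forall>\<mu>. P \<mu> x = w \<mu>)"
proof -
  have "w summable_on UNIV"
    by (rule summable_on_orthogonal[OF E_orthogonal[OF E E] sq])
  then obtain x where x: "(w has_sum x) UNIV"
    by (auto simp: summable_on_def)
  have "P \<mu> x = w \<mu>" for \<mu>
  proof -
    have "((\<lambda>\<nu>. P \<mu> (w \<nu>)) has_sum P \<mu> x) UNIV"
      using has_sum_bounded_linear[OF bounded_linear_P x] by (simp add: o_def)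
    moreover have "(\<lambda>\<nu>. P \<mu> (w \<nu>)) = (\<lambda>\<nu>. if \<nu> = \<mu> then w \<mu> else 0)"
      by (intro ext) (auto simp: P_same[OF E] P_other[OF E])
    moreover have "((\<lambda>\<nu>. if \<nu> = \<mu> then w \<mu> else 0) has_sum w \<mu>) UNIV"
      using has_sum_finite_neutralI[of "{\<mu>}" UNIV "\<lambda>\<nu>. if \<nu> = \<mu> then w \<mu> else 0" "w \<mu>"] by simp
    ultimately show ?thesis
      using has_sum_unique by metis
  qed
  then show ?thesis
    using x by blast
qed

text \<open>Bessel's inequality: a partial sum \<open>s\<close> satisfies
  \<open>norm (s - x)^2 = norm x^2 - norm s^2\<close>, so the finite sums are bounded by
  \<open>norm x^2\<close>.\<close>

lemma summable_P: "(\<lambda>\<mu>. (norm (P \<mu> x))\<^sup>2) summable_on UNIV"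
proof (rule nonneg_bdd_above_summable_on)
  have "(\<Sum>\<mu>\<in>F. (norm (P \<mu> x))\<^sup>2) \<le> (norm x)\<^sup>2" if "finite F" for F
  proof -
    define s where "s = (\<Sum>\<mu>\<in>F. P \<mu> x)"
    have ns: "(norm s)\<^sup>2 = (\<Sum>\<mu>\<in>F. (norm (P \<mu> x))\<^sup>2)"
      unfolding s_def by (intro norm_sum_orthogonal that E_orthogonal[OF P_in_E P_in_E])
    have "Re (cinner s x) = (\<Sum>\<mu>\<in>F. (norm (P \<mu> x))\<^sup>2)"
      unfolding s_def cinner_sum_left Re_sum
    proof (rule sum.cong)
      fix \<mu>
      have "cinner (x - P \<mu> x) (P \<mu> x) = 0"
        by (rule P_orth[OF P_in_E])
      then have "Re (cinner x (P \<mu> x)) = (norm (P \<mu> x))\<^sup>2"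
        by (simp add: cinner_diff_left cinner_self_eq)
      then show "Re (cinner (P \<mu> x) x) = (norm (P \<mu> x))\<^sup>2"
        by (simp add: Re_cinner_commute[of "P \<mu> x"])
    qed simp
    then have "(norm (s - x))\<^sup>2 = (norm x)\<^sup>2 - (norm s)\<^sup>2"
      unfolding norm_diff_square using ns by simp
    then show ?thesis
      using ns zero_le_power2[of "norm (s - x)"] by linarith
  qed
  then show "bdd_above (sum (\<lambda>\<mu>. (norm (P \<mu> x))\<^sup>2) ` {F. F \<subseteq> UNIV \<and> finite F})"
    by (intro bdd_aboveI[of _ "(norm x)\<^sup>2"]) auto
qed simp

text \<open>The series of the projections of \<open>x\<close> has the same projections as
  \<open>x\<close>, hence equals \<open>x\<close> by completeness. Pairing it with \<open>x\<close>
  term by term gives the identity.\<close>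

lemma parseval: "((\<lambda>\<mu>. (norm (P \<mu> x))\<^sup>2) has_sum (norm x)\<^sup>2) UNIV"
proof -
  obtain y where y: "((\<lambda>\<mu>. P \<mu> x) has_sum y) UNIV" "\<And>\<mu>. P \<mu> y = P \<mu> x"
    using synthesis[of "\<lambda>\<mu>. P \<mu> x"] P_in_E summable_P by blast
  have "y = x"
    by (rule P_injective) (rule y(2))
  have "((\<lambda>\<mu>. Re (cinner (P \<mu> x) x)) has_sum Re (cinner x x)) UNIV"
    using has_sum_bounded_linear[OF bounded_linear_compose[OF bounded_linear_Re
          bounded_linear_cinner_left[of x]] y(1)] by (simp add: o_def \<open>y = x\<close>)
  moreover have "Re (cinner (P \<mu> x) x) = (norm (P \<mu> x))\<^sup>2" for \<mu>
    using P_orth[OF P_in_E[of \<mu> x], of x]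
    by (simp add: Re_cinner_commute[of "P \<mu> x" x] cinner_diff_left cinner_self_eq)
  ultimately show ?thesis
    by (simp add: cinner_self_eq)
qed

section \<open>Distribution of the eigenvalues\<close>

lemma K_P: "P \<mu> (K x) = (1 / (1 + \<mu>)) *\<^sub>R P \<mu> x"
proof (rule eigenprojection_unique)
  show "(1 / (1 + \<mu>)) *\<^sub>R P \<mu> x \<in> E \<mu>"
    by (intro complex_subspace_scaleR subspace_E P_in_E)
  fix z assume z: "z \<in> E \<mu>"
  have "cinner (K x - (1 / (1 + \<mu>)) *\<^sub>R P \<mu> x) z = of_real (1 / (1 + \<mu>)) * cinner (x - P \<mu> x) z"
    by (simp only: cinner_diff_left cinner_scaleR_left K_symmetric K_E[OF z] cinner_scaleR_right
        right_diff_distrib)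
  then show "cinner (K x - (1 / (1 + \<mu>)) *\<^sub>R P \<mu> x) z = 0"
    using P_orth[OF z] by simp
qed

text \<open>Unit eigenvectors of different eigenvalues up to \<open>m\<close> have
  \<open>K\<close>-images at distance at least \<open>1 / (1 + m)\<close>, so infinitely many of
  them would violate the count of separated points.\<close>

lemma finite_eigenvalues_le: "finite {\<mu>. \<mu> \<le> m \<and> E \<mu> \<noteq> {0}}" (is "finite ?S")
proof (rule ccontr)
  assume inf: "infinite ?S"
  have "\<forall>\<mu>\<in>?S. \<exists>e. e \<in> E \<mu> \<and> norm e = 1"
  proof
    fix \<mu> assume that: "\<mu> \<in> ?S"
    have "0 \<in> E \<mu>"
      using subspace_E by (simp add: complex_subspace_iff)
    then have "\<not> E \<mu> \<subseteq> {0}"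
      using that by auto
    then obtain z where "z \<in> E \<mu>" "z \<noteq> 0"
      by auto
    then show "\<exists>e. e \<in> E \<mu> \<and> norm e = 1"
      by (intro exI[of _ "(1 / norm z) *\<^sub>R z"]) (auto intro: complex_subspace_scaleR[OF subspace_E])
  qed
  from bchoice[OF this] obtain e
    where "\<forall>\<mu>\<in>?S. e \<mu> \<in> E \<mu> \<and> norm (e \<mu>) = 1" ..
  then have e: "\<And>\<mu>. \<mu> \<in> ?S \<Longrightarrow> e \<mu> \<in> E \<mu>" "\<And>\<mu>. \<mu> \<in> ?S \<Longrightarrow> norm (e \<mu>) = 1"
    by blast+
  obtain \<mu>0 where "\<mu>0 \<in> ?S"
    using infinite_imp_nonempty[OF inf] by blast
  then have "m > 0"
    using eigenvalue_pos[OF e(1)] e(2) by fastforce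
  obtain n where n: "\<And>F. finite F \<Longrightarrow> F \<subseteq> cball 0 1 \<Longrightarrow>
    (\<forall>e\<in>F. \<forall>f\<in>F. e \<noteq> f \<longrightarrow> norm (K e - K f) \<ge> 1 / (1 + m)) \<Longrightarrow> card F \<le> n"
    using card_separated[of "1 / (1 + m)"] \<open>m > 0\<close> by auto
  obtain G where G: "finite G" "card G = Suc n" "G \<subseteq> ?S"
    using infinite_arbitrarily_large[OF inf] by blast
  have sep: "norm (K (e \<mu>) - K (e \<nu>)) \<ge> 1 / (1 + m)" if "\<mu> \<in> ?S" "\<nu> \<in> ?S" "\<mu> \<noteq> \<nu>" for \<mu> \<nu>
  proof -
    have "\<mu> > 0"
      using eigenvalue_pos[OF e(1)[OF that(1)]] e(2)[OF that(1)] by force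
    have "(1 / (1 + \<mu>)) *\<^sub>R e \<mu> = P \<mu> (K (e \<mu>) - K (e \<nu>))"
      by (simp only: P_diff K_P P_same[OF e(1)[OF that(1)]] P_other[OF e(1)[OF that(2)] that(3)]) simp
    then have "norm ((1 / (1 + \<mu>)) *\<^sub>R e \<mu>) \<le> norm (K (e \<mu>) - K (e \<nu>))"
      using norm_P_le by metis
    moreover have "1 / (1 + m) \<le> 1 / (1 + \<mu>)"
      using that(1) \<open>\<mu> > 0\<close> by (intro divide_left_mono) auto
    ultimately show ?thesis
      using e(2)[OF that(1)] \<open>\<mu> > 0\<close> by simp
  qed
  have "inj_on e ?S"
  proof (rule inj_onI, rule ccontr)
    fix \<mu> \<nu> assume "\<mu> \<in> ?S" "\<nu> \<in> ?S" "e \<mu> = e \<nu>" "\<mu> \<noteq> \<nu>"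
    then show False
      using sep[of \<mu> \<nu>] \<open>m > 0\<close> by (simp add: divide_le_0_iff)
  qed
  then have "card (e ` G) = Suc n"
    using G by (metis card_image inj_on_subset)
  moreover have "card (e ` G) \<le> n"
  proof (rule n)
    show "e ` G \<subseteq> cball 0 1"
      using e(2) G(3) by fastforce
    show "\<forall>x\<in>e ` G. \<forall>y\<in>e ` G. x \<noteq> y \<longrightarrow> norm (K x - K y) \<ge> 1 / (1 + m)"
    proof (intro ballI impI)
      fix x y assume "x \<in> e ` G" "y \<in> e ` G" "x \<noteq> y"
      then obtain \<mu> \<nu> where *: "\<mu> \<in> G" "\<nu> \<in> G" "x = e \<mu>" "y = e \<nu>" "\<mu> \<noteq> \<nu>"
        by auto
      show "norm (K x - K y) \<ge> 1 / (1 + m)"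
        unfolding *(3,4) by (rule sep[OF subsetD[OF G(3) *(1)] subsetD[OF G(3) *(2)] *(5)])
    qed
  qed (use G in simp)
  ultimately show False by simp
qed

text \<open>If the eigenvalues stay below \<open>M\<close>, then \<open>K\<close> is bounded below
  by \<open>1 / (1 + M)\<close>, so the images of an orthonormal set are separated and its size is
  bounded. A maximal orthonormal set is then a finite basis. Counting orthonormal sets rather than
  eigenvalues also covers eigenspaces of infinite dimension.\<close>

lemma eigenvalues_unbounded:
  assumes "infinite_dimensional TYPE('h)"
  shows "\<exists>\<mu>>m. \<exists>\<phi>\<in>E \<mu>. norm \<phi> = 1"
proof (rule ccontr)
  assume no: "\<not> ?thesis"
  define M where "M = max m 1"
  have P0: "P \<mu> x = 0" if "\<mu> > M" for \<mu> x
  proof (rule ccontr)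
    assume "P \<mu> x \<noteq> 0"
    then have "(1 / norm (P \<mu> x)) *\<^sub>R P \<mu> x \<in> E \<mu>" "norm ((1 / norm (P \<mu> x)) *\<^sub>R P \<mu> x) = 1"
      by (auto intro: complex_subspace_scaleR[OF subspace_E] P_in_E)
    then show False
      using no that unfolding M_def by (metis max_less_iff_conj)
  qed
  have K_ge: "norm x \<le> (1 + M) * norm (K x)" for x
  proof -
    have "(norm x)\<^sup>2 \<le> (1 + M)\<^sup>2 * (norm (K x))\<^sup>2"
    proof (rule has_sum_mono[OF parseval[of x] has_sum_cmult_right[OF parseval[of "K x"]]])
      fix \<mu>
      consider "\<mu> > M" | "\<mu> \<le> 0" | "0 < \<mu>" "\<mu> \<le> M" by linarith
      then show "(norm (P \<mu> x))\<^sup>2 \<le> (1 + M)\<^sup>2 * (norm (P \<mu> (K x)))\<^sup>2"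
      proof cases
        case 3
        then have "norm (P \<mu> x) \<le> (1 + M) * norm (P \<mu> (K x))"
          by (simp add: K_P pos_le_divide_eq mult.commute mult_right_mono)
        then show ?thesis
          by (metis norm_ge_zero power_mono power_mult_distrib)
      qed (simp_all add: P0 P_nonpos)
    qed
    then have "(norm x)\<^sup>2 \<le> ((1 + M) * norm (K x))\<^sup>2"
      by (simp add: power_mult_distrib)
    then show ?thesis
      by (rule power2_le_imp_le) (simp add: M_def)
  qed
  define orthonormal where "orthonormal F \<longleftrightarrow> finite F \<and> (\<forall>e\<in>F. norm e = 1) \<and>
    (\<forall>e\<in>F. \<forall>f\<in>F. e \<noteq> f \<longrightarrow> cinner e f = 0)" for F :: "'h set"
  have "M > 0"
    by (simp add: M_def)
  obtain n where n: "\<And>F. finite F \<Longrightarrow> F \<subseteq> cball 0 1 \<Longrightarrow>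
    (\<forall>e\<in>F. \<forall>f\<in>F. e \<noteq> f \<longrightarrow> norm (K e - K f) \<ge> 1 / (1 + M)) \<Longrightarrow> card F \<le> n"
    using card_separated[of "1 / (1 + M)"] \<open>M > 0\<close> by auto
  have card_le: "card F \<le> n" if F: "orthonormal F" for F
  proof (rule n)
    show "finite F" "F \<subseteq> cball 0 1"
      using F by (auto simp: orthonormal_def)
    show "\<forall>e\<in>F. \<forall>f\<in>F. e \<noteq> f \<longrightarrow> norm (K e - K f) \<ge> 1 / (1 + M)"
    proof (intro ballI impI)
      fix e f assume ef: "e \<in> F" "f \<in> F" "e \<noteq> f"
      have "(norm (e - f))\<^sup>2 = 2"
        unfolding norm_diff_square using F ef by (simp add: orthonormal_def)
      then have "1 \<le> norm (e - f)"
        by - (rule power2_le_imp_le, simp_all)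
      also have "\<dots> \<le> (1 + M) * norm (K e - K f)"
        using K_ge[of "e - f"] by (simp add: K_diff)
      finally show "norm (K e - K f) \<ge> 1 / (1 + M)"
        using \<open>M > 0\<close> by (simp add: divide_le_eq mult.commute)
    qed
  qed
  have "orthonormal {}"
    by (simp add: orthonormal_def)
  then have "\<exists>F. orthonormal F \<and> (\<forall>G. orthonormal G \<longrightarrow> card G \<le> card F)"
    using card_le by (intro ex_has_greatest_nat[of orthonormal _ card "Suc n"]) (auto simp: less_Suc_eq_le)
  then obtain F where F: "orthonormal F" "\<And>G. orthonormal G \<Longrightarrow> card G \<le> card F"
    by blast
  have "x = (\<Sum>e\<in>F. cinner x e *\<^sub>C e)" for x
  proof (rule ccontr)
    define y where "y = x - (\<Sum>e\<in>F. cinner x e *\<^sub>C e)"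
    assume "x \<noteq> (\<Sum>e\<in>F. cinner x e *\<^sub>C e)"
    then have "y \<noteq> 0"
      by (simp add: y_def)
    have orth: "cinner y f = 0" if "f \<in> F" for f
    proof -
      have "(\<Sum>e\<in>F. cinner (cinner x e *\<^sub>C e) f) = (\<Sum>e\<in>F. if e = f then cinner x f else 0)"
        using F(1) that by (intro sum.cong) (auto simp: orthonormal_def cinner_scaleC_left cinner_self_eq)
      also have "\<dots> = cinner x f"
        using F(1) that by (simp add: orthonormal_def)
      finally show ?thesis
        by (simp add: y_def cinner_diff_left cinner_sum_left)
    qed
    define g where "g = (1 / norm y) *\<^sub>R y"
    have g: "norm g = 1" "\<And>f. f \<in> F \<Longrightarrow> cinner g f = 0" "\<And>f. f \<in> F \<Longrightarrow> cinner f g = 0"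
      using \<open>y \<noteq> 0\<close> orth cinner_commute[of _ y] by (auto simp: g_def cinner_scaleR_left cinner_scaleR_right)
    have "g \<notin> F"
      using g(1) g(2)[of g] by (auto simp: cinner_self_eq)
    moreover have "orthonormal (insert g F)"
      using F(1) g by (auto simp: orthonormal_def)
    ultimately show False
      using F(2)[of "insert g F"] F(1) by (simp add: orthonormal_def)
  qed
  moreover have mod: "module (scaleC :: complex \<Rightarrow> 'h \<Rightarrow> 'h)"
    using vector_space_scaleC by (simp add: module_iff_vector_space)
  ultimately have "x \<in> module.span scaleC F" for x
    by (metis (no_types, lifting) module.span_base module.span_scale module.span_sum)
  then have "module.span scaleC F = UNIV"
    by blast
  moreover have "finite F"
    using F(1) by (simp add: orthonormal_def)
  ultimately show False
    using assms by (auto simp: infinite_dimensional_def)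
qed

end

section \<open>The system on one eigenspace\<close>

text \<open>In the coordinates \<open>w = (\<sigma>\<mu>)\<^bsup>1/2\<^esup> u\<close>, \<open>v\<close>, \<open>\<theta>\<close>, \<open>p = \<tau>\<^bsup>1/2\<^esup> q\<close>, in which the energy is the
  Euclidean norm, the system on the eigenspace of \<open>\<mu>\<close> is \<open>y' = gen a b c d y\<close> with
  \<open>a = (\<sigma>\<mu>)\<^bsup>1/2\<^esup>\<close>, \<open>b = \<mu>\<^sup>\<alpha>\<close>, \<open>c = \<mu>\<^bsup>\<beta>/2\<^esup> \<tau>\<^bsup>-1/2\<^esup>\<close>, \<open>d = 1/\<tau>\<close>.\<close>

definition gen ::
  "real \<Rightarrow> real \<Rightarrow> real \<Rightarrow> real \<Rightarrow> 'a \<times> 'a \<times> 'a \<times> 'a \<Rightarrow> 'a::complex_hilbert \<times> 'a \<times> 'a \<times> 'a" where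
  "gen a b c d = (\<lambda>(w, v, \<theta>, p).
     (a *\<^sub>R v, b *\<^sub>R \<theta> - a *\<^sub>R w, c *\<^sub>R p - b *\<^sub>R v, - (c *\<^sub>R \<theta>) - d *\<^sub>R p))"

section \<open>Energy estimate and resolvent on one eigenspace\<close>

lemma norm_quad_square:
  "(norm (w, v, \<theta>, p))\<^sup>2
    = (norm w)\<^sup>2 + (norm v)\<^sup>2 + (norm \<theta>)\<^sup>2 + (norm (p :: 'a::complex_hilbert))\<^sup>2"
  for w v \<theta> :: "'a::complex_hilbert"
  by (simp add: norm_Pair)

lemma norm_quad_le:
  "norm (w, v, \<theta>, p) \<le> norm w + norm v + norm \<theta> + norm (p :: 'a::complex_hilbert)"
  for w v \<theta> :: "'a::complex_hilbert"
  using norm_Pair_le[of w "(v, \<theta>, p)"] norm_Pair_le[of v "(\<theta>, p)"] norm_Pair_le[of \<theta> p] by linarith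

lemma norm_quad_ge:
  fixes w v \<theta> p :: "'a::complex_hilbert"
  shows "norm w \<le> norm (w, v, \<theta>, p)" "norm v \<le> norm (w, v, \<theta>, p)"
    "norm \<theta> \<le> norm (w, v, \<theta>, p)" "norm p \<le> norm (w, v, \<theta>, p)"
proof -
  have "(norm w)\<^sup>2 \<le> (norm (w, v, \<theta>, p))\<^sup>2" "(norm v)\<^sup>2 \<le> (norm (w, v, \<theta>, p))\<^sup>2"
    "(norm \<theta>)\<^sup>2 \<le> (norm (w, v, \<theta>, p))\<^sup>2" "(norm p)\<^sup>2 \<le> (norm (w, v, \<theta>, p))\<^sup>2"
    unfolding norm_quad_square by auto
  then show "norm w \<le> norm (w, v, \<theta>, p)" "norm v \<le> norm (w, v, \<theta>, p)"
    "norm \<theta> \<le> norm (w, v, \<theta>, p)" "norm p \<le> norm (w, v, \<theta>, p)"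
    by (auto elim: power2_le_imp_le)
qed

text \<open>The couplings through \<open>a\<close>, \<open>b\<close>, \<open>c\<close> are
  skew-symmetric and cancel in the real part; only the damping \<open>-d |p|^2\<close>
  remains.\<close>

lemma gen_dissipative:
  assumes "d \<ge> 0"
  shows "Re (cinner (gen a b c d y) y) \<le> 0"
proof -
  obtain w v \<theta> p where y: "y = (w, v, \<theta>, p)"
    by (cases y) auto
  have "Re (cinner (gen a b c d y) y) = - d * (norm p)\<^sup>2"
    by (simp add: y gen_def cinner_prod_def cinner_simps cinner_self_eq Re_cinner_commute[of v w]
        Re_cinner_commute[of \<theta> v] Re_cinner_commute[of p \<theta>])
  then show ?thesis
    using assms by simp
qed

lemma norm_le_norm_minus_gen:
  assumes "d \<ge> 0"
  shows "norm y \<le> norm (y - gen a b c d y)"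
proof -
  have "Re (cinner y (gen a b c d y)) \<le> 0"
    using gen_dissipative[OF assms] by (subst Re_cinner_commute)
  then have "(norm y)\<^sup>2 \<le> (norm (y - gen a b c d y))\<^sup>2"
    unfolding norm_diff_square using zero_le_power2[of "norm (gen a b c d y)"] by linarith
  then show ?thesis
    by (rule power2_le_imp_le) simp
qed

text \<open>Elimination of \<open>w\<close>, \<open>v\<close>, \<open>p\<close> leaves one equation
  for \<open>\<theta>\<close>. Only real multiples of the data occur, so the solution stays in the
  subspace, which will be an eigenspace.\<close>

lemma minus_gen_surjective:
  fixes S :: "'a::complex_hilbert set"
  assumes "d \<ge> 0" and S: "complex_subspace S" and z: "z \<in> S \<times> S \<times> S \<times> S"
  shows "\<exists>y\<in>S \<times> S \<times> S \<times> S. y - gen a b c d y = z"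
proof -
  obtain z1 z2 z3 z4 where z_eq: "z = (z1, z2, z3, z4)" and zS: "z1 \<in> S" "z2 \<in> S" "z3 \<in> S" "z4 \<in> S"
    using z by auto
  \<comment> \<open>The Schur complement, that is the factor of \<open>\<theta>\<close> after the
    elimination; it is at least 1.\<close>
  define m where "m = 1 + c\<^sup>2 / (1 + d) + b\<^sup>2 / (1 + a\<^sup>2)"
  have "m > 0"
    using \<open>d \<ge> 0\<close> by (simp add: m_def add_pos_nonneg)
  have a: "1 + a\<^sup>2 \<noteq> 0"
    by (smt (verit) zero_le_power2)
  define \<theta> where "\<theta> = (1 / m) *\<^sub>R
    (z3 + (c / (1 + d)) *\<^sub>R z4 - (b / (1 + a\<^sup>2)) *\<^sub>R z2 + (a * b / (1 + a\<^sup>2)) *\<^sub>R z1)"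
  define v where "v = (1 / (1 + a\<^sup>2)) *\<^sub>R (z2 - a *\<^sub>R z1 + b *\<^sub>R \<theta>)"
  define p where "p = (1 / (1 + d)) *\<^sub>R (z4 - c *\<^sub>R \<theta>)"
  define w where "w = z1 + a *\<^sub>R v"
  have S_add: "x + y \<in> S" if "x \<in> S" "y \<in> S" for x y
    using S that unfolding complex_subspace_iff by blast
  note S_rules = complex_subspace_scaleR[OF S] complex_subspace_diff[OF S]
  have "\<theta> \<in> S"
    unfolding \<theta>_def by (intro S_add S_rules zS)
  then have "v \<in> S"
    unfolding v_def by (intro S_add S_rules zS)
  then have mem: "(w, v, \<theta>, p) \<in> S \<times> S \<times> S \<times> S"
    unfolding w_def p_def using \<open>\<theta> \<in> S\<close> by (auto intro!: S_add S_rules zS)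
  have th: "\<theta> + (c\<^sup>2 / (1 + d)) *\<^sub>R \<theta> + (b\<^sup>2 / (1 + a\<^sup>2)) *\<^sub>R \<theta>
      = z3 + (c / (1 + d)) *\<^sub>R z4 - (b / (1 + a\<^sup>2)) *\<^sub>R z2 + (a * b / (1 + a\<^sup>2)) *\<^sub>R z1"
  proof -
    have "m *\<^sub>R \<theta> = z3 + (c / (1 + d)) *\<^sub>R z4 - (b / (1 + a\<^sup>2)) *\<^sub>R z2 + (a * b / (1 + a\<^sup>2)) *\<^sub>R z1"
      using \<open>m > 0\<close> by (simp add: \<theta>_def)
    then show ?thesis
      by (simp add: m_def scaleR_add_left)
  qed
  have e1: "w - a *\<^sub>R v = z1"
    by (simp add: w_def)
  have "(1 + a\<^sup>2) *\<^sub>R v = z2 - a *\<^sub>R z1 + b *\<^sub>R \<theta>"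
    using a by (simp add: v_def)
  then have e2: "v - (b *\<^sub>R \<theta> - a *\<^sub>R w) = z2"
    by (simp add: w_def scaleR_add_left scaleR_add_right power2_eq_square algebra_simps)
  have e4: "p - (- (c *\<^sub>R \<theta>) - d *\<^sub>R p) = z4"
  proof -
    have "(1 + d) *\<^sub>R p = z4 - c *\<^sub>R \<theta>"
      using \<open>d \<ge> 0\<close> by (simp add: p_def)
    then show ?thesis
      by (simp add: scaleR_add_left algebra_simps)
  qed
  have bv: "b *\<^sub>R v = (b / (1 + a\<^sup>2)) *\<^sub>R z2 - (a * b / (1 + a\<^sup>2)) *\<^sub>R z1 + (b\<^sup>2 / (1 + a\<^sup>2)) *\<^sub>R \<theta>"
    by (simp add: v_def scaleR_diff_right scaleR_add_right power2_eq_square mult.commute)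
  have cp: "c *\<^sub>R p = (c / (1 + d)) *\<^sub>R z4 - (c\<^sup>2 / (1 + d)) *\<^sub>R \<theta>"
    by (simp add: p_def scaleR_diff_right power2_eq_square)
  have e3: "\<theta> - (c *\<^sub>R p - b *\<^sub>R v) = z3"
    using th unfolding bv cp by (simp add: algebra_simps)
  show ?thesis
    using e1 e2 e3 e4 mem by (intro bexI[of _ "(w, v, \<theta>, p)"]) (simp_all add: z_eq gen_def)
qed

subsection \<open>Left eigenfunctionals\<close>

text \<open>A row of four complex numbers acting on a quadruple of vectors. Its value is a vector,
  so one row serves an eigenspace of any multiplicity.\<close>

definition lf ::
  "complex \<times> complex \<times> complex \<times> complex \<Rightarrow> 'a \<times> 'a \<times> 'a \<times> 'a \<Rightarrow> 'a::complex_hilbert" where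
  "lf = (\<lambda>(x1, x2, x3, x4) (w, v, \<theta>, p). x1 *\<^sub>C w + x2 *\<^sub>C v + x3 *\<^sub>C \<theta> + x4 *\<^sub>C p)"

text \<open>The row equation \<open>x M = l x\<close> for the matrix \<open>M\<close> of
  \<open>gen\<close>, read column by column.\<close>

definition left_eigen ::
  "real \<Rightarrow> real \<Rightarrow> real \<Rightarrow> real \<Rightarrow> complex \<Rightarrow> complex \<times> complex \<times> complex \<times> complex \<Rightarrow> bool" where
  "left_eigen a b c d l = (\<lambda>(x1, x2, x3, x4). l * x1 = - a * x2 \<and> l * x2 = a * x1 - b * x3 \<and>
     l * x3 = b * x2 - c * x4 \<and> l * x4 = c * x3 - d * x4)"

lemma bounded_linear_lf: "bounded_linear (lf x :: 'a \<times> 'a \<times> 'a \<times> 'a \<Rightarrow> 'a::complex_hilbert)"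
proof -
  obtain x1 x2 x3 x4 where x: "x = (x1, x2, x3, x4)"
    by (cases x) auto
  have "lf x = (\<lambda>y :: 'a \<times> 'a \<times> 'a \<times> 'a.
    x1 *\<^sub>C fst y + x2 *\<^sub>C fst (snd y) + x3 *\<^sub>C fst (snd (snd y)) + x4 *\<^sub>C snd (snd (snd y)))"
    by (auto simp: lf_def x split: prod.split)
  then show ?thesis
    by (simp only:) (intro bounded_linear_add bounded_linear_compose[OF
        bounded_bilinear.bounded_linear_right[OF bounded_bilinear_scaleC]]
        bounded_linear_fst bounded_linear_snd bounded_linear_fst_comp bounded_linear_snd_comp)
qed

lemma lf_diff: "lf x (y - z) = lf x y - lf x z"
  by (rule linear_diff[OF bounded_linear.linear[OF bounded_linear_lf]])

lemma norm_lf_le: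
  assumes "cmod x1 \<le> k" "cmod x2 \<le> k" "cmod x3 \<le> k" "cmod x4 \<le> k"
  shows "norm (lf (x1, x2, x3, x4) y) \<le> 4 * k * norm (y :: 'a \<times> 'a \<times> 'a \<times> 'a::complex_hilbert)"
proof -
  obtain w v \<theta> p where y: "y = (w, v, \<theta>, p)"
    by (cases y) auto
  have "k \<ge> 0"
    using assms(1) norm_ge_zero order_trans by blast
  have "norm (lf (x1, x2, x3, x4) y)
      \<le> norm (x1 *\<^sub>C w) + norm (x2 *\<^sub>C v) + norm (x3 *\<^sub>C \<theta>) + norm (x4 *\<^sub>C p)"
    unfolding y lf_def split
    by (intro order_trans[OF norm_triangle_ineq] add_mono order_refl)
  also have "\<dots> \<le> k * norm y + k * norm y + k * norm y + k * norm y"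
    unfolding norm_scaleC y using \<open>k \<ge> 0\<close> by (intro add_mono mult_mono assms norm_quad_ge norm_ge_zero)
  finally show ?thesis by simp
qed

lemma lf_gen:
  assumes "left_eigen a b c d l x"
  shows "lf x (gen a b c d y) = l *\<^sub>C lf x y"
proof -
  obtain w v \<theta> p where y: "y = (w, v, \<theta>, p)"
    by (cases y) auto
  obtain x1 x2 x3 x4 where x: "x = (x1, x2, x3, x4)"
    by (cases x) auto
  have "l *\<^sub>C lf x y = (l * x1) *\<^sub>C w + (l * x2) *\<^sub>C v + (l * x3) *\<^sub>C \<theta> + (l * x4) *\<^sub>C p"
    by (simp add: lf_def x y scaleC_add_right scaleC_scaleC)
  also have "\<dots> = (- a * x2) *\<^sub>C w + (a * x1 - b * x3) *\<^sub>C v + (b * x2 - c * x4) *\<^sub>C \<theta>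
      + (c * x3 - d * x4) *\<^sub>C p"
    using assms by (simp only: left_eigen_def x split)
  also have "\<dots> = lf x (gen a b c d y)"
    by (simp add: lf_def gen_def x y scaleC_diff_right scaleC_minus_right scaleC_minus_left
        scaleC_diff_left scaleC_scaleR mult.commute)
  finally show ?thesis by simp
qed

lemma left_eigen_cnj:
  assumes "left_eigen a b c d l (x1, x2, x3, x4)"
  shows "left_eigen a b c d (cnj l) (cnj x1, cnj x2, cnj x3, cnj x4)"
proof -
  have e: "l * x1 = - a * x2" "l * x2 = a * x1 - b * x3" "l * x3 = b * x2 - c * x4"
    "l * x4 = c * x3 - d * x4"
    using assms by (auto simp: left_eigen_def)
  show ?thesis
    unfolding left_eigen_def split
    using e[THEN arg_cong[where f = cnj]] by simp
qed

definition solves ::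
  "real \<Rightarrow> real \<Rightarrow> real \<Rightarrow> real \<Rightarrow> (real \<Rightarrow> 'a \<times> 'a \<times> 'a \<times> 'a::complex_hilbert) \<Rightarrow> bool" where
  "solves a b c d y \<longleftrightarrow> (\<forall>t\<ge>0. (y has_vector_derivative gen a b c d (y t)) (at t within {0..}))"

text \<open>A left eigenvector turns \<open>gen\<close> into multiplication by \<open>l\<close>, so
  after multiplication by \<open>exp (- l t)\<close> the functional is constant along the
  orbit.\<close>

lemma lf_solution:
  assumes y: "solves a b c d y" and l: "left_eigen a b c d l x" and "t \<ge> 0"
  shows "lf x (y t) = exp (l * of_real t) *\<^sub>C lf x (y 0)"
proof -
  define g where "g s = exp (- (l * of_real s)) *\<^sub>C lf x (y s)" for s
  have "(g has_vector_derivative 0) (at s within {0..})" if "s \<in> {0..}" for s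
  proof -
    have "((\<lambda>s. lf x (y s)) has_vector_derivative lf x (gen a b c d (y s))) (at s within {0..})"
      using y that by (intro bounded_linear.has_vector_derivative[OF bounded_linear_lf]) (simp add: solves_def)
    moreover have "((\<lambda>s. exp (- (l * of_real s))) has_vector_derivative
        - l * exp (- (l * of_real s))) (at s within {0..})"
      by (rule has_vector_derivative_real_field) (auto intro!: derivative_eq_intros)
    ultimately have "((\<lambda>s. exp (- (l * of_real s)) *\<^sub>C lf x (y s)) has_vector_derivative
        exp (- (l * of_real s)) *\<^sub>C lf x (gen a b c d (y s))
        + (- l * exp (- (l * of_real s))) *\<^sub>C lf x (y s)) (at s within {0..})"
      by (intro bounded_bilinear.has_vector_derivative[OF bounded_bilinear_scaleC])
    then show ?thesis
      unfolding g_def lf_gen[OF l] by (simp add: scaleC_scaleC scaleC_minus_left mult.commute)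
  qed
  then obtain k where "\<And>s. s \<in> {0..} \<Longrightarrow> g s = k"
    using has_vector_derivative_zero_constant[of "{0..}" g] convex_real_interval(1) by blast
  then have "g t = g 0"
    using \<open>t \<ge> 0\<close> by simp
  then have "exp (l * of_real t) *\<^sub>C exp (- (l * of_real t)) *\<^sub>C lf x (y t)
      = exp (l * of_real t) *\<^sub>C lf x (y 0)"
    by (simp add: g_def)
  then show ?thesis
    by (simp add: scaleC_scaleC exp_minus)
qed

text \<open>Here \<open>g\<close> plays the role of \<open>(I - M)^{-2} u\<close> and the orbit
  starts at \<open>M g\<close>, as for the semigroup composed with the generator and the squared
  resolvent. A left eigenvector turns each operator into a scalar. Being an equality, it serves the
  upper and the lower bound alike.\<close>

lemma norm_lf_orbit:
  assumes y: "solves a b c d y" and l: "left_eigen a b c d l x" and "t \<ge> 0" and "l \<noteq> 1"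
    and "y 0 = gen a b c d g" "g - gen a b c d g = r" "r - gen a b c d r = u"
  shows "norm (lf x (y t)) = exp (Re l * t) * (cmod l / (cmod (1 - l))\<^sup>2) * norm (lf x u)"
proof -
  have res: "lf x (h - gen a b c d h) = (1 - l) *\<^sub>C lf x h" for h
    by (simp add: lf_diff lf_gen[OF l] scaleC_diff_left)
  have "lf x u = ((1 - l) * (1 - l)) *\<^sub>C lf x g"
    using res[of r] res[of g] assms(6,7) by (simp add: scaleC_scaleC)
  then have u: "norm (lf x u) = (cmod (1 - l))\<^sup>2 * norm (lf x g)"
    by (simp add: norm_scaleC norm_mult power2_eq_square)
  have "norm (lf x (y t)) = cmod (exp (l * of_real t)) * (cmod l * norm (lf x g))"
    unfolding lf_solution[OF y l \<open>t \<ge> 0\<close>] assms(5) lf_gen[OF l] by (simp add: norm_scaleC)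
  also have "cmod (exp (l * of_real t)) = exp (Re l * t)"
    by (simp add: norm_exp_eq_Re)
  finally show ?thesis
    using \<open>l \<noteq> 1\<close> unfolding u by simp
qed


subsection \<open>Eigenvalues for strong coupling\<close>

text \<open>The characteristic polynomial of the matrix of \<open>gen\<close>. It is polymorphic
  because two roots come from the intermediate value theorem over the reals, while the remaining
  pair is complex.\<close>

definition char_poly :: "real \<Rightarrow> real \<Rightarrow> real \<Rightarrow> real \<Rightarrow> 'a::real_algebra_1 \<Rightarrow> 'a" where
  "char_poly a b c d x = x^4 + of_real d * x^3 + of_real (a\<^sup>2 + b\<^sup>2 + c\<^sup>2) * x\<^sup>2
     + of_real (d * (a\<^sup>2 + b\<^sup>2)) * x + of_real (a\<^sup>2 * c\<^sup>2)"

text \<open>The condition \<open>small\<close> holds for all large eigenvalues because \<open>\<alpha> > (\<beta> + 1)/2\<close>. The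
  characteristic polynomial then has the real roots \<open>-l1\<close> (near \<open>0\<close>) and \<open>-l2\<close> (near \<open>-d\<close>) and
  splits off a factor \<open>x\<^sup>2 + z x + w\<close> with \<open>w\<close> close to \<open>b\<^sup>2\<close> and \<open>z\<close> of the order of
  \<open>d c\<^sup>2 / b\<^sup>2\<close>. The four left eigenfunctionals are small perturbations of \<open>w\<close>, \<open>p\<close> and
  \<open>v \<plusminus> \<i> \<theta>\<close>, hence control the norm uniformly.\<close>

locale strong_coupling =
  fixes a b c d :: real
  assumes pos: "a > 0" "b > 0" "c > 0" "d > 0"
    and small: "1000 * (1 + d + 1 / d) * ((1 + a) * (1 + c)) \<le> b"
begin

text \<open>The factor \<open>1 + d + 1 / d\<close> dominates 1, \<open>d\<close> and
  \<open>1 / d\<close>, and \<open>(1 + a) * (1 + c)\<close> dominates 1, \<open>a\<close>,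
  \<open>c\<close> and \<open>a * c\<close>, so one condition yields all six. The number 1000 is a
  generous margin for the perturbation estimates that follow.\<close>

lemma small_bounds:
  shows "1000 * a \<le> b" "1000 * c \<le> b" "1000 * d \<le> b" "1000 \<le> b"
    "1000 * (a * c) \<le> b" "1000 * (a * c) \<le> d * b"
proof -
  have D: "1 + d + 1 / d \<ge> 1" "1 + d + 1 / d \<ge> d" "1 + d + 1 / d \<ge> 1 / d"
    using pos by auto
  have C: "(1 + a) * (1 + c) \<ge> 1" "(1 + a) * (1 + c) \<ge> a" "(1 + a) * (1 + c) \<ge> c"
    "(1 + a) * (1 + c) \<ge> a * c"
    using pos by (auto simp: algebra_simps intro: add_nonneg_nonneg)
  have *: "1000 * (x * y) \<le> b" if "x \<le> 1 + d + 1 / d" "y \<le> (1 + a) * (1 + c)" "0 \<le> x" "0 \<le> y" for x y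
  proof -
    have "x * y \<le> (1 + d + 1 / d) * ((1 + a) * (1 + c))"
      using that D(1) by (intro mult_mono) auto
    then show ?thesis
      using small by linarith
  qed
  show "1000 * a \<le> b" "1000 * c \<le> b" "1000 * d \<le> b" "1000 \<le> b" "1000 * (a * c) \<le> b"
    using *[of 1 a] *[of 1 c] *[of d 1] *[of 1 1] *[of 1 "a * c"] D C pos by auto
  have "1000 * (1 / d * (a * c)) \<le> b"
    using pos by (intro * D C) auto
  then show "1000 * (a * c) \<le> d * b"
    using pos by (simp add: field_simps)
qed

text \<open>The polynomial is positive at 0 and at \<open>- d\<close> and negative at
  \<open>- (d / 2)\<close>, where the term \<open>- d^2 b^2 / 4\<close> dominates; this puts one
  root on either side of the midpoint.\<close>

lemma ex_real_roots:
  "\<exists>l1 l2. 0 < l1 \<and> l1 < d / 2 \<and> d / 2 < l2 \<and> l2 < d \<and>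
     char_poly a b c d (- l1) = 0 \<and> char_poly a b c d (- l2) = 0"
proof -
  have cont: "continuous_on S (char_poly a b c d)" for S :: "real set"
    unfolding char_poly_def by (intro continuous_intros)
  have P0: "char_poly a b c d (0 :: real) > 0"
    using pos by (simp add: char_poly_def)
  have "char_poly a b c d (- d) = c\<^sup>2 * (d\<^sup>2 + a\<^sup>2)"
    by (simp add: char_poly_def power4_eq_xxxx power3_eq_cube power2_eq_square algebra_simps)
  then have P1: "char_poly a b c d (- d) > 0"
    using pos by (simp add: add_pos_pos)
  have "char_poly a b c d (- (d / 2)) = c\<^sup>2 * (d\<^sup>2 / 4 + a\<^sup>2) - d\<^sup>2 / 4 * (d\<^sup>2 / 4 + a\<^sup>2 + b\<^sup>2)"
    by (simp add: char_poly_def power4_eq_xxxx power3_eq_cube power2_eq_square algebra_simps)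
  also have "\<dots> < 0"
  proof -
    have "c\<^sup>2 \<le> (b / 1000)\<^sup>2" "(a * c)\<^sup>2 \<le> (d * b / 1000)\<^sup>2"
      using pos small_bounds by (auto intro!: power_mono)
    then have "c\<^sup>2 \<le> b\<^sup>2 / 1000000" "a\<^sup>2 * c\<^sup>2 \<le> d\<^sup>2 * b\<^sup>2 / 1000000"
      by (auto simp: power_mult_distrib power_divide)
    then have "d\<^sup>2 * c\<^sup>2 \<le> d\<^sup>2 * (b\<^sup>2 / 1000000)"
      by (intro mult_left_mono) auto
    moreover have "d\<^sup>2 * b\<^sup>2 > 0" "d\<^sup>2 * d\<^sup>2 > 0" "d\<^sup>2 * a\<^sup>2 > 0"
      using pos by auto
    moreover have "c\<^sup>2 * (d\<^sup>2 / 4 + a\<^sup>2) - d\<^sup>2 / 4 * (d\<^sup>2 / 4 + a\<^sup>2 + b\<^sup>2)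
        = (d\<^sup>2 * c\<^sup>2) / 4 + a\<^sup>2 * c\<^sup>2 - (d\<^sup>2 * d\<^sup>2) / 16 - (d\<^sup>2 * a\<^sup>2) / 4 - (d\<^sup>2 * b\<^sup>2) / 4"
      by (simp add: field_simps)
    ultimately show ?thesis
      using \<open>a\<^sup>2 * c\<^sup>2 \<le> d\<^sup>2 * b\<^sup>2 / 1000000\<close> by linarith
  qed
  finally have Ph: "char_poly a b c d (- (d / 2)) < 0" .
  have "\<exists>x\<ge>- (d / 2). x \<le> 0 \<and> char_poly a b c d x = 0"
    using P0 Ph pos by (intro IVT' cont) auto
  then obtain x where x: "- (d / 2) \<le> x" "x \<le> 0" "char_poly a b c d x = 0" by blast
  have "\<exists>x\<ge>- d. x \<le> - (d / 2) \<and> char_poly a b c d x = 0"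
    using P1 Ph pos by (intro IVT2' cont) auto
  then obtain y where y: "- d \<le> y" "y \<le> - (d / 2)" "char_poly a b c d y = 0" by blast
  have "x \<noteq> 0" "x \<noteq> - (d / 2)" "y \<noteq> - d" "y \<noteq> - (d / 2)"
    using P0 P1 Ph x(3) y(3) by auto
  then show ?thesis
    using x y by (intro exI[of _ "- x"] exI[of _ "- y"]) auto
qed


text \<open>Division by \<open>(x + l1) * (x + l2)\<close> leaves a remainder of degree at most one
  with two distinct zeros, hence the zero polynomial. Comparing coefficients gives \<open>w\<close>
  close to \<open>b^2\<close> and \<open>l1 * l2\<close> of the order \<open>a^2 c^2 / b^2\<close>,
  from which the size of the damping \<open>z\<close> follows.\<close>

lemma ex_factorisation:
  "\<exists>l1 l2 z w. 0 < l1 \<and> l1 < d / 2 \<and> d / 2 < l2 \<and> l2 < d \<and>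
     char_poly a b c d (- l1) = 0 \<and> char_poly a b c d (- l2) = 0 \<and>
     l1 + l2 + z = d \<and> l1 * l2 + w + (l1 + l2) * z = a\<^sup>2 + b\<^sup>2 + c\<^sup>2 \<and>
     (l1 + l2) * w + l1 * l2 * z = d * (a\<^sup>2 + b\<^sup>2) \<and> l1 * l2 * w = a\<^sup>2 * c\<^sup>2 \<and>
     99 * b\<^sup>2 \<le> 100 * w \<and> 100 * w \<le> 101 * b\<^sup>2 \<and>
     d * c\<^sup>2 / (6 * b\<^sup>2) \<le> z \<and> z \<le> 4 * d * c\<^sup>2 / b\<^sup>2 \<and> l1 * (d * b\<^sup>2) \<le> 4 * (a\<^sup>2 * c\<^sup>2)"
proof -
  obtain l1 l2 where l: "0 < l1" "l1 < d / 2" "d / 2 < l2" "l2 < d"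
    "char_poly a b c d (- l1) = 0" "char_poly a b c d (- l2) = 0"
    using ex_real_roots by blast
  define S where "S = l1 + l2"
  define Q where "Q = l1 * l2"
  define z where "z = d - S"
  define w where "w = a\<^sup>2 + b\<^sup>2 + c\<^sup>2 - Q - S * z"
  define r1 where "r1 = d * (a\<^sup>2 + b\<^sup>2) - (S * w + Q * z)"
  define r0 where "r0 = a\<^sup>2 * c\<^sup>2 - Q * w"
  have fact: "char_poly a b c d x = (x + l1) * (x + l2) * (x\<^sup>2 + z * x + w) + r1 * x + r0" for x
    unfolding char_poly_def r1_def r0_def w_def z_def S_def Q_def of_real_eq_id id_apply
    by (simp add: power4_eq_xxxx power3_eq_cube power2_eq_square algebra_simps)
  have r: "r0 = r1 * l1" "r0 = r1 * l2"
    using fact[of "- l1"] fact[of "- l2"] l(5,6) by auto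
  then have "r1 = 0" "r0 = 0"
    using l by auto
  then have Qw: "Q * w = a\<^sup>2 * c\<^sup>2" and Sw: "S * w + Q * z = d * (a\<^sup>2 + b\<^sup>2)"
    by (auto simp: r0_def r1_def)
  define B where "B = b\<^sup>2"
  have "B > 0"
    using pos by (simp add: B_def)
  have sq: "1000000 * a\<^sup>2 \<le> B" "1000000 * c\<^sup>2 \<le> B" "1000000 * d\<^sup>2 \<le> B"
    using power_mono[OF small_bounds(1), of 2] power_mono[OF small_bounds(2), of 2]
      power_mono[OF small_bounds(3), of 2] pos by (auto simp: B_def power_mult_distrib)
  have nn: "a\<^sup>2 \<ge> 0" "c\<^sup>2 \<ge> 0"
    by auto
  have S: "0 < S" "S \<le> 3 * d / 2" and z0: "\<bar>z\<bar> \<le> d / 2"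
    using l(1-4) unfolding S_def z_def by linarith+
  have "Q > 0"
    using l by (simp add: Q_def)
  have "Q \<le> d / 2 * d"
    unfolding Q_def using l by (intro mult_mono) auto
  then have Qd: "Q \<le> d\<^sup>2 / 2"
    by (simp add: power2_eq_square)
  have "\<bar>S * z\<bar> \<le> 3 * d / 2 * (d / 2)"
    unfolding abs_mult using S z0 by (intro mult_mono) auto
  then have "\<bar>S * z\<bar> \<le> 3 * d\<^sup>2 / 4"
    by (simp add: power2_eq_square)
  then have Sz: "S * z \<le> 3 * d\<^sup>2 / 4" "- (3 * d\<^sup>2 / 4) \<le> S * z"
    by (simp_all add: abs_le_iff)
  have w: "99 * B \<le> 100 * w" "100 * w \<le> 101 * B"
    using Sz Qd \<open>Q > 0\<close> sq nn \<open>B > 0\<close> w_def B_def by linarith+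
  have "Q * B \<le> Q * (2 * w)"
    using w \<open>Q > 0\<close> \<open>B > 0\<close> by (intro mult_left_mono) auto
  then have QB: "Q * B \<le> 2 * (a\<^sup>2 * c\<^sup>2)"
    using Qw by simp
  have "a\<^sup>2 * c\<^sup>2 \<le> B / 1000000 * c\<^sup>2"
    using sq(1) by (intro mult_right_mono) auto
  moreover have "c\<^sup>2 * B \<ge> 0" "B / 1000000 * c\<^sup>2 = c\<^sup>2 * B / 1000000" "c\<^sup>2 / 2 * B = c\<^sup>2 * B / 2"
    using \<open>B > 0\<close> by auto
  ultimately have "Q * B \<le> c\<^sup>2 / 2 * B"
    using QB by linarith
  then have Qc: "Q \<le> c\<^sup>2 / 2"
    using \<open>B > 0\<close> by (rule mult_right_le_imp_le)
  \<comment> \<open>The factor of \<open>z\<close> when \<open>l1 + l2 = d - z\<close> and the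
    formula for \<open>w\<close> are substituted into the linear coefficient:
    \<open>z * M = d * (c^2 - Q)\<close>. As \<open>M\<close> is comparable to \<open>b^2\<close>
    and \<open>Q\<close> is at most \<open>c^2 / 2\<close>, this gives both bounds on the
    damping.\<close>
  define M where "M = w - Q + d * S"
  have "d * S \<ge> 0" "d * S \<le> d * (3 * d / 2)"
    using S pos by (auto intro: mult_left_mono)
  then have dS: "d * S \<ge> 0" "d * S \<le> 3 * d\<^sup>2 / 2"
    by (auto simp: power2_eq_square)
  have M: "B / 4 \<le> M" "M \<le> 3 * B"
    using dS w Qd sq(3) \<open>Q > 0\<close> \<open>B > 0\<close> unfolding M_def by linarith+
  have zM: "z * M = d * (c\<^sup>2 - Q)"
  proof -
    have "S = d - z"
      by (simp add: z_def)
    have "S * w + Q * z = d * w - z * w + Q * z"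
      unfolding \<open>S = d - z\<close> by (simp add: algebra_simps)
    then have "d * w - z * w + Q * z = d * (w - c\<^sup>2 + Q + S * z)"
      using Sw by (simp add: w_def)
    then show ?thesis
      by (simp add: M_def algebra_simps)
  qed
  have "M > 0"
    using M \<open>B > 0\<close> by linarith
  have "z > 0"
  proof -
    have "c\<^sup>2 > 0"
      using pos by simp
    then have "d * (c\<^sup>2 - Q) > 0"
      using pos Qc by (intro mult_pos_pos) linarith+
    then show ?thesis
      using zM \<open>M > 0\<close> by (metis zero_less_mult_pos2)
  qed
  have "z * (B / 4) \<le> z * M"
    using M \<open>z > 0\<close> by (intro mult_left_mono) auto
  also have "\<dots> \<le> d * c\<^sup>2"
    unfolding zM using pos \<open>Q > 0\<close> by (intro mult_left_mono) auto
  finally have z1: "z \<le> 4 * d * c\<^sup>2 / B"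
    using \<open>B > 0\<close> by (simp add: field_simps)
  have "d * (c\<^sup>2 / 2) \<le> d * (c\<^sup>2 - Q)"
    using pos Qc by (intro mult_left_mono) auto
  also have "\<dots> \<le> z * (3 * B)"
    unfolding zM[symmetric] using M \<open>z > 0\<close> by (intro mult_left_mono) auto
  finally have z2: "d * c\<^sup>2 / (6 * B) \<le> z"
    using \<open>B > 0\<close> by (simp add: field_simps)
  have "l1 * (d / 2) * B \<le> Q * B"
    unfolding Q_def using l \<open>B > 0\<close> by (intro mult_right_mono mult_left_mono) auto
  then have "l1 * (d * B) \<le> 4 * (a\<^sup>2 * c\<^sup>2)"
    using QB by (simp add: algebra_simps)
  then show ?thesis
    using l w z1 z2 Qw Sw unfolding B_def
    by (intro exI[of _ l1] exI[of _ l2] exI[of _ z] exI[of _ w])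
      (simp add: z_def w_def S_def Q_def)
qed

end

section \<open>Left eigenvectors of the four roots\<close>

lemma left_eigen_of_real:
  assumes "l * x1 = - a * x2" "l * x2 = a * x1 - b * x3" "l * x3 = b * x2 - c * x4"
    "l * x4 = c * x3 - d * x4"
  shows "left_eigen a b c d (of_real l) (of_real x1, of_real x2, of_real x3, of_real x4)"
  using assms by (simp add: left_eigen_def complex_eq_iff)

text \<open>With the second entry normalised to 1, the first, second and fourth equations determine
  the other entries, and the third then amounts to the characteristic equation.\<close>

lemma left_eigen_general:
  assumes char: "char_poly a b c d l = 0" and "l \<noteq> 0" "l + of_real d \<noteq> 0" "b \<noteq> 0"
    and z: "z = - (l + (of_real a)\<^sup>2 / l) / of_real b"
  shows "left_eigen a b c d l (- (of_real a / l), 1, z, of_real c * z / (l + of_real d))"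
proof -
  have bz: "of_real b * z = - (l + (of_real a)\<^sup>2 / l)"
    using \<open>b \<noteq> 0\<close> by (simp add: z)
  have lbz: "l * of_real b * z = - (l\<^sup>2 + (of_real a)\<^sup>2)"
    using \<open>l \<noteq> 0\<close> by (simp only: mult.assoc bz) (simp add: power2_eq_square distrib_left right_diff_distrib)
  have "l * of_real b * (z * (l\<^sup>2 + of_real d * l + (of_real c)\<^sup>2))
      = l * of_real b * (of_real b * (l + of_real d))"
  proof -
    have "l * of_real b * (z * (l\<^sup>2 + of_real d * l + (of_real c)\<^sup>2))
        = - (l\<^sup>2 + (of_real a)\<^sup>2) * (l\<^sup>2 + of_real d * l + (of_real c)\<^sup>2)"
      by (simp only: lbz flip: mult.assoc)
    also have "\<dots> = l * of_real b * (of_real b * (l + of_real d)) - char_poly a b c d l"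
      by (simp add: char_poly_def power4_eq_xxxx power3_eq_cube power2_eq_square algebra_simps)
    finally show ?thesis
      by (simp only: char diff_zero)
  qed
  then have *: "z * (l\<^sup>2 + of_real d * l + (of_real c)\<^sup>2) = of_real b * (l + of_real d)"
    using \<open>l \<noteq> 0\<close> \<open>b \<noteq> 0\<close> by simp
  have "l * z * (l + of_real d) = of_real b * (l + of_real d) - (of_real c)\<^sup>2 * z"
    using * by (simp add: power2_eq_square algebra_simps)
  then have "l * z = of_real b - of_real c * (of_real c * z / (l + of_real d))"
    using assms(3) by (simp add: field_simps power2_eq_square)
  moreover have "l = of_real a * (- (of_real a / l)) - of_real b * z"
    unfolding bz by (simp add: power2_eq_square)
  moreover have "l * (of_real c * z / (l + of_real d))
      = of_real c * z - of_real d * (of_real c * z / (l + of_real d))"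
    using assms(3) by (simp add: field_simps)
  ultimately show ?thesis
    using \<open>l \<noteq> 0\<close> by (simp add: left_eigen_def)
qed

context strong_coupling
begin

text \<open>Normalised by the first entry instead of the second, since \<open>l\<close> is tiny
  compared with \<open>a\<close> and the quotient \<open>a / l\<close> of the general formula would
  be large. The other entries are small because \<open>l \<le> a / 1000\<close> and
  \<open>1000 * (a * c) \<le> d * b\<close>.\<close>

lemma slow_functional:
  assumes l: "0 < l" "l < d / 2" and char: "char_poly a b c d (- l) = 0"
    and le: "l * (d * b\<^sup>2) \<le> 4 * (a\<^sup>2 * c\<^sup>2)"
  shows "\<exists>x2 x3 x4. left_eigen a b c d (of_real (- l)) (of_real 1, of_real x2, of_real x3, of_real x4)
    \<and> \<bar>x2\<bar> \<le> 1 / 100 \<and> \<bar>x3\<bar> \<le> 1 / 100 \<and> \<bar>x4\<bar> \<le> 1 / 100"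
proof -
  define x2 where "x2 = l / a"
  define x3 where "x3 = (a + l * x2) / b"
  define x4 where "x4 = c * x3 / (d - l)"
  have dl: "d - l > 0"
    using l pos by linarith
  have "left_eigen a b c d (of_real (- l)) (of_real 1, of_real x2, of_real x3, of_real x4)"
  proof (rule left_eigen_of_real)
    show "- l * 1 = - a * x2"
      using pos by (simp add: x2_def)
    show "- l * x2 = a * 1 - b * x3"
      using pos by (simp add: x3_def)
    show "- l * x4 = c * x3 - d * x4"
      using dl by (simp add: x4_def field_simps)
    have "a * b * x3 = a\<^sup>2 + l\<^sup>2"
      using pos by (simp add: x3_def x2_def power2_eq_square field_simps)
    then have "a * b * (x3 * (c\<^sup>2 - l * (d - l))) = (a\<^sup>2 + l\<^sup>2) * (c\<^sup>2 - l * (d - l))"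
      by (simp only: flip: mult.assoc)
    also have "\<dots> = b\<^sup>2 * l * (d - l) + char_poly a b c d (- l)"
      by (simp add: char_poly_def power4_eq_xxxx power3_eq_cube power2_eq_square algebra_simps)
    also have "\<dots> = a * b * (b * x2 * (d - l))"
      using pos by (simp add: char x2_def power2_eq_square)
    finally have "x3 * (c\<^sup>2 - l * (d - l)) = b * x2 * (d - l)"
      using pos by simp
    moreover have "x4 * (d - l) = c * x3"
      using dl by (simp add: x4_def)
    moreover have "(b * x2 - c * x4) * (d - l) = b * x2 * (d - l) - c * (x4 * (d - l))"
      by (simp add: algebra_simps)
    ultimately have "(- l * x3) * (d - l) = (b * x2 - c * x4) * (d - l)"
      by (simp add: power2_eq_square algebra_simps)
    then show "- l * x3 = b * x2 - c * x4"
      using dl mult_right_cancel[of "d - l" "- l * x3"] by auto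
  qed
  moreover have x2: "0 \<le> x2" "x2 \<le> 1 / 1000"
  proof -
    have "l * (d * b\<^sup>2) \<le> (4 * a) * ((a * c) * c)"
      using le by (simp add: power2_eq_square algebra_simps)
    also have "\<dots> \<le> (4 * a) * ((d * b / 1000) * (b / 1000))"
      using small_bounds pos by (intro mult_left_mono mult_mono) auto
    also have "\<dots> \<le> (a / 1000) * (d * b\<^sup>2)"
      using pos by (simp add: power2_eq_square)
    finally have "l \<le> a / 1000"
      using pos by simp
    then show "0 \<le> x2" "x2 \<le> 1 / 1000"
      using pos l by (auto simp: x2_def field_simps)
  qed
  moreover have x3: "0 \<le> x3" "x3 \<le> 2 / 1000"
  proof -
    have "l * x2 \<le> d * 1"
      using l x2 pos by (intro mult_mono) auto
    then have "a + l * x2 \<le> b * (2 / 1000)"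
      using small_bounds by linarith
    then show "0 \<le> x3" "x3 \<le> 2 / 1000"
      using pos l x2 by (auto simp: x3_def field_simps intro!: add_nonneg_nonneg)
  qed
  moreover have "0 \<le> x4" "x4 \<le> 3 / 1000"
  proof -
    have x3b: "x3 * b = a + l * x2"
      using pos by (simp add: x3_def)
    have "c * x3 * b = a * c + c * (l * x2)"
      unfolding mult.assoc x3b by (simp add: distrib_left)
    also have "c * (l * x2) \<le> b / 1000 * (d / 2 * (1 / 1000))"
      using l x2 pos small_bounds by (intro mult_mono) auto
    finally have "c * x3 * b \<le> a * c + d * b / 2000000"
      by (simp add: mult.commute)
    moreover have "d * b > 0"
      using pos by simp
    ultimately have "c * x3 * b \<le> 3 / 2000 * (d * b)"
      using small_bounds(6) by linarith
    then have "c * x3 * b \<le> (3 / 1000 * (d / 2)) * b"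
      by simp
    then have "c * x3 \<le> 3 / 1000 * (d / 2)"
      using pos by simp
    also have "\<dots> \<le> 3 / 1000 * (d - l)"
      using l by simp
    finally show "x4 \<le> 3 / 1000"
      using dl by (simp add: x4_def pos_divide_le_eq)
    show "0 \<le> x4"
      using x3 pos dl by (simp add: x4_def)
  qed
  ultimately show ?thesis
    by (intro exI[of _ x2] exI[of _ x3] exI[of _ x4]) simp
qed

text \<open>Normalised by the last entry, because \<open>d - l\<close>, which stands in a
  denominator of the general formula, may be very small. The hypothesis \<open>le\<close> measures
  how close \<open>l\<close> is to \<open>d\<close> and gives
  \<open>d - l \<le> 8 / 1000000 * c\<close>.\<close>

lemma damped_functional:
  assumes l: "d / 2 < l" "l < d" and char: "char_poly a b c d (- l) = 0"
    and le: "(d - l) * (d * b\<^sup>2) \<le> 4 * (a\<^sup>2 * c\<^sup>2) + 4 * (d * c)\<^sup>2"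
  shows "\<exists>y1 y2 y3. left_eigen a b c d (of_real (- l)) (of_real y1, of_real y2, of_real y3, of_real 1)
    \<and> \<bar>y1\<bar> \<le> 1 / 100 \<and> \<bar>y2\<bar> \<le> 1 / 100 \<and> \<bar>y3\<bar> \<le> 1 / 100"
proof -
  define y3 where "y3 = (d - l) / c"
  define y2 where "y2 = (c - l * y3) / b"
  define y1 where "y1 = a * y2 / l"
  have "l > 0"
    using l pos by linarith
  have "left_eigen a b c d (of_real (- l)) (of_real y1, of_real y2, of_real y3, of_real 1)"
  proof (rule left_eigen_of_real)
    show "- l * y1 = - a * y2"
      using \<open>l > 0\<close> by (simp add: y1_def)
    show "- l * y3 = b * y2 - c * 1"
      using pos by (simp add: y2_def)
    show "- l * 1 = c * y3 - d * 1"
      using pos by (simp add: y3_def)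
    have "c * (b * y2) = c\<^sup>2 - l * (d - l)"
      using pos by (simp add: y2_def y3_def power2_eq_square field_simps)
    then have "c * (b * y2 * (l\<^sup>2 + a\<^sup>2)) = (c\<^sup>2 - l * (d - l)) * (l\<^sup>2 + a\<^sup>2)"
      by (simp only: flip: mult.assoc)
    also have "\<dots> = b\<^sup>2 * l * (d - l) + char_poly a b c d (- l)"
      by (simp add: char_poly_def power4_eq_xxxx power3_eq_cube power2_eq_square algebra_simps)
    also have "\<dots> = c * (b * (b * l * y3))"
      using pos by (simp add: char y3_def power2_eq_square)
    finally have "y2 * (l\<^sup>2 + a\<^sup>2) = b * l * y3"
      using pos by simp
    then have "(- l * y2) * l = (a * y1 - b * y3) * l"
      using \<open>l > 0\<close> by (simp add: y1_def power2_eq_square algebra_simps)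
    then show "- l * y2 = a * y1 - b * y3"
      using \<open>l > 0\<close> mult_right_cancel[of l "- l * y2"] by blast
  qed
  moreover have y3: "0 \<le> y3" "y3 \<le> 1 / 1000"
  proof -
    have "(a\<^sup>2 * c\<^sup>2) \<le> c * (d * b / 1000) * (b / 1000)"
    proof -
      have "a\<^sup>2 * c\<^sup>2 = c * (a * c) * a"
        by (simp add: power2_eq_square)
      also have "\<dots> \<le> c * (d * b / 1000) * (b / 1000)"
        using small_bounds pos by (intro mult_mono) auto
      finally show ?thesis .
    qed
    moreover have "(d * c)\<^sup>2 \<le> d * c * (b / 1000 * (b / 1000))"
    proof -
      have "(d * c)\<^sup>2 = d * c * (d * c)"
        by (simp add: power2_eq_square)
      also have "\<dots> \<le> d * c * (b / 1000 * (b / 1000))"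
        using small_bounds pos by (intro mult_left_mono mult_mono) auto
      finally show ?thesis .
    qed
    ultimately have "(d - l) * (d * b\<^sup>2) \<le> 8 / 1000000 * c * (d * b\<^sup>2)"
      using le by (simp add: power2_eq_square algebra_simps)
    then have "d - l \<le> 8 / 1000000 * c"
      using pos by simp
    then show "0 \<le> y3" "y3 \<le> 1 / 1000"
      using pos l by (auto simp: y3_def field_simps)
  qed
  have "l * y3 \<le> d * (1 / 1000)"
    using l y3 pos by (intro mult_mono) auto
  then have ly: "0 \<le> l * y3" "l * y3 \<le> d * (1 / 1000)"
    using y3 \<open>l > 0\<close> by auto
  have "\<bar>c - l * y3\<bar> \<le> b * (2 / 1000)"
    using ly small_bounds(2,3) pos by (intro abs_leI) linarith+
  then have "\<bar>y2\<bar> \<le> 2 / 1000"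
    using pos by (simp add: y2_def field_simps)
  moreover have "\<bar>y1\<bar> \<le> 4 / 1000"
  proof -
    have "a * (l * y3) \<le> b / 1000 * (d * (1 / 1000))"
      by (rule mult_mono) (use ly small_bounds(1) pos in linarith)+
    then have "a * (l * y3) \<le> d * b / 1000000"
      by (simp add: mult.commute)
    moreover have "0 \<le> a * (l * y3)" "0 < a * c" "0 < d * b"
      using pos ly by auto
    ultimately have "\<bar>a * c - a * (l * y3)\<bar> \<le> 2 / 1000 * (d * b)"
      using small_bounds(6) by (intro abs_leI) linarith+
    then have "\<bar>a * (c - l * y3)\<bar> \<le> (4 / 1000 * (d / 2)) * b"
      by (simp add: right_diff_distrib)
    also have "\<dots> \<le> (4 / 1000 * l) * b"
      using l pos by (intro mult_right_mono) auto
    finally show ?thesis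
      using pos \<open>l > 0\<close> by (simp add: y1_def y2_def abs_mult field_simps)
  qed
  ultimately show ?thesis
    using y3 by (intro exI[of _ y1] exI[of _ y2] exI[of _ y3]) simp
qed

text \<open>At a nonreal root of modulus about \<open>b\<close> the third entry is
  \<open>- l / b\<close> up to a small error, so it is close to a unit imaginary number. The lower
  bound on its imaginary part is what separates this functional from its conjugate.\<close>

lemma fast_functional:
  assumes z: "0 < z" "z \<le> d" and w: "99 * b\<^sup>2 \<le> 100 * w" "100 * w \<le> 101 * b\<^sup>2"
    and char: "\<And>l :: complex. l\<^sup>2 + of_real z * l + of_real w = 0 \<Longrightarrow> char_poly a b c d l = 0"
  shows "\<exists>l z1 z3 z4. left_eigen a b c d l (z1, 1, z3, z4) \<and> cmod z1 \<le> 1 / 100 \<and> cmod z4 \<le> 1 / 100 \<and>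
    cmod z3 \<le> 3 \<and> 1 / 4 \<le> \<bar>Im z3\<bar> \<and> Re l = - z / 2 \<and> b / 2 \<le> cmod l \<and> cmod l \<le> 2 * b"
proof -
  have "b\<^sup>2 > 0"
    using pos by simp
  have zb: "z\<^sup>2 \<le> b\<^sup>2 / 1000000" "a\<^sup>2 \<le> b\<^sup>2 / 1000000"
    using power_mono[of z "b / 1000" 2] power_mono[of a "b / 1000" 2] z small_bounds pos
    by (auto simp: power_divide)
  define om where "om = sqrt (w - z\<^sup>2 / 4)"
  have "w - z\<^sup>2 / 4 > 0"
    using w zb \<open>b\<^sup>2 > 0\<close> by linarith
  then have om: "om > 0" "om\<^sup>2 = w - z\<^sup>2 / 4"
    by (auto simp: om_def)
  \<comment> \<open>The square of 9/10 is 81/100, well below the 99/100 granted to \<open>w\<close>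
    minus the tiny \<open>z^2 / 4\<close>.\<close>
  have "(b * (9 / 10))\<^sup>2 \<le> om\<^sup>2"
    unfolding om power_mult_distrib using w zb \<open>b\<^sup>2 > 0\<close> by (simp add: power2_eq_square[of "9 / 10"])
  then have omb: "b * (9 / 10) \<le> om"
    by (rule power2_le_imp_le) (use om in simp)
  define l where "l = Complex (- z / 2) om"
  have lsq: "(cmod l)\<^sup>2 = w"
    by (simp add: l_def cmod_power2 om power_divide)
  have "l\<^sup>2 + of_real z * l + of_real w = 0"
    using om(2) by (simp add: l_def complex_eq_iff power2_eq_square algebra_simps)
  then have ch: "char_poly a b c d l = 0"
    by (rule char)
  have "w > 0"
    using w \<open>b\<^sup>2 > 0\<close> by linarith
  have "(b / 2)\<^sup>2 \<le> (cmod l)\<^sup>2" "(cmod l)\<^sup>2 \<le> (2 * b)\<^sup>2"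
    unfolding lsq power_mult_distrib power_divide using w \<open>b\<^sup>2 > 0\<close> by auto
  then have lb: "b / 2 \<le> cmod l" "cmod l \<le> 2 * b"
    using pos by (auto intro: power2_le_imp_le[of "b / 2"] power2_le_imp_le[of _ "2 * b"])
  have "l \<noteq> 0"
    using lb pos by auto
  have om_le: "om \<le> cmod (l + of_real d)"
    using abs_Im_le_cmod[of "l + of_real d"] om(1) by (simp add: l_def)
  then have "l + of_real d \<noteq> 0"
    using om(1) by auto
  define z3 where "z3 = - (l + (of_real a)\<^sup>2 / l) / of_real b"
  define z1 where "z1 = - (of_real a / l)"
  define z4 where "z4 = of_real c * z3 / (l + of_real d)"
  have "left_eigen a b c d l (z1, 1, z3, z4)"
    unfolding z1_def z4_def
    by (rule left_eigen_general[OF ch \<open>l \<noteq> 0\<close> \<open>l + of_real d \<noteq> 0\<close> _ z3_def]) (use pos in simp)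
  moreover have "cmod z1 \<le> 1 / 100"
  proof -
    have "cmod z1 = a / cmod l"
      using pos by (simp add: z1_def norm_divide)
    also have "\<dots> \<le> (b / 1000) / (b / 2)"
      using lb small_bounds pos by (intro frac_le) auto
    finally show ?thesis
      using pos by simp
  qed
  moreover have z3: "cmod z3 \<le> 3"
  proof -
    have "cmod z3 = cmod (l + (of_real a)\<^sup>2 / l) / b"
      unfolding z3_def norm_divide norm_minus_cancel using pos by simp
    also have "cmod (l + (of_real a)\<^sup>2 / l) \<le> cmod l + a\<^sup>2 / cmod l"
      using norm_triangle_ineq[of l "(of_real a)\<^sup>2 / l"] by (simp add: norm_divide norm_power)
    also have "a\<^sup>2 / cmod l \<le> (b\<^sup>2 / 1000000) / (b / 2)"
      using lb zb pos by (intro frac_le) auto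
    also have "\<dots> \<le> b"
      using pos by (simp add: power2_eq_square)
    finally have "cmod z3 \<le> (cmod l + b) / b"
      using pos by (simp add: divide_right_mono)
    also have "\<dots> \<le> (3 * b) / b"
      using lb(2) pos by (intro divide_right_mono) auto
    finally show ?thesis
      using pos by simp
  qed
  moreover have "1 / 4 \<le> \<bar>Im z3\<bar>"
  proof -
    have "Im ((of_real a)\<^sup>2 / l) = - (a\<^sup>2 * om / w)"
      using lsq by (simp add: Im_divide cmod_power2 l_def power2_eq_square[of a])
    moreover have "Im z3 = - (Im l + Im ((of_real a)\<^sup>2 / l)) / b"
      unfolding z3_def Im_divide_of_real by (simp only: uminus_complex.sel plus_complex.sel)
    ultimately have "Im z3 = - (om * (1 - a\<^sup>2 / w)) / b"
      by (simp add: l_def algebra_simps)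
    moreover have "a\<^sup>2 / w \<le> 1 / 2"
      using zb w \<open>w > 0\<close> by (simp add: pos_divide_le_eq)
    then have "b * (9 / 10) * (1 / 2) \<le> om * (1 - a\<^sup>2 / w)"
      using omb pos by (intro mult_mono) auto
    then have "b * (1 / 4) \<le> om * (1 - a\<^sup>2 / w)"
      using pos by linarith
    then have "1 / 4 \<le> om * (1 - a\<^sup>2 / w) / b"
      using pos by (simp only: pos_le_divide_eq mult.commute)
    ultimately have "Im z3 \<le> - (1 / 4)"
      by simp
    then show ?thesis
      by simp
  qed
  moreover have "cmod z4 \<le> 1 / 100"
  proof -
    have "cmod z4 = c * cmod z3 / cmod (l + of_real d)"
      using pos by (simp add: z4_def norm_divide norm_mult)
    also have "\<dots> \<le> (b / 1000 * 3) / (b * (9 / 10))"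
      using om_le omb small_bounds pos z3 by (intro frac_le mult_mono) auto
    finally show ?thesis
      using pos by simp
  qed
  ultimately show ?thesis
    using lb by (intro exI[of _ l] exI[of _ z1] exI[of _ z3] exI[of _ z4]) (simp add: l_def)
qed

text \<open>The real part of the complex pair is \<open>- z / 2\<close>, so the factors
  \<open>1 / 6\<close> and \<open>4\<close> in the bounds on the damping become
  \<open>1 / 12\<close> and \<open>2\<close>.\<close>

lemma ex_functionals:
  "\<exists>l1 l2 x2 x3 x4 y1 y2 y3 l z1 z3 z4. 0 < l1 \<and> 0 < l2 \<and>
    left_eigen a b c d (of_real (- l1)) (of_real 1, of_real x2, of_real x3, of_real x4) \<and>
    \<bar>x2\<bar> \<le> 1 / 100 \<and> \<bar>x3\<bar> \<le> 1 / 100 \<and> \<bar>x4\<bar> \<le> 1 / 100 \<and>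
    left_eigen a b c d (of_real (- l2)) (of_real y1, of_real y2, of_real y3, of_real 1) \<and>
    \<bar>y1\<bar> \<le> 1 / 100 \<and> \<bar>y2\<bar> \<le> 1 / 100 \<and> \<bar>y3\<bar> \<le> 1 / 100 \<and>
    left_eigen a b c d l (z1, 1, z3, z4) \<and> cmod z1 \<le> 1 / 100 \<and> cmod z4 \<le> 1 / 100 \<and>
    cmod z3 \<le> 3 \<and> 1 / 4 \<le> \<bar>Im z3\<bar> \<and>
    - (2 * d * c\<^sup>2 / b\<^sup>2) \<le> Re l \<and> Re l \<le> - (d * c\<^sup>2 / (12 * b\<^sup>2)) \<and> b / 2 \<le> cmod l \<and> cmod l \<le> 2 * b"
proof -
  obtain l1 l2 z w where *: "0 < l1" "l1 < d / 2" "d / 2 < l2" "l2 < d"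
     "char_poly a b c d (- l1) = 0" "char_poly a b c d (- l2) = 0"
     "l1 + l2 + z = d" "l1 * l2 + w + (l1 + l2) * z = a\<^sup>2 + b\<^sup>2 + c\<^sup>2"
     "(l1 + l2) * w + l1 * l2 * z = d * (a\<^sup>2 + b\<^sup>2)" "l1 * l2 * w = a\<^sup>2 * c\<^sup>2"
     "99 * b\<^sup>2 \<le> 100 * w" "100 * w \<le> 101 * b\<^sup>2"
     "d * c\<^sup>2 / (6 * b\<^sup>2) \<le> z" "z \<le> 4 * d * c\<^sup>2 / b\<^sup>2" "l1 * (d * b\<^sup>2) \<le> 4 * (a\<^sup>2 * c\<^sup>2)"
    using ex_factorisation by blast
  have "0 < d * c\<^sup>2 / (6 * b\<^sup>2)"
    using pos by simp
  then have "z > 0"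
    using *(13) by linarith
  have "z \<le> d"
    using *(1,3,7) pos by linarith
  have zb: "z * b\<^sup>2 \<le> 4 * d * c\<^sup>2"
    using *(14) pos by (simp add: pos_le_divide_eq)
  have "(d - l2) * (d * b\<^sup>2) = l1 * (d * b\<^sup>2) + d * (z * b\<^sup>2)"
    using *(7) by (simp add: algebra_simps flip: *(7))
  also have "\<dots> \<le> 4 * (a\<^sup>2 * c\<^sup>2) + d * (4 * d * c\<^sup>2)"
    using *(15) zb pos by (intro add_mono mult_left_mono) auto
  finally have d2: "(d - l2) * (d * b\<^sup>2) \<le> 4 * (a\<^sup>2 * c\<^sup>2) + 4 * (d * c)\<^sup>2"
    by (simp add: power2_eq_square algebra_simps)
  have char: "char_poly a b c d l = 0" if "l\<^sup>2 + of_real z * l + of_real w = 0" for l :: complex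
  proof -
    have "char_poly a b c d l = (l + of_real l1) * (l + of_real l2) * (l\<^sup>2 + of_real z * l + of_real w)"
      unfolding char_poly_def *(8)[symmetric] *(9)[symmetric] *(10)[symmetric] *(7)[symmetric, THEN arg_cong[where f = "\<lambda>x. of_real x * l^3"]]
      by (simp add: power4_eq_xxxx power3_eq_cube power2_eq_square algebra_simps)
    then show ?thesis
      using that by simp
  qed
  obtain x2 x3 x4 where x: "left_eigen a b c d (of_real (- l1)) (of_real 1, of_real x2, of_real x3, of_real x4)"
    "\<bar>x2\<bar> \<le> 1 / 100" "\<bar>x3\<bar> \<le> 1 / 100" "\<bar>x4\<bar> \<le> 1 / 100"
    using slow_functional[OF *(1,2,5,15)] by blast
  obtain y1 y2 y3 where y: "left_eigen a b c d (of_real (- l2)) (of_real y1, of_real y2, of_real y3, of_real 1)"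
    "\<bar>y1\<bar> \<le> 1 / 100" "\<bar>y2\<bar> \<le> 1 / 100" "\<bar>y3\<bar> \<le> 1 / 100"
    using damped_functional[OF *(3,4,6) d2] by blast
  obtain l z1 z3 z4 where z: "left_eigen a b c d l (z1, 1, z3, z4)" "cmod z1 \<le> 1 / 100" "cmod z4 \<le> 1 / 100"
    "cmod z3 \<le> 3" "1 / 4 \<le> \<bar>Im z3\<bar>" "Re l = - z / 2" "b / 2 \<le> cmod l" "cmod l \<le> 2 * b"
    using fast_functional[OF \<open>z > 0\<close> \<open>z \<le> d\<close> *(11,12) char] by blast
  have "- (2 * d * c\<^sup>2 / b\<^sup>2) \<le> Re l" "Re l \<le> - (d * c\<^sup>2 / (12 * b\<^sup>2))"
    using *(13,14) unfolding z(6) by auto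
  moreover have "0 < l2"
    using *(3) pos by linarith
  ultimately show ?thesis
    using *(1) x y z(1-5,7,8) by blast
qed

end

text \<open>The four functionals perturb an invertible system. Solving for one component at a time
  costs small multiples of \<open>norm Y\<close>, which add up to 40/100 and are absorbed on the
  left.\<close>

lemma norm_le_functionals:
  fixes Y :: "'a \<times> 'a \<times> 'a \<times> 'a::complex_hilbert"
  assumes x: "\<bar>x2\<bar> \<le> 1 / 100" "\<bar>x3\<bar> \<le> 1 / 100" "\<bar>x4\<bar> \<le> 1 / 100"
    and y: "\<bar>y1\<bar> \<le> 1 / 100" "\<bar>y2\<bar> \<le> 1 / 100" "\<bar>y3\<bar> \<le> 1 / 100"
    and z: "cmod z1 \<le> 1 / 100" "cmod z4 \<le> 1 / 100" "cmod z3 \<le> 3" "1 / 4 \<le> \<bar>Im z3\<bar>"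
  shows "norm Y \<le> 20 * (norm (lf (of_real 1, of_real x2, of_real x3, of_real x4) Y)
    + norm (lf (of_real y1, of_real y2, of_real y3, of_real 1) Y)
    + norm (lf (z1, 1, z3, z4) Y) + norm (lf (cnj z1, cnj 1, cnj z3, cnj z4) Y))"
proof -
  obtain w v \<theta> p where Y: "Y = (w, v, \<theta>, p)"
    by (cases Y) auto
  define f1 where "f1 = lf (of_real 1, of_real x2, of_real x3, of_real x4) Y"
  define f2 where "f2 = lf (of_real y1, of_real y2, of_real y3, of_real 1) Y"
  define f3 where "f3 = lf (z1, 1, z3, z4) Y"
  define f4 where "f4 = lf (cnj z1, cnj 1, cnj z3, cnj z4) Y"
  note le = norm_quad_ge[where w = w and v = v and \<theta> = \<theta> and p = p, folded Y]
  have sm: "norm (s *\<^sub>C u) \<le> k * norm Y" if "cmod s \<le> k" "norm u \<le> norm Y" for s k and u :: 'a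
    unfolding norm_scaleC by (intro mult_mono that norm_ge_zero order_trans[OF norm_ge_zero that(1)])
  have smr: "norm (complex_of_real s *\<^sub>C u) \<le> 1 / 100 * norm Y" if "\<bar>s\<bar> \<le> 1 / 100" "norm u \<le> norm Y"
    for s and u :: 'a
    by (rule sm) (use that in simp_all)
  have tri: "norm (e1 - e2 - e3 - e4) \<le> norm e1 + norm e2 + norm e3 + norm e4" for e1 e2 e3 e4 :: 'a
    using norm_triangle_ineq4[of "e1 - e2 - e3" e4] norm_triangle_ineq4[of "e1 - e2" e3]
      norm_triangle_ineq4[of e1 e2] by linarith
  have "norm w = norm (f1 - complex_of_real x2 *\<^sub>C v - complex_of_real x3 *\<^sub>C \<theta> - complex_of_real x4 *\<^sub>C p)"
    by (simp add: f1_def lf_def Y)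
  then have w: "norm w \<le> norm f1 + 3 / 100 * norm Y"
    using tri[of f1 "complex_of_real x2 *\<^sub>C v" "complex_of_real x3 *\<^sub>C \<theta>" "complex_of_real x4 *\<^sub>C p"]
      smr[OF x(1) le(2)] smr[OF x(2) le(3)] smr[OF x(3) le(4)] by linarith
  have "norm p = norm (f2 - complex_of_real y1 *\<^sub>C w - complex_of_real y2 *\<^sub>C v - complex_of_real y3 *\<^sub>C \<theta>)"
    by (simp add: f2_def lf_def Y)
  then have p: "norm p \<le> norm f2 + 3 / 100 * norm Y"
    using tri[of f2 "complex_of_real y1 *\<^sub>C w" "complex_of_real y2 *\<^sub>C v" "complex_of_real y3 *\<^sub>C \<theta>"]
      smr[OF y(1) le(1)] smr[OF y(2) le(2)] smr[OF y(3) le(3)] by linarith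
  have \<theta>: "norm \<theta> \<le> 2 * norm f3 + 2 * norm f4 + 8 / 100 * norm Y"
  proof -
    \<comment> \<open>Both functionals carry the coefficient 1 at \<open>v\<close>, so the
      difference eliminates \<open>v\<close> and leaves \<open>2 i Im z3\<close> times
      \<open>\<theta>\<close>, which is bounded below by the last hypothesis.\<close>
    have "f3 - f4 = (z1 - cnj z1) *\<^sub>C w + (z3 - cnj z3) *\<^sub>C \<theta> + (z4 - cnj z4) *\<^sub>C p"
      by (simp add: f3_def f4_def lf_def Y scaleC_diff_left)
    then have "(z3 - cnj z3) *\<^sub>C \<theta> = f3 - f4 - (z1 - cnj z1) *\<^sub>C w - (z4 - cnj z4) *\<^sub>C p"
      by simp
    then have "norm ((z3 - cnj z3) *\<^sub>C \<theta>) \<le> norm f3 + norm f4 + norm ((z1 - cnj z1) *\<^sub>C w)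
        + norm ((z4 - cnj z4) *\<^sub>C p)"
      using tri[of f3 f4 "(z1 - cnj z1) *\<^sub>C w" "(z4 - cnj z4) *\<^sub>C p"] by simp
    moreover have "cmod (z1 - cnj z1) \<le> 2 / 100" "cmod (z4 - cnj z4) \<le> 2 / 100"
      using z(1,2) norm_triangle_ineq4[of z1 "cnj z1"] norm_triangle_ineq4[of z4 "cnj z4"] by auto
    then have "norm ((z1 - cnj z1) *\<^sub>C w) \<le> 2 / 100 * norm Y" "norm ((z4 - cnj z4) *\<^sub>C p) \<le> 2 / 100 * norm Y"
      using sm le by blast+
    moreover have "cmod (z3 - cnj z3) = 2 * \<bar>Im z3\<bar>"
      by (simp add: complex_diff_cnj norm_mult)
    then have "norm ((z3 - cnj z3) *\<^sub>C \<theta>) \<ge> 1 / 2 * norm \<theta>"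
      unfolding norm_scaleC using z(4) by (intro mult_right_mono) auto
    ultimately show ?thesis
      by linarith
  qed
  have "norm v = norm (f3 - z1 *\<^sub>C w - z3 *\<^sub>C \<theta> - z4 *\<^sub>C p)"
    by (simp add: f3_def lf_def Y)
  then have v: "norm v \<le> norm f3 + 2 / 100 * norm Y + 3 * norm \<theta>"
    using tri[of f3 "z1 *\<^sub>C w" "z3 *\<^sub>C \<theta>" "z4 *\<^sub>C p"] sm[OF z(1) le(1)] sm[OF z(2) le(4)]
      mult_right_mono[OF z(3) norm_ge_zero[of \<theta>]] by (simp add: norm_scaleC)
  have "norm Y \<le> norm w + norm v + norm \<theta> + norm p"
    unfolding Y by (rule norm_quad_le)
  moreover have "norm v \<le> 7 * norm f3 + 6 * norm f4 + 26 / 100 * norm Y"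
    using v \<theta> by linarith
  ultimately have "60 / 100 * norm Y \<le> norm f1 + norm f2 + 9 * norm f3 + 8 * norm f4"
    using w p \<theta> by linarith
  then have "3 * norm Y \<le> 5 * norm f1 + 5 * norm f2 + 45 * norm f3 + 40 * norm f4"
    by simp
  moreover have "0 \<le> norm f1" "0 \<le> norm f2" "0 \<le> norm f3" "0 \<le> norm f4"
    by simp_all
  ultimately have "norm Y \<le> 20 * (norm f1 + norm f2 + norm f3 + norm f4)"
    by argo
  then show ?thesis
    by (simp only: f1_def f2_def f3_def f4_def)
qed

subsection \<open>Decay on one eigenspace\<close>

text \<open>The contribution of a real root, uniform in \<open>l\<close>: for the root near 0 the
  factor \<open>l\<close> compensates the missing decay, by
  \<open>x exp (- x) \<le> 1\<close>.\<close>

lemma slow_factor_le: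
  fixes l t :: real
  assumes "0 < l" "0 < t"
  shows "exp (- l * t) * (l / (1 + l)\<^sup>2) \<le> 1 / t"
proof -
  have "1 \<le> (1 + l)\<^sup>2"
    using assms by (simp add: one_le_power)
  then have "l / (1 + l)\<^sup>2 \<le> l / 1"
    using assms by (intro divide_left_mono) auto
  then have "l / (1 + l)\<^sup>2 \<le> l"
    by simp
  then have "exp (- l * t) * (l / (1 + l)\<^sup>2) \<le> exp (- l * t) * l"
    by (rule mult_left_mono) simp
  also have "\<dots> = l / exp (l * t)"
    by (simp add: exp_minus field_simps)
  also have "\<dots> \<le> l / (l * t)"
    using assms exp_ge_add_one_self[of "l * t"] by (intro divide_left_mono mult_pos_pos) (linarith | simp)+
  also have "\<dots> = 1 / t"
    using assms by simp
  finally show ?thesis .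
qed

context strong_coupling
begin

lemma orbit_bound:
  assumes y: "solves a b c d y" and "t > 0"
    and u: "y 0 = gen a b c d g" "g - gen a b c d g = r" "r - gen a b c d r = u"
  shows "norm (y t) \<le> 1000 * (1 / t + exp (- (d * c\<^sup>2 / (12 * b\<^sup>2)) * t) / b) * norm u"
proof -
  obtain l1 l2 x2 x3 x4 y1 y2 y3 l z1 z3 z4 where pl: "0 < l1" "0 < l2"
    and x: "left_eigen a b c d (of_real (- l1)) (of_real 1, of_real x2, of_real x3, of_real x4)"
      "\<bar>x2\<bar> \<le> 1 / 100" "\<bar>x3\<bar> \<le> 1 / 100" "\<bar>x4\<bar> \<le> 1 / 100"
    and yy: "left_eigen a b c d (of_real (- l2)) (of_real y1, of_real y2, of_real y3, of_real 1)"
      "\<bar>y1\<bar> \<le> 1 / 100" "\<bar>y2\<bar> \<le> 1 / 100" "\<bar>y3\<bar> \<le> 1 / 100"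
    and z: "left_eigen a b c d l (z1, 1, z3, z4)" "cmod z1 \<le> 1 / 100" "cmod z4 \<le> 1 / 100"
      "cmod z3 \<le> 3" "1 / 4 \<le> \<bar>Im z3\<bar>"
    and l: "Re l \<le> - (d * c\<^sup>2 / (12 * b\<^sup>2))" "b / 2 \<le> cmod l"
    using ex_functionals by blast
  define F where "F = exp (- (d * c\<^sup>2 / (12 * b\<^sup>2)) * t) / b"
  note orbit = norm_lf_orbit[OF y _ less_imp_le[OF \<open>t > 0\<close>] _ u]
  have slow: "norm (lf (s1, s2, s3, s4) (y t)) \<le> 4 / t * norm u"
    if "k > 0" "left_eigen a b c d (of_real (- k)) (s1, s2, s3, s4)"
      "cmod s1 \<le> 1" "cmod s2 \<le> 1" "cmod s3 \<le> 1" "cmod s4 \<le> 1" for k :: real and s1 s2 s3 s4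
  proof -
    have k1: "(1 :: complex) - of_real (- k) = of_real (1 + k)"
      by simp
    have "complex_of_real (- k) \<noteq> 1"
      using \<open>k > 0\<close> by (simp add: complex_eq_iff)
    then have "norm (lf (s1, s2, s3, s4) (y t))
        = exp (- k * t) * (k / (1 + k)\<^sup>2) * norm (lf (s1, s2, s3, s4) u)"
      using orbit[OF that(2)] \<open>k > 0\<close> unfolding k1 by (simp only: norm_of_real Re_complex_of_real) simp
    also have "\<dots> \<le> 1 / t * (4 * 1 * norm u)"
      using \<open>k > 0\<close> \<open>t > 0\<close> that(3-6) by (intro mult_mono slow_factor_le norm_lf_le) auto
    finally show ?thesis by simp
  qed
  have fast: "norm (lf (s1, s2, s3, s4) (y t)) \<le> 24 * F * norm u"
    if s: "left_eigen a b c d k (s1, s2, s3, s4)" "Re k = Re l" "cmod k = cmod l"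
      "cmod s1 \<le> 3" "cmod s2 \<le> 3" "cmod s3 \<le> 3" "cmod s4 \<le> 3" for k s1 s2 s3 s4
  proof -
    have "0 < d * c\<^sup>2 / (12 * b\<^sup>2)"
      using pos by simp
    then have "Re k < 0"
      using l(1) s(2) by linarith
    then have "k \<noteq> 1"
      by auto
    have "cmod k > 0"
      using l(2) s(3) pos by linarith
    \<comment> \<open>The root lies in the left half-plane, so its distance to 1 is at least its
      modulus; hence the resolvent factor is at most \<open>1 / cmod k \<le> 2 / b\<close>.\<close>
    have "(cmod k)\<^sup>2 \<le> (cmod (1 - k))\<^sup>2"
    proof -
      have "(cmod (1 - k))\<^sup>2 = (cmod k)\<^sup>2 + (1 - 2 * Re k)"
        unfolding cmod_power2 by (simp add: power2_eq_square algebra_simps)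
      then show ?thesis
        using \<open>Re k < 0\<close> by linarith
    qed
    then have "cmod k / (cmod (1 - k))\<^sup>2 \<le> cmod k / (cmod k)\<^sup>2"
      using l(2) s(3) pos by (intro divide_left_mono mult_pos_pos) auto
    also have "\<dots> = 1 / cmod k"
      by (simp add: power2_eq_square)
    also have "\<dots> \<le> 1 / (b / 2)"
      using l(2) s(3) pos \<open>cmod k > 0\<close> by (intro divide_left_mono mult_pos_pos) auto
    finally have k2: "cmod k / (cmod (1 - k))\<^sup>2 \<le> 2 / b"
      by simp
    have "exp (Re k * t) \<le> exp (- (d * c\<^sup>2 / (12 * b\<^sup>2)) * t)"
      unfolding s(2) exp_le_cancel_iff using l(1) \<open>t > 0\<close> by (intro mult_right_mono) auto
    then have "exp (Re k * t) * (cmod k / (cmod (1 - k))\<^sup>2) \<le> exp (- (d * c\<^sup>2 / (12 * b\<^sup>2)) * t) * (2 / b)"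
      using k2 by (intro mult_mono) auto
    also have "\<dots> = 2 * F"
      by (simp add: F_def)
    finally have F: "exp (Re k * t) * (cmod k / (cmod (1 - k))\<^sup>2) \<le> 2 * F" .
    have "F \<ge> 0"
      using pos by (simp add: F_def)
    then have "exp (Re k * t) * (cmod k / (cmod (1 - k))\<^sup>2) * norm (lf (s1, s2, s3, s4) u)
        \<le> 2 * F * (4 * 3 * norm u)"
      using s(4-7) by (intro mult_mono[OF F norm_lf_le]) auto
    then show ?thesis
      unfolding orbit[OF s(1) \<open>k \<noteq> 1\<close>] by simp
  qed
  have "norm (lf (of_real 1, of_real x2, of_real x3, of_real x4) (y t)) \<le> 4 / t * norm u"
    by (rule slow[OF pl(1) x(1)]) (use x in auto)
  moreover have "norm (lf (of_real y1, of_real y2, of_real y3, of_real 1) (y t)) \<le> 4 / t * norm u"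
    by (rule slow[OF pl(2) yy(1)]) (use yy in auto)
  moreover have "norm (lf (z1, 1, z3, z4) (y t)) \<le> 24 * F * norm u"
    by (rule fast[OF z(1)]) (use z in auto)
  moreover have "norm (lf (cnj z1, cnj 1, cnj z3, cnj z4) (y t)) \<le> 24 * F * norm u"
    by (rule fast[OF left_eigen_cnj[OF z(1)]]) (use z in auto)
  \<comment> \<open>Twice \<open>4 / t\<close> and twice \<open>24 * F\<close>, times 20, make
    \<open>160 / t\<close> and \<open>960 * F\<close>, which explains the constant 1000.\<close>
  ultimately have "norm (y t) \<le> 20 * (4 / t * norm u + 4 / t * norm u + 24 * F * norm u + 24 * F * norm u)"
    by (intro order_trans[OF norm_le_functionals[OF x(2-4) yy(2-4) z(2-5)]] mult_left_mono add_mono) auto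
  also have "\<dots> = 160 * (1 / t * norm u) + 960 * (F * norm u)"
    by (simp add: algebra_simps)
  also have "\<dots> \<le> 1000 * (1 / t * norm u) + 1000 * (F * norm u)"
    using \<open>t > 0\<close> pos by (intro add_mono mult_right_mono) (auto simp: F_def)
  also have "\<dots> = 1000 * (1 / t + F) * norm u"
    by (simp add: algebra_simps)
  finally show ?thesis
    by (simp only: F_def)
qed

text \<open>The functional of the complex pair has coefficient 1 at \<open>v\<close>, so it reads
  off \<open>\<phi>\<close> exactly from a datum concentrated in the velocity, and its evolution is
  known exactly. The constant 96 is 8 from the resolvent factor times 12 from the norm of the
  functional.\<close>

lemma orbit_lower_bound:
  assumes y: "solves a b c d y" and "t \<ge> 0"
    and u: "y 0 = gen a b c d g" "g - gen a b c d g = r" "r - gen a b c d r = (0, \<phi>, 0, 0)"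
  shows "exp (- (2 * d * c\<^sup>2 / b\<^sup>2) * t) / (96 * b) * norm \<phi> \<le> norm (y t)"
proof -
  obtain l z1 z3 z4 where z: "left_eigen a b c d l (z1, 1, z3, z4)" "cmod z1 \<le> 1 / 100" "cmod z4 \<le> 1 / 100"
      "cmod z3 \<le> 3"
    and l: "- (2 * d * c\<^sup>2 / b\<^sup>2) \<le> Re l" "Re l \<le> - (d * c\<^sup>2 / (12 * b\<^sup>2))" "b / 2 \<le> cmod l" "cmod l \<le> 2 * b"
    using ex_functionals by blast
  have "0 < d * c\<^sup>2 / (12 * b\<^sup>2)"
    using pos by simp
  then have "l \<noteq> 1"
    using l(2) by auto
  have "1 \<le> cmod l"
    using l(3) small_bounds(4) by linarith
  have "cmod (1 - l) \<le> 2 * cmod l"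
    using norm_triangle_ineq4[of 1 l] \<open>1 \<le> cmod l\<close> by simp
  then have "(cmod (1 - l))\<^sup>2 \<le> (2 * cmod l)\<^sup>2"
    by (intro power_mono) auto
  then have "cmod l / (2 * cmod l)\<^sup>2 \<le> cmod l / (cmod (1 - l))\<^sup>2"
    using \<open>l \<noteq> 1\<close> \<open>1 \<le> cmod l\<close> by (intro divide_left_mono mult_pos_pos) auto
  moreover have "cmod l / (2 * cmod l)\<^sup>2 = 1 / (4 * cmod l)"
    by (simp add: power2_eq_square)
  moreover have "1 / (4 * (2 * b)) \<le> 1 / (4 * cmod l)"
    using l(4) \<open>1 \<le> cmod l\<close> by (intro divide_left_mono mult_pos_pos) auto
  ultimately have k: "1 / (8 * b) \<le> cmod l / (cmod (1 - l))\<^sup>2"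
    by simp
  have "exp (- (2 * d * c\<^sup>2 / b\<^sup>2) * t) \<le> exp (Re l * t)"
    unfolding exp_le_cancel_iff using l(1) \<open>t \<ge> 0\<close> by (intro mult_right_mono) auto
  then have "exp (- (2 * d * c\<^sup>2 / b\<^sup>2) * t) * (1 / (8 * b)) * norm \<phi>
      \<le> exp (Re l * t) * (cmod l / (cmod (1 - l))\<^sup>2) * norm \<phi>"
    using k pos by (intro mult_right_mono mult_mono) auto
  also have "\<dots> = norm (lf (z1, 1, z3, z4) (y t))"
    unfolding norm_lf_orbit[OF y z(1) \<open>t \<ge> 0\<close> \<open>l \<noteq> 1\<close> u] by (simp add: lf_def)
  also have "\<dots> \<le> 4 * 3 * norm (y t)"
    using z by (intro norm_lf_le) auto
  finally show ?thesis
    by simp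
qed

end

section \<open>Exponential decay on a fixed eigenspace\<close>

lemma cross_term_le:
  fixes x y :: "'a::complex_hilbert"
  assumes "e > 0"
  shows "k * Re (cinner x y) \<le> e * (norm x)\<^sup>2 + k\<^sup>2 / (4 * e) * (norm y)\<^sup>2"
proof -
  have "0 \<le> (norm ((2 * e) *\<^sub>R x - k *\<^sub>R y))\<^sup>2"
    by simp
  also have "\<dots> = 4 * e * (e * (norm x)\<^sup>2 + k\<^sup>2 / (4 * e) * (norm y)\<^sup>2 - k * Re (cinner x y))"
    unfolding norm_diff_square using assms
    by (simp add: cinner_scaleR_left cinner_scaleR_right power_mult_distrib power2_eq_square field_simps)
  finally show ?thesis
    using assms by (simp add: zero_le_mult_iff)
qed

lemma abs_cross_le:
  fixes x y :: "'a::complex_hilbert"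
  shows "\<bar>Re (cinner x y)\<bar> \<le> (norm x)\<^sup>2 + (norm y)\<^sup>2"
proof -
  have "0 \<le> (norm (x + y))\<^sup>2" "0 \<le> (norm (x - y))\<^sup>2" "0 \<le> (norm x)\<^sup>2" "0 \<le> (norm y)\<^sup>2"
    by auto
  then show ?thesis
    unfolding norm_add_square norm_diff_square by (intro abs_leI) linarith+
qed

text \<open>A subdiagonal perturbation of \<open>k\<close> times the identity. It is not
  symmetrised, because only the real part of its quadratic form enters.\<close>

definition twist :: "real \<Rightarrow> real \<Rightarrow> real \<Rightarrow> 'a \<times> 'a \<times> 'a \<times> 'a \<Rightarrow> 'a::complex_hilbert \<times> 'a \<times> 'a \<times> 'a" where
  "twist k k1 k2 = (\<lambda>(w, v, \<theta>, p). (k *\<^sub>R w, k *\<^sub>R v + w, k *\<^sub>R \<theta> + k2 *\<^sub>R v, k *\<^sub>R p + k1 *\<^sub>R \<theta>))"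

lemma bounded_linear_twist:
  "bounded_linear (twist k k1 k2 :: 'a \<times> 'a \<times> 'a \<times> 'a \<Rightarrow> 'a::complex_hilbert \<times> 'a \<times> 'a \<times> 'a)"
proof -
  have "twist k k1 k2 = (\<lambda>y :: 'a \<times> 'a \<times> 'a \<times> 'a. (k *\<^sub>R fst y, k *\<^sub>R fst (snd y) + fst y,
      k *\<^sub>R fst (snd (snd y)) + k2 *\<^sub>R fst (snd y), k *\<^sub>R snd (snd (snd y)) + k1 *\<^sub>R fst (snd (snd y))))"
    by (auto simp: twist_def split: prod.split)
  then show ?thesis
    by (simp only:) (intro bounded_linear_Pair bounded_linear_add bounded_linear_const_scaleR
        bounded_linear_fst bounded_linear_snd bounded_linear_fst_comp bounded_linear_snd_comp)
qed

text \<open>The form \<open>Re \<langle>twist y, y\<rangle>\<close> is a large multiple of the energy plus multiples of \<open>\<langle>p, \<theta>\<rangle>\<close>,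
  \<open>\<langle>\<theta>, v\<rangle>\<close> and \<open>\<langle>v, w\<rangle>\<close>, which pass the damping of \<open>p\<close> along the chain to \<open>\<theta>\<close>, \<open>v\<close>
  and \<open>w\<close>.\<close>

lemma ex_lyapunov:
  assumes pos: "a > 0" "b > 0" "c > 0" "d > 0"
  shows "\<exists>k k1 k2 e M. e > 0 \<and> M > 0 \<and> (\<forall>y :: 'a \<times> 'a \<times> 'a \<times> 'a::complex_hilbert.
    (norm y)\<^sup>2 \<le> Re (cinner (twist k k1 k2 y) y) \<and> Re (cinner (twist k k1 k2 y) y) \<le> M * (norm y)\<^sup>2 \<and>
    Re (cinner (twist k k1 k2 (gen a b c d y)) y) + Re (cinner (twist k k1 k2 y) (gen a b c d y))
      \<le> - e * (norm y)\<^sup>2)"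
proof -
  \<comment> \<open>Chosen in the order \<open>k2\<close>, \<open>k1\<close>, \<open>k\<close>, each
    large enough to absorb the error terms left at its component: the factors of
    \<open>|v|^2\<close>, \<open>|\<theta>|^2\<close> and \<open>|p|^2\<close> end up as
    \<open>- a\<close>, \<open>- 1\<close> and at most \<open>- 1\<close>. The further summands of
    \<open>k\<close> make the form coercive.\<close>
  define k2 where "k2 = 3 * a / b"
  define M1 where "M1 = k2 * b + (b - k2 * a)\<^sup>2 / (4 * (a / 2))"
  define k1 where "k1 = 2 * (M1 + 1) / c"
  define M2 where "M2 = k1 * c + (k2 * c - k1 * b)\<^sup>2 / (4 * a) + (k1 * d)\<^sup>2 / (4 * (M1 + 1))"
  define k where "k = M2 / (2 * d) + 1 / (2 * d) + 2 * (k1 + k2 + 1) + 1"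
  define e where "e = min (a / 2) (min a 1)"
  have k2: "k2 > 0" "k2 * b = 3 * a"
    using pos by (auto simp: k2_def)
  then have M1: "M1 + 1 > 0"
    using pos by (simp add: M1_def add_pos_nonneg)
  then have k1: "k1 > 0" "k1 * c = 2 * (M1 + 1)"
    using pos by (auto simp: k1_def)
  have M2: "M2 \<ge> 0"
    unfolding M2_def using k1 M1 pos by (intro add_nonneg_nonneg divide_nonneg_nonneg) auto
  have kd: "2 * k * d \<ge> M2 + 1"
  proof -
    have "2 * d * k = M2 + 1 + 2 * d * (2 * (k1 + k2 + 1) + 1)"
      using pos by (simp add: k_def field_simps)
    moreover have "2 * d * (2 * (k1 + k2 + 1) + 1) \<ge> 0"
      using k1(1) k2(1) pos by (intro mult_nonneg_nonneg) auto
    ultimately show ?thesis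
      by (simp add: mult.commute mult.left_commute)
  qed
  have k_ge: "k \<ge> 2 * (k1 + k2 + 1) + 1"
    using M2 pos by (simp add: k_def)
  have e: "e > 0" "e \<le> a / 2" "e \<le> a" "e \<le> 1"
    using pos by (auto simp: e_def)
  have main: "(norm y)\<^sup>2 \<le> Re (cinner (twist k k1 k2 y) y) \<and>
    Re (cinner (twist k k1 k2 y) y) \<le> 2 * k * (norm y)\<^sup>2 \<and>
    Re (cinner (twist k k1 k2 (gen a b c d y)) y) + Re (cinner (twist k k1 k2 y) (gen a b c d y))
      \<le> - e * (norm y)\<^sup>2" for y :: "'a \<times> 'a \<times> 'a \<times> 'a"
  proof -
    obtain w v \<theta> p where y: "y = (w, v, \<theta>, p)"
      by (cases y) auto
    define W V T Q where "W = (norm w)\<^sup>2" and "V = (norm v)\<^sup>2" and "T = (norm \<theta>)\<^sup>2" and "Q = (norm p)\<^sup>2"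
    have nn: "W \<ge> 0" "V \<ge> 0" "T \<ge> 0" "Q \<ge> 0"
      by (auto simp: W_def V_def T_def Q_def)
    have ny: "(norm y)\<^sup>2 = W + V + T + Q"
      by (simp add: y norm_quad_square W_def V_def T_def Q_def)
    define X1 X2 X3 where "X1 = Re (cinner p \<theta>)" and "X2 = Re (cinner \<theta> v)" and "X3 = Re (cinner v w)"
    note com = Re_cinner_commute[of \<theta> p] Re_cinner_commute[of v \<theta>] Re_cinner_commute[of w v]
    have form: "Re (cinner (twist k k1 k2 y) y) = k * (W + V + T + Q) + k1 * X1 + k2 * X2 + X3"
      by (simp add: y twist_def cinner_prod_def cinner_simps cinner_self_eq com W_def V_def T_def Q_def
          X1_def X2_def X3_def algebra_simps)
    have X: "\<bar>X1\<bar> \<le> W + V + T + Q" "\<bar>X2\<bar> \<le> W + V + T + Q" "\<bar>X3\<bar> \<le> W + V + T + Q"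
      using abs_cross_le[of p \<theta>] abs_cross_le[of \<theta> v] abs_cross_le[of v w] nn
      unfolding W_def V_def T_def Q_def X1_def X2_def X3_def by linarith+
    define Y where "Y = W + V + T + Q"
    have "Y \<ge> 0"
      using nn by (simp add: Y_def)
    have "\<bar>k1 * X1\<bar> \<le> k1 * Y" "\<bar>k2 * X2\<bar> \<le> k2 * Y"
      unfolding abs_mult using X k1(1) k2(1) by (auto simp: Y_def intro: mult_left_mono)
    then have ab: "\<bar>k1 * X1 + k2 * X2 + X3\<bar> \<le> (k1 + k2 + 1) * Y"
      using X(3) unfolding Y_def[symmetric] distrib_right by linarith
    have "(2 * (k1 + k2 + 1) + 1) * Y \<le> k * Y"
      using k_ge \<open>Y \<ge> 0\<close> by (rule mult_right_mono)
    moreover have "0 \<le> (k1 + k2 + 1) * Y"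
      using k1(1) k2(1) \<open>Y \<ge> 0\<close> by auto
    moreover have "(2 * (k1 + k2 + 1) + 1) * Y = 2 * ((k1 + k2 + 1) * Y) + Y"
      by (simp add: algebra_simps)
    ultimately have both: "(norm y)\<^sup>2 \<le> Re (cinner (twist k k1 k2 y) y)"
      "Re (cinner (twist k k1 k2 y) y) \<le> 2 * k * (norm y)\<^sup>2"
      using ab[unfolded abs_le_iff] \<open>Y \<ge> 0\<close> unfolding form ny Y_def[symmetric] by linarith+
    define Z1 Z2 where "Z1 = Re (cinner \<theta> w)" and "Z2 = Re (cinner p v)"
    note com2 = com Re_cinner_commute[of w \<theta>] Re_cinner_commute[of v p]
    have der: "Re (cinner (twist k k1 k2 (gen a b c d y)) y) + Re (cinner (twist k k1 k2 y) (gen a b c d y))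
      = - (2 * k * d) * Q + k1 * c * Q - k1 * c * T - k1 * d * X1 - k1 * b * Z2
        + k2 * c * Z2 - k2 * b * V + k2 * b * T - k2 * a * Z1 + b * Z1 - a * W + a * V"
      by (simp add: y twist_def gen_def cinner_prod_def cinner_simps cinner_self_eq com2 W_def V_def
          T_def Q_def X1_def X2_def X3_def Z1_def Z2_def algebra_simps)
    \<comment> \<open>Young's inequality with weights that spend \<open>a / 2 |w|^2\<close>,
      \<open>a |v|^2\<close> and \<open>(M1 + 1) |\<theta>|^2\<close>; the counterweights are what
      \<open>M1\<close> and \<open>M2\<close> collect.\<close>
    have 1: "(b - k2 * a) * Z1 \<le> a / 2 * W + (b - k2 * a)\<^sup>2 / (4 * (a / 2)) * T"
      using cross_term_le[of "a / 2" "b - k2 * a" w \<theta>] pos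
      by (simp only: Z1_def W_def T_def com2)
    have 2: "(k2 * c - k1 * b) * Z2 \<le> a * V + (k2 * c - k1 * b)\<^sup>2 / (4 * a) * Q"
      using cross_term_le[of a "k2 * c - k1 * b" v p] pos
      by (simp only: Z2_def V_def Q_def com2)
    have 3: "(- (k1 * d)) * X1 \<le> (M1 + 1) * T + (k1 * d)\<^sup>2 / (4 * (M1 + 1)) * Q"
      using cross_term_le[of "M1 + 1" "- (k1 * d)" \<theta> p] M1
      by (simp only: X1_def T_def Q_def com2 power2_minus)
    have "Re (cinner (twist k k1 k2 (gen a b c d y)) y) + Re (cinner (twist k k1 k2 y) (gen a b c d y))
      = (b - k2 * a) * Z1 + (k2 * c - k1 * b) * Z2 + (- (k1 * d)) * X1
        - (2 * k * d) * Q + k1 * c * Q - k1 * c * T - k2 * b * V + k2 * b * T - a * W + a * V"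
      unfolding der by (simp add: algebra_simps)
    also have "\<dots> \<le> - (a / 2) * W + (2 * a - k2 * b) * V + (M1 + (M1 + 1) - k1 * c) * T
        + (M2 - 2 * k * d) * Q"
    proof -
      have "(M1 + (M1 + 1) - k1 * c) * T = k2 * b * T + (b - k2 * a)\<^sup>2 / (4 * (a / 2)) * T + (M1 + 1) * T
          - k1 * c * T"
        by (simp add: M1_def algebra_simps)
      moreover have "(M2 - 2 * k * d) * Q = k1 * c * Q + (k2 * c - k1 * b)\<^sup>2 / (4 * a) * Q
          + (k1 * d)\<^sup>2 / (4 * (M1 + 1)) * Q - (2 * k * d) * Q"
        by (simp add: M2_def algebra_simps)
      moreover have "(2 * a - k2 * b) * V = 2 * (a * V) - k2 * b * V" "- (a / 2) * W = a / 2 * W - a * W"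
        by (simp_all add: algebra_simps)
      ultimately show ?thesis
        using 1 2 3 by linarith
    qed
    also have "\<dots> = - (a / 2) * W + (- a) * V + (- 1) * T + (M2 - 2 * k * d) * Q"
      unfolding k1(2) k2(2) by simp
    also have "\<dots> \<le> (- e) * W + (- e) * V + (- e) * T + (- e) * Q"
      using e kd nn by (intro add_mono mult_right_mono) auto
    also have "\<dots> = - e * (norm y)\<^sup>2"
      by (simp add: ny algebra_simps)
    finally show ?thesis
      using both by blast
  qed
  have "2 * k > 0"
    using k_ge k1(1) k2(1) by argo
  then show ?thesis
    using main e(1) by blast
qed

text \<open>The Lyapunov form satisfies \<open>L' \<le> - r L\<close>, so
  \<open>exp (r s) * L s\<close> is nonincreasing, and comparability of \<open>L\<close> with the
  energy gives the decay. The argument does not look at the roots and so survives multiple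
  ones.\<close>

lemma exponential_decay:
  assumes pos: "a > 0" "b > 0" "c > 0" "d > 0"
  shows "\<exists>C \<kappa>. C > 0 \<and> \<kappa> > 0 \<and> (\<forall>(y :: real \<Rightarrow> 'a \<times> 'a \<times> 'a \<times> 'a::complex_hilbert) t.
    solves a b c d y \<longrightarrow> t \<ge> 0 \<longrightarrow> norm (y t) \<le> C * exp (- \<kappa> * t) * norm (y 0))"
proof -
  obtain k k1 k2 e M where "e > 0" "M > 0"
    and ly: "\<And>y :: 'a \<times> 'a \<times> 'a \<times> 'a. (norm y)\<^sup>2 \<le> Re (cinner (twist k k1 k2 y) y)"
      "\<And>y :: 'a \<times> 'a \<times> 'a \<times> 'a. Re (cinner (twist k k1 k2 y) y) \<le> M * (norm y)\<^sup>2"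
      "\<And>y :: 'a \<times> 'a \<times> 'a \<times> 'a. Re (cinner (twist k k1 k2 (gen a b c d y)) y)
        + Re (cinner (twist k k1 k2 y) (gen a b c d y)) \<le> - e * (norm y)\<^sup>2"
    using ex_lyapunov[OF pos, where 'a = 'a] by blast
  define r where "r = e / M"
  have "r > 0"
    using \<open>e > 0\<close> \<open>M > 0\<close> by (simp add: r_def)
  have "norm (y t) \<le> sqrt M * exp (- (r / 2) * t) * norm (y 0)"
    if y: "solves a b c d y" and "t \<ge> 0" for y :: "real \<Rightarrow> 'a \<times> 'a \<times> 'a \<times> 'a" and t
  proof -
    define L where "L s = Re (cinner (twist k k1 k2 (y s)) (y s))" for s
    define L' where "L' s = Re (cinner (twist k k1 k2 (gen a b c d (y s))) (y s))
      + Re (cinner (twist k k1 k2 (y s)) (gen a b c d (y s)))" for s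
    have dL: "(L has_vector_derivative L' s) (at s within {0..})" if "s \<ge> 0" for s
    proof -
      have dy: "(y has_vector_derivative gen a b c d (y s)) (at s within {0..})"
        using y that by (simp add: solves_def)
      show ?thesis
        unfolding L_def L'_def
        using bounded_bilinear.has_vector_derivative[OF bounded_bilinear_Re_cinner
            bounded_linear.has_vector_derivative[OF bounded_linear_twist dy] dy]
        by (simp add: add.commute)
    qed
    define G where "G s = exp (r * s) * L s" for s
    have dG: "(G has_vector_derivative exp (r * s) * (L' s + r * L s)) (at s within {0..})" if "s \<ge> 0" for s
    proof -
      have "((\<lambda>s. exp (r * s)) has_vector_derivative r * exp (r * s)) (at s within {0..})"
        by (auto intro!: derivative_eq_intros simp flip: has_real_derivative_iff_has_vector_derivative)
      from has_vector_derivative_mult[OF this dL[OF that]] show ?thesis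
        unfolding G_def by (rule has_vector_derivative_eq_rhs) (simp add: algebra_simps)
    qed
    have "L' s + r * L s \<le> 0" for s
    proof -
      have "r * L s \<le> r * (M * (norm (y s))\<^sup>2)"
        using ly(2) \<open>r > 0\<close> by (simp add: L_def)
      then show ?thesis
        using ly(3)[of "y s"] \<open>M > 0\<close> by (simp add: L'_def r_def)
    qed
    then have neg: "exp (r * s) * (L' s + r * L s) \<le> 0" for s
      by (simp add: mult_nonneg_nonpos)
    have "G t \<le> G 0"
    proof (rule DERIV_nonpos_imp_decreasing_open[OF \<open>t \<ge> 0\<close>])
      fix s assume s: "0 < s" "s < t"
      have "(G has_real_derivative exp (r * s) * (L' s + r * L s)) (at s within {0..})"
        using dG[of s] s by (simp add: has_real_derivative_iff_has_vector_derivative)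
      moreover have "at s within {0..} = at s"
        using s by (intro at_within_interior) (simp add: interior_real_atLeast)
      ultimately show "\<exists>y. (G has_real_derivative y) (at s) \<and> y \<le> 0"
        using neg by auto
    next
      show "continuous_on {0..t} G"
      proof (rule continuous_on_subset)
        show "continuous_on {0..} G"
          unfolding continuous_on_eq_continuous_within
          using dG has_vector_derivative_continuous by fastforce
      qed auto
    qed
    moreover have "exp (r * t) * (norm (y t))\<^sup>2 \<le> G t"
      unfolding G_def L_def by (intro mult_left_mono ly(1)) simp
    moreover have "G 0 \<le> M * (norm (y 0))\<^sup>2"
      using ly(2)[of "y 0"] by (simp add: G_def L_def)
    ultimately have "exp (r * t) * (norm (y t))\<^sup>2 \<le> M * (norm (y 0))\<^sup>2"
      by linarith
    then have "exp (- (r * t)) * (exp (r * t) * (norm (y t))\<^sup>2) \<le> exp (- (r * t)) * (M * (norm (y 0))\<^sup>2)"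
      by (rule mult_left_mono) simp
    moreover have "exp (- (r * t)) * (exp (r * t) * (norm (y t))\<^sup>2) = (norm (y t))\<^sup>2"
      by (simp add: exp_minus)
    moreover have "exp (- (r * t)) * (M * (norm (y 0))\<^sup>2) = (sqrt M * exp (- (r / 2) * t) * norm (y 0))\<^sup>2"
      using \<open>M > 0\<close> by (simp add: power_mult_distrib flip: exp_double)
    ultimately have "(norm (y t))\<^sup>2 \<le> (sqrt M * exp (- (r / 2) * t) * norm (y 0))\<^sup>2"
      by simp
    then show ?thesis
      by (rule power2_le_imp_le) (use \<open>M > 0\<close> in simp)
  qed
  then show ?thesis
    using \<open>r > 0\<close> \<open>M > 0\<close> by (intro exI[of _ "sqrt M"] exI[of _ "r / 2"]) auto
qed

section \<open>The thermoelastic semigroup\<close>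

context elliptic_operator
begin

section \<open>Formal sums and the vectors they represent\<close>

lemma expansion_apply: "expansion D A x \<mu> = P \<mu> x"
  by (simp add: expansion_def)

lemma fractional_power_apply: "fractional_power D A s x \<mu> = (\<mu> powr s) *\<^sub>R P \<mu> x"
  by (simp add: fractional_power_def expansion_apply)

lemma in_H_I: "(\<And>\<mu>. w \<mu> = P \<mu> x) \<Longrightarrow> in_H D A w"
  unfolding in_H_def by (intro range_eqI[of _ _ x] ext) (simp add: expansion_apply)

lemma vector_of_eq:
  assumes "\<And>\<mu>. w \<mu> = P \<mu> x"
  shows "vector_of D A w = x"
  unfolding vector_of_def
proof (rule the_equality)
  show "expansion D A x = w"
    using assms by (auto simp: expansion_apply)
  fix y assume "expansion D A y = w"
  then have "P \<mu> y = P \<mu> x" for \<mu>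
    using assms[of \<mu>] by (auto simp: expansion_def)
  then show "y = x"
    by (rule P_injective)
qed

lemma P_vector_of:
  assumes "in_H D A w"
  shows "P \<mu> (vector_of D A w) = w \<mu>"
proof -
  obtain x where "w = expansion D A x"
    using assms by (auto simp: in_H_def)
  then have "\<And>\<mu>. w \<mu> = P \<mu> x"
    by (simp add: expansion_apply)
  then show ?thesis
    using vector_of_eq by metis
qed

lemma in_H_diff:
  assumes "in_H D A w1" "in_H D A w2"
  shows "in_H D A (\<lambda>\<mu>. w1 \<mu> - w2 \<mu>)"
  by (rule in_H_I[of _ "vector_of D A w1 - vector_of D A w2"]) (simp add: P_diff P_vector_of assms)

lemma in_H_scaleC:
  assumes "in_H D A w"
  shows "in_H D A (\<lambda>\<mu>. c *\<^sub>C w \<mu>)"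
  by (rule in_H_I[of _ "c *\<^sub>C vector_of D A w"]) (simp add: P_scaleC P_vector_of assms)

text \<open>Bessel in one direction, synthesis in the other: membership in H of an expression formed
  in the extrapolation spaces becomes a condition on its terms.\<close>

lemma in_H_iff: "in_H D A w \<longleftrightarrow> (\<forall>\<mu>. w \<mu> \<in> E \<mu>) \<and> (\<lambda>\<mu>. (norm (w \<mu>))\<^sup>2) summable_on UNIV"
proof
  assume "in_H D A w"
  then obtain x where "w = expansion D A x"
    by (auto simp: in_H_def)
  then have "w = (\<lambda>\<mu>. P \<mu> x)"
    by (simp add: expansion_def)
  then show "(\<forall>\<mu>. w \<mu> \<in> E \<mu>) \<and> (\<lambda>\<mu>. (norm (w \<mu>))\<^sup>2) summable_on UNIV"
    using summable_P[of x] P_in_E by simp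
next
  assume "(\<forall>\<mu>. w \<mu> \<in> E \<mu>) \<and> (\<lambda>\<mu>. (norm (w \<mu>))\<^sup>2) summable_on UNIV"
  then obtain x where "\<forall>\<mu>. P \<mu> x = w \<mu>"
    using synthesis[of w] by blast
  then show "in_H D A w"
    by (intro in_H_I[of _ x]) simp
qed

lemma power_space_iff: "expansion D A x \<in> power_space D A s \<longleftrightarrow> in_H D A (fractional_power D A s x)"
proof -
  have "fractional_power D A s x \<mu> \<in> E \<mu>" for \<mu>
    unfolding fractional_power_apply by (intro complex_subspace_scaleR subspace_E P_in_E)
  then show ?thesis
    by (simp add: in_H_iff power_space_def expansion_apply fractional_power_apply P_in_E)
qed

end

section \<open>State space and operator, mode by mode\<close>

locale thermoelastic = elliptic_operator D A
  for D :: "'h::complex_hilbert set" and A :: "'h \<Rightarrow> 'h" +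
  fixes \<sigma> \<tau> \<alpha> \<beta> :: real
  assumes sigma: "\<sigma> > 0" and tau: "\<tau> > 0" and Q: "(\<alpha>, \<beta>) \<in> Q_star"
begin

abbreviation X :: "('h \<times> 'h \<times> 'h \<times> 'h) set" where "X \<equiv> state_space D A"
abbreviation N :: "'h \<times> 'h \<times> 'h \<times> 'h \<Rightarrow> real" where "N \<equiv> state_norm D A \<sigma> \<tau>"
abbreviation DB :: "('h \<times> 'h \<times> 'h \<times> 'h) set" where "DB \<equiv> system_domain D A \<sigma> \<alpha> \<beta>"
abbreviation B :: "'h \<times> 'h \<times> 'h \<times> 'h \<Rightarrow> 'h \<times> 'h \<times> 'h \<times> 'h" where
  "B \<equiv> system_operator D A \<sigma> \<tau> \<alpha> \<beta>"

definition ca :: "real \<Rightarrow> real" where "ca \<mu> = sqrt \<sigma> * \<mu> powr (1/2)"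
definition cb :: "real \<Rightarrow> real" where "cb \<mu> = \<mu> powr \<alpha>"
definition cc :: "real \<Rightarrow> real" where "cc \<mu> = \<mu> powr (\<beta>/2) / sqrt \<tau>"

abbreviation M :: "real \<Rightarrow> 'h \<times> 'h \<times> 'h \<times> 'h \<Rightarrow> 'h \<times> 'h \<times> 'h \<times> 'h" where
  "M \<mu> \<equiv> gen (ca \<mu>) (cb \<mu>) (cc \<mu>) (1/\<tau>)"

text \<open>The component at \<open>\<mu>\<close> in the coordinates that turn the energy into the
  Euclidean norm. It is defined for every real \<open>\<mu>\<close> and is 0 unless
  \<open>\<mu>\<close> is an eigenvalue, so sums may run over all reals.\<close>

definition mode :: "real \<Rightarrow> 'h \<times> 'h \<times> 'h \<times> 'h \<Rightarrow> 'h \<times> 'h \<times> 'h \<times> 'h" where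
  "mode \<mu> = (\<lambda>(u, v, \<theta>, q). (ca \<mu> *\<^sub>R P \<mu> u, P \<mu> v, P \<mu> \<theta>, sqrt \<tau> *\<^sub>R P \<mu> q))"

lemma mode_diff: "mode \<mu> (U - V) = mode \<mu> U - mode \<mu> V"
  by (cases U; cases V) (simp add: mode_def P_diff scaleR_diff_right)

lemma mode_scaleR: "mode \<mu> (r *\<^sub>R U) = r *\<^sub>R mode \<mu> U"
  by (cases U) (simp add: mode_def P_scaleR scaleR_prod_def)

lemma mode_in_E: "mode \<mu> U \<in> E \<mu> \<times> E \<mu> \<times> E \<mu> \<times> E \<mu>"
  by (cases U) (auto simp: mode_def intro!: complex_subspace_scaleR subspace_E P_in_E)

lemma mode_trivial:
  assumes "E \<mu> = {0}"
  shows "mode \<mu> U = 0"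
  using mode_in_E[of \<mu> U] unfolding assms by (auto simp: zero_prod_def)

lemma X_iff: "(u, v, \<theta>, q) \<in> X \<longleftrightarrow> in_H D A (fractional_power D A (1/2) u)"
  by (simp add: state_space_def power_space_iff)

lemma X_diff:
  assumes "U \<in> X" "V \<in> X"
  shows "U - V \<in> X"
proof -
  obtain u1 v1 \<theta>1 q1 u2 v2 \<theta>2 q2 where UV: "U = (u1, v1, \<theta>1, q1)" "V = (u2, v2, \<theta>2, q2)"
    by (cases U; cases V) auto
  have "fractional_power D A (1/2) (u1 - u2)
      = (\<lambda>\<mu>. fractional_power D A (1/2) u1 \<mu> - fractional_power D A (1/2) u2 \<mu>)"
    by (auto simp: fractional_power_apply P_diff scaleR_diff_right)
  then show ?thesis
    using assms by (simp add: UV X_iff in_H_diff)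
qed

lemma X_scaleR:
  assumes "U \<in> X"
  shows "r *\<^sub>R U \<in> X"
proof -
  obtain u v \<theta> q where U: "U = (u, v, \<theta>, q)"
    by (cases U) auto
  have "fractional_power D A (1/2) (r *\<^sub>R u) = (\<lambda>\<mu>. complex_of_real r *\<^sub>C fractional_power D A (1/2) u \<mu>)"
    by (intro ext) (simp add: fractional_power_apply P_scaleR mult.commute flip: scaleR_scaleC)
  then show ?thesis
    using assms in_H_scaleC by (simp add: U X_iff scaleR_prod_def)
qed

lemma DB_subset: "DB \<subseteq> X"
  by (auto simp: system_domain_def)

lemma DB_diff:
  assumes "U \<in> DB" "V \<in> DB"
  shows "U - V \<in> DB"
proof -
  obtain u1 v1 \<theta>1 q1 u2 v2 \<theta>2 q2 where UV: "U = (u1, v1, \<theta>1, q1)" "V = (u2, v2, \<theta>2, q2)"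
    by (cases U; cases V) auto
  have "fractional_power D A (1/2) (v1 - v2)
      = (\<lambda>\<mu>. fractional_power D A (1/2) v1 \<mu> - fractional_power D A (1/2) v2 \<mu>)"
    "stress D A \<sigma> \<alpha> (u1 - u2) (\<theta>1 - \<theta>2)
      = (\<lambda>\<mu>. stress D A \<sigma> \<alpha> u1 \<theta>1 \<mu> - stress D A \<sigma> \<alpha> u2 \<theta>2 \<mu>)"
    "heat D A \<alpha> \<beta> (v1 - v2) (q1 - q2) = (\<lambda>\<mu>. heat D A \<alpha> \<beta> v1 q1 \<mu> - heat D A \<alpha> \<beta> v2 q2 \<mu>)"
    "flux D A \<beta> (\<theta>1 - \<theta>2) (q1 - q2) = (\<lambda>\<mu>. flux D A \<beta> \<theta>1 q1 \<mu> - flux D A \<beta> \<theta>2 q2 \<mu>)"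
    by (auto simp: fractional_power_apply expansion_apply stress_def heat_def flux_def P_diff scaleR_diff_right)
  moreover have "U - V \<in> X"
    using assms DB_subset X_diff by blast
  ultimately show ?thesis
    using assms by (simp add: UV system_domain_def power_space_iff in_H_diff)
qed

lemma B_in_X: "U \<in> DB \<Longrightarrow> B U \<in> X"
  by (cases U) (auto simp: system_domain_def system_operator_def state_space_def)

lemma coefficients_pos:
  assumes "\<mu> > 0"
  shows "ca \<mu> > 0" "cb \<mu> > 0" "cc \<mu> > 0" "1 / \<tau> > 0" "(ca \<mu>)\<^sup>2 = \<sigma> * \<mu>"
proof -
  have "(\<mu> powr (1/2))\<^sup>2 = \<mu>"
    using assms by (simp add: powr_half_sqrt)
  then show "(ca \<mu>)\<^sup>2 = \<sigma> * \<mu>"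
    using sigma by (simp add: ca_def power_mult_distrib)
qed (use assms sigma tau in \<open>auto simp: ca_def cb_def cc_def\<close>)

text \<open>The intertwining relation behind the decoupling. The membership conditions of the domain
  let the projection pass through the formal sums; for nonpositive \<open>\<mu>\<close> both sides
  vanish, as all eigenvalues are positive.\<close>

lemma mode_B:
  assumes "U \<in> DB"
  shows "mode \<mu> (B U) = M \<mu> (mode \<mu> U)"
proof -
  obtain u v \<theta> q where U: "U = (u, v, \<theta>, q)"
    by (cases U) auto
  have H: "in_H D A (stress D A \<sigma> \<alpha> u \<theta>)" "in_H D A (heat D A \<alpha> \<beta> v q)" "in_H D A (flux D A \<beta> \<theta> q)"
    using assms by (auto simp: U system_domain_def)
  have st: "sqrt \<tau> / \<tau> = 1 / sqrt \<tau>" "sqrt \<tau> * sqrt \<tau> = \<tau>"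
    using tau by (auto simp: field_simps)
  have st': "sqrt \<tau> * r / \<tau> = r / sqrt \<tau>" for r
  proof -
    have "sqrt \<tau> * r / \<tau> = r * (sqrt \<tau> / \<tau>)"
      by simp
    then show ?thesis
      by (simp only: st(1)) simp
  qed
  show ?thesis
  proof (cases "\<mu> > 0")
    case True
    have e: "(ca \<mu>)\<^sup>2 = \<sigma> * \<mu>"
      by (rule coefficients_pos(5)[OF True])
    have "P \<mu> (- vector_of D A (stress D A \<sigma> \<alpha> u \<theta>)) = cb \<mu> *\<^sub>R P \<mu> \<theta> - ca \<mu> *\<^sub>R ca \<mu> *\<^sub>R P \<mu> u"
      using True e unfolding P_minus P_vector_of[OF H(1)]
      by (simp add: stress_def fractional_power_apply cb_def power2_eq_square)
    moreover have "P \<mu> (vector_of D A (heat D A \<alpha> \<beta> v q)) = cc \<mu> *\<^sub>R sqrt \<tau> *\<^sub>R P \<mu> q - cb \<mu> *\<^sub>R P \<mu> v"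
      using tau unfolding P_vector_of[OF H(2)] by (simp add: heat_def fractional_power_apply cb_def cc_def)
    moreover have "sqrt \<tau> *\<^sub>R P \<mu> ((1/\<tau>) *\<^sub>R (- vector_of D A (flux D A \<beta> \<theta> q)))
        = - (cc \<mu> *\<^sub>R P \<mu> \<theta>) - (1/\<tau>) *\<^sub>R sqrt \<tau> *\<^sub>R P \<mu> q"
      unfolding P_scaleR P_minus P_vector_of[OF H(3)]
      by (simp add: flux_def fractional_power_apply expansion_apply cc_def st st' scaleR_diff_right)
    ultimately show ?thesis
      by (simp add: U mode_def gen_def system_operator_def)
  next
    case False
    then show ?thesis
      by (cases "B U") (simp add: U mode_def gen_def P_nonpos)
  qed
qed

text \<open>Parseval for each of the four components; for \<open>u\<close> it is applied to the
  vector that represents \<open>A^(1/2) u\<close>.\<close>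

lemma state_norm_has_sum:
  assumes "U \<in> X"
  shows "((\<lambda>\<mu>. (norm (mode \<mu> U))\<^sup>2) has_sum (N U)\<^sup>2) UNIV"
proof -
  obtain u v \<theta> q where U: "U = (u, v, \<theta>, q)"
    by (cases U) auto
  define x where "x = vector_of D A (fractional_power D A (1/2) u)"
  have Px: "P \<mu> x = (\<mu> powr (1/2)) *\<^sub>R P \<mu> u" for \<mu>
    unfolding x_def using assms by (subst P_vector_of) (auto simp: U X_iff fractional_power_apply)
  have "Re (state_inner D A \<sigma> \<tau> U U) = \<sigma> * (norm x)\<^sup>2 + (norm v)\<^sup>2 + (norm \<theta>)\<^sup>2 + \<tau> * (norm q)\<^sup>2"
    by (simp add: U state_inner_def cinner_self_eq flip: x_def)
  then have N2: "(N U)\<^sup>2 = \<sigma> * (norm x)\<^sup>2 + (norm v)\<^sup>2 + (norm \<theta>)\<^sup>2 + \<tau> * (norm q)\<^sup>2"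
    using sigma tau by (simp add: state_norm_def)
  have "((\<lambda>\<mu>. \<sigma> * (norm (P \<mu> x))\<^sup>2 + (norm (P \<mu> v))\<^sup>2 + (norm (P \<mu> \<theta>))\<^sup>2 + \<tau> * (norm (P \<mu> q))\<^sup>2)
      has_sum (N U)\<^sup>2) UNIV"
    unfolding N2 by (intro has_sum_add has_sum_cmult_right parseval)
  moreover have "(norm (mode \<mu> U))\<^sup>2
      = \<sigma> * (norm (P \<mu> x))\<^sup>2 + (norm (P \<mu> v))\<^sup>2 + (norm (P \<mu> \<theta>))\<^sup>2 + \<tau> * (norm (P \<mu> q))\<^sup>2" for \<mu>
    using sigma tau by (simp add: U mode_def norm_quad_square Px ca_def power_mult_distrib)
  ultimately show ?thesis
    by simp
qed

lemma N_nonneg: "N U \<ge> 0" if "U \<in> X"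
proof -
  obtain u v \<theta> q where U: "U = (u, v, \<theta>, q)"
    by (cases U) auto
  show ?thesis
    using sigma tau by (simp add: U state_norm_def state_inner_def cinner_self_eq)
qed

lemma norm_mode_le:
  assumes "U \<in> X"
  shows "norm (mode \<mu> U) \<le> N U"
proof (rule power2_le_imp_le)
  have "((\<lambda>\<nu>. (norm (mode \<nu> U))\<^sup>2) has_sum (norm (mode \<mu> U))\<^sup>2) {\<mu>}"
    by (intro has_sum_finiteI) auto
  then show "(norm (mode \<mu> U))\<^sup>2 \<le> (N U)\<^sup>2"
    by (rule has_sum_mono_neutral[OF _ state_norm_has_sum[OF assms]]) auto
qed (rule N_nonneg[OF assms])

text \<open>Each mode is solved on its eigenspace; dissipativity bounds the solution by the datum in
  every mode, so the modes are square-summable and assemble to vectors of H. This makes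
  \<open>resolvent DB B 1\<close>, an \<open>inv_into\<close>, a genuine right inverse of
  \<open>I - B\<close> on the state space.\<close>

lemma resolvent_surjective:
  assumes "U \<in> X"
  shows "\<exists>Y\<in>DB. Y - B Y = U"
proof -
  obtain u0 v0 \<theta>0 q0 where U: "U = (u0, v0, \<theta>0, q0)"
    by (cases U) auto
  have "\<exists>y\<in>E \<mu> \<times> E \<mu> \<times> E \<mu> \<times> E \<mu>. y - M \<mu> y = mode \<mu> U" for \<mu>
    by (rule minus_gen_surjective[OF _ subspace_E mode_in_E]) (use tau in simp)
  then have "\<exists>y. \<forall>\<mu>. y \<mu> \<in> E \<mu> \<times> E \<mu> \<times> E \<mu> \<times> E \<mu> \<and> y \<mu> - M \<mu> (y \<mu>) = mode \<mu> U"
    by (intro choice) blast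
  then obtain y where y: "\<And>\<mu>. y \<mu> \<in> E \<mu> \<times> E \<mu> \<times> E \<mu> \<times> E \<mu>" "\<And>\<mu>. y \<mu> - M \<mu> (y \<mu>) = mode \<mu> U"
    by blast
  define y1 y2 y3 y4 where "y1 \<mu> = fst (y \<mu>)" and "y2 \<mu> = fst (snd (y \<mu>))"
    and "y3 \<mu> = fst (snd (snd (y \<mu>)))" and "y4 \<mu> = snd (snd (snd (y \<mu>)))" for \<mu>
  have y_eq: "y \<mu> = (y1 \<mu>, y2 \<mu>, y3 \<mu>, y4 \<mu>)" for \<mu>
    by (simp add: y1_def y2_def y3_def y4_def)
  have yE: "y1 \<mu> \<in> E \<mu>" "y2 \<mu> \<in> E \<mu>" "y3 \<mu> \<in> E \<mu>" "y4 \<mu> \<in> E \<mu>" for \<mu>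
    using y(1)[of \<mu>] by (auto simp: y_eq)
  have "norm (y \<mu>) \<le> norm (mode \<mu> U)" for \<mu>
    using norm_le_norm_minus_gen[of "1/\<tau>" "y \<mu>" "ca \<mu>" "cb \<mu>" "cc \<mu>"] tau by (simp add: y(2))
  then have le: "(norm z)\<^sup>2 \<le> (norm (mode \<mu> U))\<^sup>2" if "norm z \<le> norm (y \<mu>)" for z :: 'h and \<mu>
    using that by (meson norm_ge_zero order_trans power_mono)
  have summ: "(\<lambda>\<mu>. (norm (z \<mu>))\<^sup>2) summable_on UNIV" if "\<And>\<mu>. norm (z \<mu>) \<le> norm (y \<mu>)" for z :: "real \<Rightarrow> 'h"
    using has_sum_imp_summable[OF state_norm_has_sum[OF assms]]
    by (rule summable_on_comparison_test) (use le[OF that] in auto)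
  have syn: "\<exists>x. \<forall>\<mu>. P \<mu> x = z \<mu>" if "\<And>\<mu>. z \<mu> \<in> E \<mu>" "\<And>\<mu>. norm (z \<mu>) \<le> norm (y \<mu>)" for z
    using synthesis[OF that(1) summ[OF that(2)]] by blast
  note ge = norm_quad_ge[where w = "y1 \<mu>" and v = "y2 \<mu>" and \<theta> = "y3 \<mu>" and p = "y4 \<mu>" for \<mu>, folded y_eq]
  obtain w where w: "\<And>\<mu>. P \<mu> w = y1 \<mu>"
    using syn[OF yE(1) ge(1)] by blast
  obtain v where v: "\<And>\<mu>. P \<mu> v = y2 \<mu>"
    using syn[OF yE(2) ge(2)] by blast
  obtain \<theta> where \<theta>: "\<And>\<mu>. P \<mu> \<theta> = y3 \<mu>"
    using syn[OF yE(3) ge(3)] by blast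
  obtain p where p: "\<And>\<mu>. P \<mu> p = y4 \<mu>"
    using syn[OF yE(4) ge(4)] by blast
  \<comment> \<open>The first equation is solved for \<open>u\<close> directly, without dividing
    \<open>w\<close> by \<open>ca \<mu>\<close>; afterwards \<open>w\<close> turns out to represent
    \<open>\<sigma>^(1/2) A^(1/2) u\<close>.\<close>
  define u where "u = v + u0"
  define q where "q = (1 / sqrt \<tau>) *\<^sub>R p"
  have sq: "sqrt \<tau> * sqrt \<tau> = \<tau>" "sqrt \<tau> > 0"
    using tau by auto
  have p_eq: "P \<mu> p = sqrt \<tau> *\<^sub>R P \<mu> q" for \<mu>
    using sq(2) by (simp add: q_def P_scaleR)
  have eqs: "P \<mu> w - ca \<mu> *\<^sub>R P \<mu> v = ca \<mu> *\<^sub>R P \<mu> u0"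
    "P \<mu> v - (cb \<mu> *\<^sub>R P \<mu> \<theta> - ca \<mu> *\<^sub>R P \<mu> w) = P \<mu> v0"
    "P \<mu> \<theta> - (cc \<mu> *\<^sub>R P \<mu> p - cb \<mu> *\<^sub>R P \<mu> v) = P \<mu> \<theta>0"
    "P \<mu> p - (- (cc \<mu> *\<^sub>R P \<mu> \<theta>) - (1/\<tau>) *\<^sub>R P \<mu> p) = sqrt \<tau> *\<^sub>R P \<mu> q0" for \<mu>
    using y(2)[of \<mu>] by (auto simp: y_eq gen_def mode_def U v \<theta> p w)
  have w_eq: "P \<mu> w = ca \<mu> *\<^sub>R P \<mu> u" for \<mu>
    using eqs(1)[of \<mu>] by (simp add: u_def P_add scaleR_add_right diff_eq_eq add.commute)
  have "fractional_power D A (1/2) u \<mu> = P \<mu> ((1 / sqrt \<sigma>) *\<^sub>R w)" for \<mu>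
    using sigma by (simp add: fractional_power_apply P_scaleR w_eq ca_def)
  then have uX: "in_H D A (fractional_power D A (1/2) u)"
    by (rule in_H_I)
  have u0X: "in_H D A (fractional_power D A (1/2) u0)"
    using assms by (simp add: U X_iff)
  have "fractional_power D A (1/2) v
      = (\<lambda>\<mu>. fractional_power D A (1/2) u \<mu> - fractional_power D A (1/2) u0 \<mu>)"
    by (auto simp: fractional_power_apply u_def P_add scaleR_add_right)
  then have vX: "in_H D A (fractional_power D A (1/2) v)"
    using in_H_diff[OF uX u0X] by simp
  have stress: "stress D A \<sigma> \<alpha> u \<theta> \<mu> = P \<mu> (v0 - v)" for \<mu>
  proof (cases "\<mu> > 0")
    case True
    have "ca \<mu> *\<^sub>R P \<mu> w = (\<sigma> * \<mu>) *\<^sub>R P \<mu> u"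
      using coefficients_pos(5)[OF True] by (simp add: w_eq power2_eq_square)
    then have "stress D A \<sigma> \<alpha> u \<theta> \<mu> = ca \<mu> *\<^sub>R P \<mu> w - cb \<mu> *\<^sub>R P \<mu> \<theta>"
      using True by (simp add: stress_def fractional_power_apply cb_def)
    then show ?thesis
      by (simp only: P_diff eqs(2)[of \<mu>, symmetric]) simp
  qed (simp add: stress_def fractional_power_apply P_nonpos)
  have heat: "heat D A \<alpha> \<beta> v q \<mu> = P \<mu> (\<theta> - \<theta>0)" for \<mu>
  proof -
    have "cc \<mu> *\<^sub>R P \<mu> p = \<mu> powr (\<beta>/2) *\<^sub>R P \<mu> q"
      using sq(2) by (simp add: p_eq cc_def)
    then show ?thesis
      by (simp add: heat_def fractional_power_apply cb_def P_diff eqs(3)[of \<mu>, symmetric])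
  qed
  have flux: "flux D A \<beta> \<theta> q \<mu> = P \<mu> (\<tau> *\<^sub>R (q0 - q))" for \<mu>
  proof -
    have "sqrt \<tau> *\<^sub>R (P \<mu> p - (- (cc \<mu> *\<^sub>R P \<mu> \<theta>) - (1/\<tau>) *\<^sub>R P \<mu> p))
        = sqrt \<tau> *\<^sub>R sqrt \<tau> *\<^sub>R P \<mu> q0"
      by (simp only: eqs(4))
    moreover have "sqrt \<tau> *\<^sub>R (P \<mu> p - (- (cc \<mu> *\<^sub>R P \<mu> \<theta>) - (1/\<tau>) *\<^sub>R P \<mu> p))
        = \<tau> *\<^sub>R P \<mu> q + \<mu> powr (\<beta>/2) *\<^sub>R P \<mu> \<theta> + P \<mu> q"
      using sq tau by (simp add: p_eq cc_def scaleR_diff_right scaleR_add_right)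
    ultimately show ?thesis
      using sq(1) by (simp add: flux_def fractional_power_apply expansion_apply P_scaleR P_diff
          algebra_simps)
  qed
  define Y where "Y = (u, v, \<theta>, q)"
  have "Y \<in> DB"
    using uX vX in_H_I[OF stress] in_H_I[OF heat] in_H_I[OF flux]
    by (simp add: Y_def system_domain_def X_iff power_space_iff)
  moreover have "Y - B Y = U"
    using tau by (simp add: Y_def U system_operator_def vector_of_eq[OF stress] vector_of_eq[OF heat]
        vector_of_eq[OF flux]) (simp add: u_def algebra_simps)
  ultimately show ?thesis
    by blast
qed

end

section \<open>Orbits of the semigroup, mode by mode\<close>

locale thermoelastic_semigroup = thermoelastic D A \<sigma> \<tau> \<alpha> \<beta>
  for D :: "'h::complex_hilbert set" and A :: "'h \<Rightarrow> 'h" and \<sigma> \<tau> \<alpha> \<beta> :: real +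
  fixes T :: "real \<Rightarrow> 'h \<times> 'h \<times> 'h \<times> 'h \<Rightarrow> 'h \<times> 'h \<times> 'h \<times> 'h"
  assumes semigroup: "contraction_semigroup X N T" and generator: "is_generator X N T DB B"
begin

lemma T_in_X: "t \<ge> 0 \<Longrightarrow> U \<in> X \<Longrightarrow> T t U \<in> X"
  and N_T_le: "t \<ge> 0 \<Longrightarrow> U \<in> X \<Longrightarrow> N (T t U) \<le> N U"
  and T_zero: "U \<in> X \<Longrightarrow> T 0 U = U"
  and T_add: "s \<ge> 0 \<Longrightarrow> t \<ge> 0 \<Longrightarrow> U \<in> X \<Longrightarrow> T (s + t) U = T s (T t U)"
  and T_continuous: "U \<in> X \<Longrightarrow> ((\<lambda>t. N (T t U - U)) \<longlongrightarrow> 0) (at_right 0)"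
  and T_linear: "t \<ge> 0 \<Longrightarrow> linear_operator X (T t)"
  using semigroup unfolding contraction_semigroup_def by blast+

lemma T_scaleR:
  assumes "t \<ge> 0" "U \<in> X"
  shows "T t (r *\<^sub>R U) = r *\<^sub>R T t U"
  using T_linear[OF assms(1)] assms(2) by (simp add: linear_operator_def scaleR_scaleC)

lemma T_diff:
  assumes "t \<ge> 0" "U \<in> X" "V \<in> X"
  shows "T t (U - V) = T t U - T t V"
proof -
  have "T t (U + (- 1) *\<^sub>R V) = T t U + T t ((- 1) *\<^sub>R V)"
    using T_linear[OF assms(1)] assms(2) X_scaleR[OF assms(3)] unfolding linear_operator_def by blast
  then show ?thesis
    using T_scaleR[OF assms(1,3), of "-1"] by simp
qed

lemma tendsto_mode:
  assumes "((\<lambda>h. N (x h - y)) \<longlongrightarrow> 0) F" "\<forall>\<^sub>F h in F. x h \<in> X" "y \<in> X"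
  shows "((\<lambda>h. mode \<mu> (x h)) \<longlongrightarrow> mode \<mu> y) F"
proof -
  have "((\<lambda>h. mode \<mu> (x h) - mode \<mu> y) \<longlongrightarrow> 0) F"
  proof (rule Lim_null_comparison[OF _ assms(1)])
    show "\<forall>\<^sub>F h in F. norm (mode \<mu> (x h) - mode \<mu> y) \<le> N (x h - y)"
      using assms(2) by eventually_elim (simp add: norm_mode_le X_diff assms(3) flip: mode_diff)
  qed
  then show ?thesis
    by (simp add: LIM_zero_iff)
qed

text \<open>The error of the difference quotient at time 0; contractivity makes it an error bound at
  all later times.\<close>

definition defect :: "'h \<times> 'h \<times> 'h \<times> 'h \<Rightarrow> real \<Rightarrow> real" where
  "defect V h = N ((1 / h) *\<^sub>R (T h V - V) - B V)"

lemma defect_tendsto: "V \<in> DB \<Longrightarrow> (defect V \<longlongrightarrow> 0) (at_right 0)"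
  using generator unfolding is_generator_def has_right_derivative_at_0_def defect_def[abs_def] by blast

lemma DB_in_X: "V \<in> DB \<Longrightarrow> V \<in> X"
  using DB_subset by blast

lemma quotient_in_X: "V \<in> X \<Longrightarrow> h \<ge> 0 \<Longrightarrow> (1 / h) *\<^sub>R (T h V - V) \<in> X"
  by (intro X_scaleR X_diff T_in_X)

lemma N_shifted_quotient_le:
  assumes "V \<in> DB" "s \<ge> 0" "h > 0"
  shows "N ((1 / h) *\<^sub>R (T h (T s V) - T s V) - T s (B V)) \<le> defect V h"
proof -
  have "T h (T s V) = T s (T h V)"
    using assms T_add[of h s V] T_add[of s h V] DB_in_X by (simp add: add.commute)
  then have "(1 / h) *\<^sub>R (T h (T s V) - T s V) - T s (B V) = T s ((1 / h) *\<^sub>R (T h V - V) - B V)"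
    using assms by (simp add: T_diff T_scaleR X_scaleR X_diff T_in_X B_in_X DB_in_X)
  then show ?thesis
    unfolding defect_def using assms by (simp add: N_T_le X_diff X_scaleR T_in_X B_in_X DB_in_X)
qed

text \<open>Invariance of the domain and commutation with the generator. Two right derivatives of
  the same orbit are compared after \<open>mode\<close>, where uniqueness of limits for the norm of
  the type is available.\<close>

lemma T_domain:
  assumes V: "V \<in> DB" and "s \<ge> 0"
  shows "T s V \<in> DB" "mode \<mu> (B (T s V)) = mode \<mu> (T s (B V))"
proof -
  note VX = DB_in_X[OF V]
  have *: "((\<lambda>h. N ((1 / h) *\<^sub>R (T h (T s V) - T s V) - T s (B V))) \<longlongrightarrow> 0) (at_right 0)"
  proof (rule tendsto_sandwich[OF _ _ tendsto_const defect_tendsto[OF V]])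
    show "\<forall>\<^sub>F h in at_right 0. 0 \<le> N ((1 / h) *\<^sub>R (T h (T s V) - T s V) - T s (B V))"
      using eventually_at_right_less[of "0::real"]
      by eventually_elim
        (intro N_nonneg X_diff quotient_in_X T_in_X B_in_X VX V \<open>s \<ge> 0\<close>, simp)
    show "\<forall>\<^sub>F h in at_right 0. N ((1 / h) *\<^sub>R (T h (T s V) - T s V) - T s (B V)) \<le> defect V h"
      using eventually_at_right_less[of "0::real"]
      by eventually_elim (rule N_shifted_quotient_le[OF V \<open>s \<ge> 0\<close>])
  qed
  then have d: "has_right_derivative_at_0 N T (T s V) (T s (B V))"
    by (simp add: has_right_derivative_at_0_def)
  have TBX: "T s (B V) \<in> X"
    by (intro T_in_X B_in_X V \<open>s \<ge> 0\<close>)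
  have TX: "T s V \<in> X"
    by (intro T_in_X VX \<open>s \<ge> 0\<close>)
  show TD: "T s V \<in> DB"
    using generator d TBX TX unfolding is_generator_def by blast
  then have "has_right_derivative_at_0 N T (T s V) (B (T s V))"
    using generator unfolding is_generator_def by blast
  then have **: "((\<lambda>h. N ((1 / h) *\<^sub>R (T h (T s V) - T s V) - B (T s V))) \<longlongrightarrow> 0) (at_right 0)"
    by (simp add: has_right_derivative_at_0_def)
  have ev: "\<forall>\<^sub>F h in at_right 0. (1 / h) *\<^sub>R (T h (T s V) - T s V) \<in> X"
    using eventually_at_right_less[of "0::real"]
    by eventually_elim (rule quotient_in_X[OF TX], simp)
  show "mode \<mu> (B (T s V)) = mode \<mu> (T s (B V))"
    by (rule tendsto_unique[OF _ tendsto_mode[OF ** ev B_in_X[OF TD]] tendsto_mode[OF * ev TBX]]) simp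
qed

text \<open>The generator provides right derivatives only. The error bound \<open>defect\<close>,
  uniform in time, and strong continuity of the orbit of \<open>B V\<close> turn them into two-sided
  derivatives at positive times.\<close>

lemma mode_solves:
  assumes V: "V \<in> DB"
  shows "solves (ca \<mu>) (cb \<mu>) (cc \<mu>) (1/\<tau>) (\<lambda>t. mode \<mu> (T t V))"
proof -
  note VX = DB_in_X[OF V] and BX = B_in_X[OF V]
  define g where "g s = mode \<mu> (T s V)" for s
  define g' where "g' s = mode \<mu> (T s (B V))" for s
  define k where "k h = N (T h (B V) - B V)" for h
  have one: "norm (g r - g s - (r - s) *\<^sub>R g' s) \<le> (r - s) * defect V (r - s)"
    if "0 \<le> s" "s < r" for r s
  proof -
    define h where "h = r - s"
    have "h > 0" and r: "T r V = T h (T s V)"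
      using that T_add[of h s V] VX by (auto simp: h_def)
    have "norm (mode \<mu> ((1 / h) *\<^sub>R (T h (T s V) - T s V) - T s (B V))) \<le> defect V h"
      by (rule order_trans[OF norm_mode_le N_shifted_quotient_le[OF V \<open>0 \<le> s\<close> \<open>h > 0\<close>]])
        (use that \<open>h > 0\<close> in \<open>intro X_diff quotient_in_X T_in_X VX BX, auto\<close>)
    then have "h * norm ((1 / h) *\<^sub>R (g r - g s) - g' s) \<le> h * defect V h"
      using \<open>h > 0\<close> by (simp add: g_def g'_def r mode_diff mode_scaleR)
    moreover have "g r - g s - h *\<^sub>R g' s = h *\<^sub>R ((1 / h) *\<^sub>R (g r - g s) - g' s)"
      using \<open>h > 0\<close> by (simp add: scaleR_right_diff_distrib)
    ultimately show ?thesis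
      using \<open>h > 0\<close> by (simp add: h_def)
  qed
  have two: "norm (g' r - g' s) \<le> k (r - s)" if "0 \<le> s" "s \<le> r" for r s
  proof -
    have "T r (B V) = T s (T (r - s) (B V))"
      using that T_add[of s "r - s" "B V"] BX by simp
    then have "g' r - g' s = mode \<mu> (T s (T (r - s) (B V) - B V))"
      using that BX by (simp add: g'_def T_diff T_in_X mode_diff)
    moreover have "norm (mode \<mu> (T s (T (r - s) (B V) - B V))) \<le> N (T s (T (r - s) (B V) - B V))"
      using that BX by (intro norm_mode_le T_in_X X_diff) auto
    moreover have "\<dots> \<le> k (r - s)"
      unfolding k_def using that BX by (intro N_T_le T_in_X X_diff) auto
    ultimately show ?thesis
      by simp
  qed
  have k0: "k h \<ge> 0" if "h \<ge> 0" for h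
    unfolding k_def using that BX by (intro N_nonneg X_diff T_in_X)
  have "(g has_vector_derivative g' t) (at t within {0..})" if "t \<ge> 0" for t
    unfolding has_vector_derivative_def has_derivative_within_alt
  proof (intro conjI allI impI)
    show "bounded_linear (\<lambda>x. x *\<^sub>R g' t)"
      by (rule bounded_linear_scaleR_left)
    fix e :: real assume "e > 0"
    have "\<forall>\<^sub>F h in at_right 0. defect V h < e / 2" "\<forall>\<^sub>F h in at_right 0. k h < e / 2"
      using order_tendstoD(2)[OF defect_tendsto[OF V], of "e / 2"]
        order_tendstoD(2)[OF T_continuous[OF BX], of "e / 2"] \<open>e > 0\<close> by (auto simp: k_def)
    then have "\<forall>\<^sub>F h in at_right 0. defect V h < e / 2 \<and> k h < e / 2"
      by (rule eventually_conj)
    then obtain b where "b > 0" and b: "\<And>h. 0 < h \<Longrightarrow> h < b \<Longrightarrow> defect V h < e / 2 \<and> k h < e / 2"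
      unfolding eventually_at_right_field by auto
    show "\<exists>d>0. \<forall>y\<in>{0..}. norm (y - t) < d \<longrightarrow>
        norm (g y - g t - (y - t) *\<^sub>R g' t) \<le> e * norm (y - t)"
    proof (intro exI[of _ b] conjI ballI impI \<open>b > 0\<close>)
      fix y :: real assume y: "y \<in> {0..}" "norm (y - t) < b"
      consider "y = t" | "t < y" | "y < t" by linarith
      then show "norm (g y - g t - (y - t) *\<^sub>R g' t) \<le> e * norm (y - t)"
      proof cases
        case 2
        have "(y - t) * defect V (y - t) \<le> (y - t) * e"
          using 2 y b[of "y - t"] \<open>e > 0\<close> by (intro mult_left_mono) auto
        from order_trans[OF one[OF \<open>t \<ge> 0\<close> 2] this] show ?thesis
          using 2 by (simp add: mult.commute)
      next
        case 3
        \<comment> \<open>The left difference quotient is expanded from the earlier time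
          \<open>y\<close>, at the price of the change of \<open>g'\<close> between \<open>y\<close>
          and \<open>t\<close>.\<close>
        have "g y - g t - (y - t) *\<^sub>R g' t
            = - (g t - g y - (t - y) *\<^sub>R g' y) + (t - y) *\<^sub>R (g' t - g' y)"
          by (simp add: algebra_simps)
        then have "norm (g y - g t - (y - t) *\<^sub>R g' t)
            \<le> norm (g t - g y - (t - y) *\<^sub>R g' y) + (t - y) * norm (g' t - g' y)"
          using norm_triangle_ineq[of "- (g t - g y - (t - y) *\<^sub>R g' y)" "(t - y) *\<^sub>R (g' t - g' y)"] 3
          by (simp only: norm_minus_cancel norm_scaleR)
        also have "\<dots> \<le> (t - y) * (e / 2) + (t - y) * (e / 2)"
        proof (intro add_mono order_trans[OF one] mult_left_mono order_trans[OF two])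
          show "defect V (t - y) \<le> e / 2" "k (t - y) \<le> e / 2"
            using 3 y b[of "t - y"] by auto
        qed (use 3 y in auto)
        finally show ?thesis
          using 3 by (simp add: algebra_simps)
      qed simp
    qed
  qed
  moreover have "g' t = M \<mu> (g t)" if "t \<ge> 0" for t
    using T_domain[OF V that] mode_B[of "T t V" \<mu>] by (simp add: g_def g'_def)
  ultimately show ?thesis
    by (simp add: solves_def g_def[abs_def])
qed

abbreviation R :: "'h \<times> 'h \<times> 'h \<times> 'h \<Rightarrow> 'h \<times> 'h \<times> 'h \<times> 'h" where "R \<equiv> resolvent DB B 1"

lemma R_in_DB: "U \<in> X \<Longrightarrow> R U \<in> DB" and R_eq: "U \<in> X \<Longrightarrow> R U - B (R U) = U"
proof -
  assume "U \<in> X"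
  then have "U \<in> (\<lambda>x. 1 *\<^sub>C x - B x) ` DB"
    using resolvent_surjective[of U] by auto
  then show "R U \<in> DB" "R U - B (R U) = U"
    unfolding resolvent_def using inv_into_into[of U _ DB] f_inv_into_f[of U "\<lambda>x. 1 *\<^sub>C x - B x" DB]
    by auto
qed

text \<open>\<open>B (R (R U))\<close> equals \<open>R (R U) - R U\<close>, hence lies in the domain
  and its orbit is differentiable. The last three identities are the hypotheses of the estimates on
  one eigenspace, with \<open>u\<close>, \<open>r\<close>, \<open>g\<close> the modes of
  \<open>U\<close>, \<open>R U\<close>, \<open>R (R U)\<close>.\<close>

lemma orbit:
  assumes "U \<in> X"
  shows "B (R (R U)) \<in> DB"
    and "solves (ca \<mu>) (cb \<mu>) (cc \<mu>) (1/\<tau>) (\<lambda>t. mode \<mu> (T t (B (R (R U)))))"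
    and "mode \<mu> (T 0 (B (R (R U)))) = M \<mu> (mode \<mu> (R (R U)))"
    and "mode \<mu> (R (R U)) - M \<mu> (mode \<mu> (R (R U))) = mode \<mu> (R U)"
    and "mode \<mu> (R U) - M \<mu> (mode \<mu> (R U)) = mode \<mu> U"
proof -
  have 1: "R U \<in> DB"
    by (rule R_in_DB[OF assms])
  then have 2: "R (R U) \<in> DB" and e: "R (R U) - B (R (R U)) = R U"
    using R_in_DB R_eq DB_in_X by blast+
  have "B (R (R U)) = R (R U) - R U"
    using e by (simp add: algebra_simps)
  then show 3: "B (R (R U)) \<in> DB"
    using DB_diff[OF 2 1] by simp
  show "solves (ca \<mu>) (cb \<mu>) (cc \<mu>) (1/\<tau>) (\<lambda>t. mode \<mu> (T t (B (R (R U)))))"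
    by (rule mode_solves[OF 3])
  show "mode \<mu> (T 0 (B (R (R U)))) = M \<mu> (mode \<mu> (R (R U)))"
    using T_zero[OF DB_in_X[OF 3]] mode_B[OF 2] by simp
  show "mode \<mu> (R (R U)) - M \<mu> (mode \<mu> (R (R U))) = mode \<mu> (R U)"
    unfolding mode_B[OF 2, symmetric] mode_diff[symmetric] e ..
  show "mode \<mu> (R U) - M \<mu> (mode \<mu> (R U)) = mode \<mu> U"
    unfolding mode_B[OF 1, symmetric] mode_diff[symmetric] R_eq[OF assms] ..
qed


subsection \<open>Uniform decay rates\<close>

definition rate :: real where "rate = \<alpha> / (2 * \<alpha> - \<beta>)"

text \<open>From \<open>\<alpha> > (\<beta> + 1) / 2 \<ge> \<beta>\<close> one gets
  \<open>\<alpha> \<le> 2 * \<alpha> - \<beta>\<close>, hence \<open>rate \<le> 1\<close>: decay of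
  order \<open>1 / t\<close> is never slower than the claimed rate.\<close>

lemma parameters:
  shows "0 \<le> \<beta>" "\<beta> \<le> 1" "\<alpha> \<le> 1" "(\<beta> + 1) / 2 < \<alpha>" "0 < 2 * \<alpha> - \<beta>" "0 < rate" "rate \<le> 1"
proof -
  show *: "0 \<le> \<beta>" "\<beta> \<le> 1" "\<alpha> \<le> 1" "(\<beta> + 1) / 2 < \<alpha>"
    using Q by (auto simp: Q_star_def)
  from *(4) have "\<beta> + 1 < 2 * \<alpha>"
    by simp
  then show "0 < 2 * \<alpha> - \<beta>"
    by simp
  then show "0 < rate" "rate \<le> 1"
    using * by (auto simp: rate_def divide_le_eq)
qed

lemma ex_strong_coupling:
  "\<exists>m\<ge>1. \<forall>\<mu>\<ge>m. strong_coupling (ca \<mu>) (cb \<mu>) (cc \<mu>) (1/\<tau>)"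
proof -
  \<comment> \<open>The excess exponent: \<open>cb \<mu>\<close> divided by
    \<open>\<mu> powr (1/2) * \<mu> powr (\<beta>/2)\<close> is \<open>\<mu> powr g\<close>, so the
    condition of \<open>strong_coupling\<close> holds once \<open>\<mu> \<ge> 1\<close> and
    \<open>\<mu> powr g\<close> reaches the constant \<open>k\<close>.\<close>
  define g where "g = \<alpha> - (1 + \<beta>) / 2"
  have "g > 0"
    using parameters(4) by (simp add: g_def add.commute)
  define k where "k = 1000 * (1 + 1/\<tau> + \<tau>) * ((1 + sqrt \<sigma>) * (1 + 1 / sqrt \<tau>))"
  have "k > 0"
    using sigma tau by (simp add: k_def add_pos_pos)
  have "strong_coupling (ca \<mu>) (cb \<mu>) (cc \<mu>) (1/\<tau>)" if \<mu>: "\<mu> \<ge> max 1 (k powr (1/g))" for \<mu>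
  proof
    have "\<mu> \<ge> 1"
      using \<mu> by simp
    then show "0 < ca \<mu>" "0 < cb \<mu>" "0 < cc \<mu>" "0 < 1/\<tau>"
      using coefficients_pos[of \<mu>] by auto
    have "k = (k powr (1/g)) powr g"
      using \<open>k > 0\<close> \<open>g > 0\<close> by (simp add: powr_powr)
    also have "\<dots> \<le> \<mu> powr g"
      using \<mu> \<open>g > 0\<close> by (intro powr_mono2) auto
    finally have k: "k \<le> \<mu> powr g" .
    have p1: "1 \<le> \<mu> powr (1/2)" "1 \<le> \<mu> powr (\<beta>/2)"
      using \<open>\<mu> \<ge> 1\<close> parameters(1) by (auto intro: ge_one_powr_ge_zero)
    have "1 + ca \<mu> \<le> (1 + sqrt \<sigma>) * \<mu> powr (1/2)"
      using p1 by (simp add: ca_def algebra_simps)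
    moreover have "1 + cc \<mu> \<le> (1 + 1 / sqrt \<tau>) * \<mu> powr (\<beta>/2)"
      using p1 by (simp add: cc_def algebra_simps)
    ultimately have "(1 + ca \<mu>) * (1 + cc \<mu>)
        \<le> ((1 + sqrt \<sigma>) * \<mu> powr (1/2)) * ((1 + 1 / sqrt \<tau>) * \<mu> powr (\<beta>/2))"
      using \<open>0 < ca \<mu>\<close> \<open>0 < cc \<mu>\<close> by (intro mult_mono) auto
    then have "1000 * (1 + 1/\<tau> + \<tau>) * ((1 + ca \<mu>) * (1 + cc \<mu>)) \<le> 1000 * (1 + 1/\<tau> + \<tau>) *
        (((1 + sqrt \<sigma>) * \<mu> powr (1/2)) * ((1 + 1 / sqrt \<tau>) * \<mu> powr (\<beta>/2)))"
      using tau by (intro mult_left_mono) auto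
    also have "\<dots> = k * (\<mu> powr (1/2) * \<mu> powr (\<beta>/2))"
      by (simp add: k_def)
    also have "\<dots> \<le> \<mu> powr g * (\<mu> powr (1/2) * \<mu> powr (\<beta>/2))"
      using k by (intro mult_right_mono) auto
    also have "\<dots> = cb \<mu>"
      by (simp add: cb_def g_def add_divide_distrib flip: powr_add)
    finally show "1000 * (1 + 1/\<tau> + 1 / (1/\<tau>)) * ((1 + ca \<mu>) * (1 + cc \<mu>)) \<le> cb \<mu>"
      by simp
  qed
  then show ?thesis
    by (intro exI[of _ "max 1 (k powr (1/g))"]) auto
qed

lemma damping_eq:
  assumes "\<mu> > 0"
  shows "1/\<tau> * (cc \<mu>)\<^sup>2 / (cb \<mu>)\<^sup>2 = \<mu> powr (\<beta> - 2 * \<alpha>) / \<tau>\<^sup>2"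
proof -
  have "(cc \<mu>)\<^sup>2 = \<mu> powr \<beta> / \<tau>" "(cb \<mu>)\<^sup>2 = \<mu> powr (2 * \<alpha>)"
    using assms tau by (auto simp: cc_def cb_def power_divide power2_eq_square simp flip: powr_add)
  then show ?thesis
    by (simp add: powr_diff power2_eq_square)
qed

text \<open>The origin of the exponent: with \<open>r = \<mu> powr (\<beta> - 2 * \<alpha>)\<close>
  the order of the damping, the size \<open>1 / cb \<mu>\<close> of the contribution is
  \<open>r powr rate\<close>, so one parameter governs both.\<close>

lemma cb_eq:
  assumes "\<mu> > 0"
  shows "1 / cb \<mu> = (\<mu> powr (\<beta> - 2 * \<alpha>)) powr rate"
proof -
  have "(\<beta> - 2 * \<alpha>) * rate = - \<alpha>"
    using parameters(5) by (simp add: rate_def field_simps)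
  then show ?thesis
    by (simp add: cb_def powr_powr powr_minus_divide)
qed

lemma inverse_le_rate:
  assumes "t \<ge> 1"
  shows "1 / t \<le> t powr (- rate)"
proof -
  have "t powr (- 1) \<le> t powr (- rate)"
    using assms parameters(7) by (intro powr_mono) auto
  then show ?thesis
    using assms by (simp add: powr_minus_divide)
qed

text \<open>Only the product \<open>x = r * t\<close> matters, since \<open>r powr rate\<close> is
  \<open>x powr rate * t powr (- rate)\<close>; the rest is bounded in \<open>x\<close> because
  \<open>x powr rate \<le> 1 + x\<close>. The bound is uniform in \<open>r\<close>, hence in the
  eigenvalue.\<close>

lemma exp_decay_le_rate:
  assumes "r > 0" "t > 0" "k > 0"
  shows "exp (- k * r * t) * r powr rate \<le> (1 + 1 / k) * t powr (- rate)"
proof -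
  define x where "x = r * t"
  have "x > 0"
    using assms by (simp add: x_def)
  have "x powr rate \<le> 1 + x"
  proof (cases "x \<le> 1")
    case True
    then have "x powr rate \<le> 1 powr rate"
      using \<open>x > 0\<close> parameters(6) by (intro powr_mono2) auto
    then show ?thesis
      using \<open>x > 0\<close> by simp
  next
    case False
    then have "x powr rate \<le> x powr 1"
      using parameters(7) by (intro powr_mono) auto
    then show ?thesis
      using \<open>x > 0\<close> by simp
  qed
  then have "exp (- (k * x)) * x powr rate \<le> exp (- (k * x)) * (1 + x)"
    by (intro mult_left_mono) auto
  also have "\<dots> \<le> 1 + 1 / k"
  proof -
    have "k * x \<le> exp (k * x)"
      using exp_ge_add_one_self[of "k * x"] by linarith
    then have "exp (- (k * x)) * (k * x) \<le> exp (- (k * x)) * exp (k * x)"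
      by (intro mult_left_mono) auto
    then have "k * (exp (- (k * x)) * x) \<le> 1"
      by (simp add: exp_minus mult.left_commute)
    then have "exp (- (k * x)) * x \<le> 1 / k"
      using assms by (simp add: pos_le_divide_eq mult.commute)
    moreover have "exp (- (k * x)) \<le> 1"
      using assms \<open>x > 0\<close> by simp
    ultimately show ?thesis
      unfolding distrib_left mult_1_right by (intro add_mono)
  qed
  finally have "exp (- (k * x)) * x powr rate \<le> 1 + 1 / k" .
  then have "exp (- (k * x)) * x powr rate * t powr (- rate) \<le> (1 + 1 / k) * t powr (- rate)"
    by (intro mult_right_mono) auto
  moreover have "r powr rate = x powr rate * t powr (- rate)"
    using assms by (simp add: x_def powr_mult powr_minus_divide)
  ultimately show ?thesis
    by (simp add: x_def mult.assoc)
qed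

abbreviation orbit_from :: "real \<Rightarrow> 'h \<times> 'h \<times> 'h \<times> 'h \<Rightarrow> 'h \<times> 'h \<times> 'h \<times> 'h" where
  "orbit_from t U \<equiv> T t (B (R (R U)))"

lemma mode_decay_large:
  assumes "strong_coupling (ca \<mu>) (cb \<mu>) (cc \<mu>) (1/\<tau>)" "\<mu> > 0" "U \<in> X" "t \<ge> 1"
  shows "norm (mode \<mu> (orbit_from t U)) \<le> 1000 * (2 + 12 * \<tau>\<^sup>2) * t powr (- rate) * norm (mode \<mu> U)"
proof -
  interpret strong_coupling "ca \<mu>" "cb \<mu>" "cc \<mu>" "1/\<tau>"
    by fact
  define r where "r = \<mu> powr (\<beta> - 2 * \<alpha>)"
  have "r > 0"
    using assms(2) by (simp add: r_def)
  have "1/\<tau> * (cc \<mu>)\<^sup>2 / (12 * (cb \<mu>)\<^sup>2) = (1/\<tau> * (cc \<mu>)\<^sup>2 / (cb \<mu>)\<^sup>2) / 12"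
    by simp
  also have "\<dots> = 1 / (12 * \<tau>\<^sup>2) * r"
    unfolding damping_eq[OF assms(2)] r_def by simp
  finally have e: "1/\<tau> * (cc \<mu>)\<^sup>2 / (12 * (cb \<mu>)\<^sup>2) = 1 / (12 * \<tau>\<^sup>2) * r" .
  have cbr: "r powr rate = 1 / cb \<mu>"
    unfolding r_def by (rule cb_eq[OF assms(2), symmetric])
  have "exp (- (1/\<tau> * (cc \<mu>)\<^sup>2 / (12 * (cb \<mu>)\<^sup>2)) * t) / cb \<mu>
      = exp (- (1 / (12 * \<tau>\<^sup>2)) * r * t) * r powr rate"
    unfolding e cbr by simp
  also have "\<dots> \<le> (1 + 1 / (1 / (12 * \<tau>\<^sup>2))) * t powr (- rate)"
    using \<open>r > 0\<close> assms(4) tau by (intro exp_decay_le_rate) auto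
  finally have "1 / t + exp (- (1/\<tau> * (cc \<mu>)\<^sup>2 / (12 * (cb \<mu>)\<^sup>2)) * t) / cb \<mu>
      \<le> t powr (- rate) + (1 + 1 / (1 / (12 * \<tau>\<^sup>2))) * t powr (- rate)"
    by (intro add_mono inverse_le_rate assms(4))
  also have "\<dots> = (2 + 12 * \<tau>\<^sup>2) * t powr (- rate)"
    by (simp add: algebra_simps)
  finally have f: "1000 * (1 / t + exp (- (1/\<tau> * (cc \<mu>)\<^sup>2 / (12 * (cb \<mu>)\<^sup>2)) * t) / cb \<mu>) * norm (mode \<mu> U)
      \<le> 1000 * ((2 + 12 * \<tau>\<^sup>2) * t powr (- rate)) * norm (mode \<mu> U)"
    by (intro mult_right_mono mult_left_mono) auto
  have "norm (mode \<mu> (orbit_from t U))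
      \<le> 1000 * (1 / t + exp (- (1/\<tau> * (cc \<mu>)\<^sup>2 / (12 * (cb \<mu>)\<^sup>2)) * t) / cb \<mu>) * norm (mode \<mu> U)"
    using assms(4) by (intro orbit_bound[OF orbit(2)[OF assms(3)] _ orbit(3-5)[OF assms(3)]]) auto
  from order_trans[OF this f] show ?thesis
    by (simp only: mult.assoc)
qed

text \<open>Exponential decay is faster than \<open>1 / t\<close>, which is no slower than the rate.
  The constant depends on \<open>\<mu>\<close>.\<close>

lemma mode_decay_small:
  assumes "\<mu> > 0"
  shows "\<exists>C\<ge>0. \<forall>U\<in>X. \<forall>t\<ge>1. norm (mode \<mu> (orbit_from t U)) \<le> C * t powr (- rate) * norm (mode \<mu> U)"
proof -
  obtain C k where "C > 0" "k > 0"
    and dec: "\<And>(y :: real \<Rightarrow> 'h \<times> 'h \<times> 'h \<times> 'h) t. solves (ca \<mu>) (cb \<mu>) (cc \<mu>) (1/\<tau>) y \<Longrightarrow> t \<ge> 0 \<Longrightarrow>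
      norm (y t) \<le> C * exp (- k * t) * norm (y 0)"
    using exponential_decay[OF coefficients_pos(1-4)[OF assms], where 'a = 'h] by blast
  have "norm (mode \<mu> (orbit_from t U)) \<le> (2 * C / k) * t powr (- rate) * norm (mode \<mu> U)"
    if U: "U \<in> X" and "t \<ge> 1" for U t
  proof -
    have "norm (mode \<mu> (R (R U))) \<le> norm (mode \<mu> (R U))" "norm (mode \<mu> (R U)) \<le> norm (mode \<mu> U)"
      using norm_le_norm_minus_gen[of "1/\<tau>" _ "ca \<mu>" "cb \<mu>" "cc \<mu>"] tau orbit(4,5)[OF U, of \<mu>]
      by (metis less_imp_le zero_less_divide_1_iff)+
    moreover have "mode \<mu> (orbit_from 0 U) = mode \<mu> (R (R U)) - mode \<mu> (R U)"
      using orbit(3)[OF U, of \<mu>] by (simp flip: orbit(4)[OF U])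
    ultimately have n0: "norm (mode \<mu> (orbit_from 0 U)) \<le> 2 * norm (mode \<mu> U)"
      using norm_triangle_ineq4[of "mode \<mu> (R (R U))" "mode \<mu> (R U)"] by simp
    have "k * t \<le> exp (k * t)"
      using exp_ge_add_one_self[of "k * t"] by linarith
    then have "exp (- k * t) \<le> 1 / (k * t)"
      using \<open>k > 0\<close> \<open>t \<ge> 1\<close> by (simp add: exp_minus inverse_eq_divide frac_le)
    also have "\<dots> = 1 / k * (1 / t)"
      by simp
    also have "\<dots> \<le> 1 / k * t powr (- rate)"
      using \<open>k > 0\<close> \<open>t \<ge> 1\<close> by (intro mult_left_mono inverse_le_rate) auto
    finally have "C * exp (- k * t) * norm (mode \<mu> (orbit_from 0 U))
        \<le> C * (1 / k * t powr (- rate)) * (2 * norm (mode \<mu> U))"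
      using \<open>C > 0\<close> \<open>k > 0\<close> n0 by (intro mult_mono mult_left_mono) auto
    then show ?thesis
      using dec[OF orbit(2)[OF U, of \<mu>], of t] \<open>t \<ge> 1\<close> by (simp add: mult_ac)
  qed
  then show ?thesis
    using \<open>C > 0\<close> \<open>k > 0\<close> by (intro exI[of _ "2 * C / k"]) auto
qed

lemma mode_decay:
  "\<exists>C\<ge>0. \<forall>\<mu>. \<forall>U\<in>X. \<forall>t\<ge>1. norm (mode \<mu> (orbit_from t U)) \<le> C * t powr (- rate) * norm (mode \<mu> U)"
proof -
  obtain m where "m \<ge> 1" and m: "\<And>\<mu>. \<mu> \<ge> m \<Longrightarrow> strong_coupling (ca \<mu>) (cb \<mu>) (cc \<mu>) (1/\<tau>)"
    using ex_strong_coupling by blast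
  define F where "F = {\<mu>. \<mu> \<le> m \<and> E \<mu> \<noteq> {0}}"
  have "finite F"
    unfolding F_def by (rule finite_eigenvalues_le)
  have pos: "\<mu> > 0" if "E \<mu> \<noteq> {0}" for \<mu>
  proof -
    have "0 \<in> E \<mu>"
      using subspace_E by (simp add: complex_subspace_iff)
    then have "\<not> E \<mu> \<subseteq> {0}"
      using that by auto
    then obtain z where "z \<in> E \<mu>" "z \<noteq> 0"
      by auto
    then show ?thesis
      by (rule eigenvalue_pos)
  qed
  have "\<forall>\<mu>\<in>F. \<exists>C. C \<ge> 0 \<and> (\<forall>U\<in>X. \<forall>t\<ge>1.
      norm (mode \<mu> (orbit_from t U)) \<le> C * t powr (- rate) * norm (mode \<mu> U))"
    using mode_decay_small pos by (auto simp: F_def)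
  from bchoice[OF this] obtain C where C: "\<forall>\<mu>\<in>F. C \<mu> \<ge> 0 \<and> (\<forall>U\<in>X. \<forall>t\<ge>1.
      norm (mode \<mu> (orbit_from t U)) \<le> C \<mu> * t powr (- rate) * norm (mode \<mu> U))" ..
  \<comment> \<open>One constant for all modes: the uniform one for large eigenvalues plus the
    finitely many for the others.\<close>
  define K where "K = 1000 * (2 + 12 * \<tau>\<^sup>2) + (\<Sum>\<mu>\<in>F. C \<mu>)"
  have "(\<Sum>\<mu>\<in>F. C \<mu>) \<ge> 0"
    using C by (intro sum_nonneg) auto
  then have K: "K \<ge> 0" "1000 * (2 + 12 * \<tau>\<^sup>2) \<le> K"
    by (auto simp: K_def)
  have KC: "C \<mu> \<le> K" if "\<mu> \<in> F" for \<mu>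
    unfolding K_def using member_le_sum[of \<mu> F C] that C \<open>finite F\<close> by (auto intro: add_increasing)
  have "norm (mode \<mu> (orbit_from t U)) \<le> K * t powr (- rate) * norm (mode \<mu> U)"
    if U: "U \<in> X" and t: "t \<ge> 1" for \<mu> U t
  proof -
    consider "E \<mu> = {0}" | "\<mu> \<in> F" | "E \<mu> \<noteq> {0}" "m \<le> \<mu>"
      unfolding F_def by fastforce
    then show ?thesis
    proof cases
      case 1
      then show ?thesis
        by (simp add: mode_trivial)
    next
      case 2
      then have "norm (mode \<mu> (orbit_from t U)) \<le> C \<mu> * t powr (- rate) * norm (mode \<mu> U)"
        using C U t by blast
      also have "\<dots> \<le> K * t powr (- rate) * norm (mode \<mu> U)"
        using KC[OF 2] by (intro mult_right_mono) auto
      finally show ?thesis .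
    next
      case 3
      have "norm (mode \<mu> (orbit_from t U)) \<le> 1000 * (2 + 12 * \<tau>\<^sup>2) * t powr (- rate) * norm (mode \<mu> U)"
        by (rule mode_decay_large[OF m[OF 3(2)] pos[OF 3(1)] U t])
      also have "\<dots> \<le> K * t powr (- rate) * norm (mode \<mu> U)"
        using K(2) by (intro mult_right_mono) auto
      finally show ?thesis .
    qed
  qed
  then show ?thesis
    using K(1) by blast
qed

section \<open>Operator norm: upper bound and sharpness\<close>

lemma operator_norm_upper:
  "\<exists>C. \<forall>t\<ge>1. operator_norm X N (orbit_from t) \<le> ennreal (C * t powr (- rate))"
proof -
  obtain C where "C \<ge> 0" and C: "\<And>\<mu> U t. U \<in> X \<Longrightarrow> t \<ge> 1 \<Longrightarrow>
      norm (mode \<mu> (orbit_from t U)) \<le> C * t powr (- rate) * norm (mode \<mu> U)"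
    using mode_decay by blast
  have "N (orbit_from t U) \<le> C * t powr (- rate)" if U: "U \<in> X" "N U \<le> 1" and t: "t \<ge> 1" for U t
  proof -
    have TX: "orbit_from t U \<in> X"
      using t by (intro T_in_X DB_in_X orbit(1) U) auto
    \<comment> \<open>The mode estimates share one factor, so squaring and summing them by Parseval
      transfers them to the state norm.\<close>
    have "(N (orbit_from t U))\<^sup>2 \<le> (C * t powr (- rate))\<^sup>2 * (N U)\<^sup>2"
    proof (rule has_sum_mono[OF state_norm_has_sum[OF TX] has_sum_cmult_right[OF state_norm_has_sum[OF U(1)]]])
      fix \<mu>
      show "(norm (mode \<mu> (orbit_from t U)))\<^sup>2 \<le> (C * t powr (- rate))\<^sup>2 * (norm (mode \<mu> U))\<^sup>2"
        unfolding power_mult_distrib[symmetric] by (intro power_mono C U t) auto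
    qed
    also have "\<dots> \<le> (C * t powr (- rate))\<^sup>2 * 1"
      using U N_nonneg[OF U(1)] by (intro mult_left_mono) (auto intro: power_le_one)
    finally show ?thesis
      using \<open>C \<ge> 0\<close> by (intro power2_le_imp_le[of "N (orbit_from t U)"]) auto
  qed
  then show ?thesis
    unfolding operator_norm_def by (intro exI[of _ C] allI impI SUP_least ennreal_leI) auto
qed

text \<open>The test state is a unit eigenvector in the velocity and zero elsewhere. By time
  \<open>t\<close> the damping has accumulated a total independent of \<open>\<mu>\<close>, so the
  exponential is a constant and the factor \<open>1 / cb \<mu> = t powr (- rate)\<close>
  remains.\<close>

lemma operator_norm_lower:
  assumes sc: "strong_coupling (ca \<mu>) (cb \<mu>) (cc \<mu>) (1/\<tau>)" and "\<mu> > 0" and \<phi>: "\<phi> \<in> E \<mu>" "norm \<phi> = 1"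
    and t: "t = \<mu> powr (2 * \<alpha> - \<beta>)"
  shows "ennreal (exp (- (2 / \<tau>\<^sup>2)) / 96 * t powr (- rate)) \<le> operator_norm X N (orbit_from t)"
proof -
  interpret strong_coupling "ca \<mu>" "cb \<mu>" "cc \<mu>" "1/\<tau>"
    by fact
  define U where "U = (0 :: 'h, \<phi>, 0 :: 'h, 0 :: 'h)"
  have vec0: "vector_of D A (fractional_power D A (1/2) 0) = 0"
    by (rule vector_of_eq) (simp add: fractional_power_apply P_zero)
  have U: "U \<in> X"
    unfolding U_def X_iff by (rule in_H_I[of _ 0]) (simp add: fractional_power_apply P_zero)
  have "N U = 1"
    using \<phi>(2) by (simp add: U_def state_norm_def state_inner_def vec0 cinner_self_eq)
  have mode_U: "mode \<mu> U = (0, \<phi>, 0, 0)"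
    by (simp add: U_def mode_def P_zero P_same[OF \<phi>(1)])
  have "t > 0"
    using \<open>\<mu> > 0\<close> by (simp add: t)
  have r: "\<mu> powr (\<beta> - 2 * \<alpha>) = 1 / t"
    unfolding t by (simp add: powr_minus_divide[symmetric])
  have "2 * (1/\<tau>) * (cc \<mu>)\<^sup>2 / (cb \<mu>)\<^sup>2 = 2 * (1/\<tau> * (cc \<mu>)\<^sup>2 / (cb \<mu>)\<^sup>2)"
    by simp
  also have "\<dots> = 2 / \<tau>\<^sup>2 * (1 / t)"
    unfolding damping_eq[OF \<open>\<mu> > 0\<close>] r by simp
  finally have e: "2 * (1/\<tau>) * (cc \<mu>)\<^sup>2 / (cb \<mu>)\<^sup>2 = 2 / \<tau>\<^sup>2 * (1 / t)" .
  have cbt: "1 / cb \<mu> = t powr (- rate)"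
    unfolding cb_eq[OF \<open>\<mu> > 0\<close>] r using \<open>t > 0\<close> by (simp add: powr_divide powr_minus_divide)
  have "exp (- (2 / \<tau>\<^sup>2)) / 96 * t powr (- rate)
      = exp (- (2 * (1/\<tau>) * (cc \<mu>)\<^sup>2 / (cb \<mu>)\<^sup>2) * t) / (96 * cb \<mu>) * norm \<phi>"
    unfolding e cbt[symmetric] using \<open>t > 0\<close> \<phi>(2) by simp
  also have "\<dots> \<le> norm (mode \<mu> (orbit_from t U))"
    using \<open>t > 0\<close> orbit(5)[OF U, of \<mu>] unfolding mode_U
    by (intro orbit_lower_bound[OF orbit(2)[OF U] _ orbit(3,4)[OF U]]) auto
  also have "\<dots> \<le> N (orbit_from t U)"
    using \<open>t > 0\<close> by (intro norm_mode_le T_in_X DB_in_X orbit(1) U) auto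
  finally have "ennreal (exp (- (2 / \<tau>\<^sup>2)) / 96 * t powr (- rate)) \<le> ennreal (N (orbit_from t U))"
    by (rule ennreal_leI)
  also have "\<dots> \<le> operator_norm X N (orbit_from t)"
    unfolding operator_norm_def using U \<open>N U = 1\<close> by (intro SUP_upper) auto
  finally show ?thesis .
qed

text \<open>Eigenvalues tending to infinity give arbitrarily late times at which the lower bound
  holds, and there an extra factor \<open>t powr (- \<delta>)\<close> would be too small.\<close>

lemma rate_sharp:
  assumes inf: "infinite_dimensional TYPE('h)" and "\<delta> > 0"
  shows "\<not> (\<forall>\<^sub>F t in at_top. operator_norm X N (orbit_from t) \<le> ennreal (C * t powr (- rate - \<delta>)))"
proof
  assume ev: "\<forall>\<^sub>F t in at_top. operator_norm X N (orbit_from t) \<le> ennreal (C * t powr (- rate - \<delta>))"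
  define c where "c = exp (- (2 / \<tau>\<^sup>2)) / 96"
  have "c > 0"
    by (simp add: c_def)
  have "\<forall>\<^sub>F t :: real in at_top. t powr \<delta> > C / c"
    using eventually_ge_at_top[of "(\<bar>C / c\<bar> + 1) powr (1 / \<delta>)"]
  proof eventually_elim
    case (elim t)
    have "\<bar>C / c\<bar> + 1 = ((\<bar>C / c\<bar> + 1) powr (1 / \<delta>)) powr \<delta>"
      using \<open>\<delta> > 0\<close> by (simp add: powr_powr)
    also have "\<dots> \<le> t powr \<delta>"
      using elim \<open>\<delta> > 0\<close> by (intro powr_mono2) auto
    finally show ?case
      by linarith
  qed
  then have "\<forall>\<^sub>F t in at_top. t powr \<delta> > C / c \<and>
      operator_norm X N (orbit_from t) \<le> ennreal (C * t powr (- rate - \<delta>))"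
    using ev by (rule eventually_conj)
  then obtain t0 where t0: "\<And>t. t \<ge> t0 \<Longrightarrow> t powr \<delta> > C / c \<and>
      operator_norm X N (orbit_from t) \<le> ennreal (C * t powr (- rate - \<delta>))"
    by (auto simp: eventually_at_top_linorder)
  obtain m where "m \<ge> 1" and m: "\<And>\<mu>. \<mu> \<ge> m \<Longrightarrow> strong_coupling (ca \<mu>) (cb \<mu>) (cc \<mu>) (1/\<tau>)"
    using ex_strong_coupling by blast
  define s where "s = 2 * \<alpha> - \<beta>"
  have "s > 0"
    using parameters(5) by (simp add: s_def)
  \<comment> \<open>An eigenvalue beyond \<open>m\<close> is in the regime of strong coupling, and
    beyond \<open>max 1 t0 powr (1/s)\<close> its time \<open>\<mu> powr s\<close> is past
    \<open>t0\<close>.\<close>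
  obtain \<mu> \<phi> where \<mu>: "\<mu> > max m (max 1 t0 powr (1/s))" and \<phi>: "\<phi> \<in> E \<mu>" "norm \<phi> = 1"
    using eigenvalues_unbounded[OF inf] by blast
  define t where "t = \<mu> powr s"
  have "\<mu> > 0"
    using \<mu> \<open>m \<ge> 1\<close> by simp
  have "max 1 t0 = (max 1 t0 powr (1/s)) powr s"
    using \<open>s > 0\<close> by (simp add: powr_powr)
  also have "\<dots> \<le> t"
    unfolding t_def using \<mu> \<open>s > 0\<close> by (intro powr_mono2) auto
  finally have "t \<ge> t0" "t \<ge> 1"
    by auto
  have "ennreal (c * t powr (- rate)) \<le> operator_norm X N (orbit_from t)"
    unfolding c_def by (rule operator_norm_lower[OF m _ \<phi>]) (use \<mu> \<open>\<mu> > 0\<close> in \<open>auto simp: t_def s_def\<close>)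
  also have "\<dots> \<le> ennreal (C * t powr (- rate - \<delta>))"
    using t0[OF \<open>t \<ge> t0\<close>] by simp
  \<comment> \<open>\<open>ennreal\<close> sends negative numbers to 0, so the comparison passes to
    the reals only because the left side is positive; this also excludes a nonpositive
    \<open>C\<close>.\<close>
  finally have "c * t powr (- rate) \<le> C * t powr (- rate - \<delta>)"
    using \<open>c > 0\<close> \<open>t \<ge> 1\<close> by (subst (asm) ennreal_le_iff2) (auto simp: not_le mult_le_0_iff)
  also have "t powr (- rate - \<delta>) = t powr (- rate) * t powr (- \<delta>)"
    by (simp flip: powr_add)
  finally have "c \<le> C * t powr (- \<delta>)"
    using \<open>t \<ge> 1\<close> by (simp add: mult.left_commute)
  then have "c * t powr \<delta> \<le> C"
    using \<open>t \<ge> 1\<close> by (simp add: powr_minus_divide pos_le_divide_eq)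
  moreover have "C / c < t powr \<delta>"
    using t0[OF \<open>t \<ge> t0\<close>] by simp
  ultimately show False
    using \<open>c > 0\<close> by (simp add: pos_divide_less_eq mult.commute)
qed

end

theorem theorem2p7:
  fixes D :: "'h::complex_hilbert set" and A :: "'h \<Rightarrow> 'h"
    and \<sigma> \<tau> \<alpha> \<beta> :: real
    and T :: "real \<Rightarrow> 'h \<times> 'h \<times> 'h \<times> 'h \<Rightarrow> 'h \<times> 'h \<times> 'h \<times> 'h"
  defines "X \<equiv> state_space D A"
    and "N \<equiv> state_norm D A \<sigma> \<tau>"
    and "DB \<equiv> system_domain D A \<sigma> \<alpha> \<beta>"
    and "B \<equiv> system_operator D A \<sigma> \<tau> \<alpha> \<beta>"
  defines "R \<equiv> resolvent DB B 1"
  assumes "infinite_dimensional TYPE('h)"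
    and "self_adjoint D A" and "positive_definite D A" and "compact_resolvent D A"
    and "\<sigma> > 0" and "\<tau> > 0" and "(\<alpha>, \<beta>) \<in> Q_star"
    and "contraction_semigroup X N T" and "is_generator X N T DB B"
  shows "(\<exists>C. \<forall>t\<ge>1. operator_norm X N (\<lambda>U. T t (B (R (R U))))
              \<le> ennreal (C * t powr (- (\<alpha> / (2 * \<alpha> - \<beta>))))) \<and>
         \<not> (\<exists>\<delta>>0. \<exists>C. \<forall>\<^sub>F t in at_top. operator_norm X N (\<lambda>U. T t (B (R (R U))))
              \<le> ennreal (C * t powr (- (\<alpha> / (2 * \<alpha> - \<beta>)) - \<delta>)))"
proof -
  interpret thermoelastic_semigroup D A \<sigma> \<tau> \<alpha> \<beta> T
    using assms(7-14) unfolding X_def N_def DB_def B_def by unfold_locales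
  show ?thesis
    using operator_norm_upper rate_sharp[OF assms(6)]
    unfolding rate_def R_def X_def N_def DB_def B_def by blast
qed

end
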